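(* Let $\Omega\subset\mathbb R^2$ be an admissible domain with $\partial\Omega=\mathcal F\cup\mathcal B$ satisfying the John condition $\Omega\subset\mathcal F\times(-\infty,0)$. Let $\eta_1\le\eta_2\le\cdots$ be the mixed Steklov--Dirichlet eigenvalues of $\Omega$. Then for every $z>0$ $$R^\Omega_1(z,\mathcal D_D)=\sum_j(z-\eta_j)_+\ \le\ \frac{|\mathcal F|}{2\pi}z^2-\frac12 z+\frac{\pi}{2|\mathcal F|}.$$
   Context: Admissible domain in $\mathbb R^2$: a bounded domain $\Omega\subset\mathbb R^2$ with Lipschitz, piecewise smooth boundary $\partial\Omega=\mathcal F\cup\mathcal B$, $\mathcal F\subset\{x_2=0\}$, $\mathcal B\subset\{x_2<0\}$, where $\mathcal F$ has positive length $|\mathcal F|$. $\mathcal F$ is identified with a subset of $\mathbb R$. Steklov--Dirichlet eigenvalues of $\Omega$: the numbers $0<\eta_1\le\eta_2\le\cdots\nearrow\infty$ (counted with multiplicity) for which $\Delta f=0$ in $\Omega$, $f=0$ on $\mathcal B$, $\partial f/\partial x_2=\eta f$ on $\mathcal F$ has a nontrivial (weak) solution; equivalently, the eigenvalues given by min-max for $\int_\Omega|\nabla f|^2dx/\int_{\mathcal F}|f|^2ds$ over $f\in H^1(\Omega)$ with $f=0$ on $\mathcal B$. They are the eigenvalues of the Dirichlet-to-Neumann operator $\mathcal D_D$ on $L^2(\mathcal F)$. $(t)_+=\max\{0,t\}$. *)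

theory Defs
  imports "HOL-Analysis.Analysis"
begin

text \<open>The plane is \<open>real \<times> real\<close>, so that \<open>x\<^sub>1 = fst x\<close> and \<open>x\<^sub>2 = snd x\<close>. The free part of the
  boundary is given by a set \<open>F\<close> of reals and sits in the plane as \<open>F \<times> {0}\<close>.\<close>

primrec Ck :: "nat \<Rightarrow> ('a::euclidean_space \<Rightarrow> 'b::real_normed_vector) \<Rightarrow> bool" where
  "Ck 0 f \<longleftrightarrow> continuous_on UNIV f"
| "Ck (Suc k) f \<longleftrightarrow> f differentiable_on UNIV \<and> (\<forall>v. Ck k (\<lambda>x. frechet_derivative f (at x) v))"

definition smooth :: "('a::euclidean_space \<Rightarrow> 'b::real_normed_vector) \<Rightarrow> bool" where
  "smooth f \<longleftrightarrow> (\<forall>k. Ck k f)"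


subsection \<open>Admissible domains\<close>

text \<open>Near each boundary point the domain is, in suitable orthonormal coordinates, the
  region strictly on one side of the graph of a Lipschitz function.\<close>

definition lipschitz_boundary :: "(real \<times> real) set \<Rightarrow> bool" where
  "lipschitz_boundary \<Omega> \<longleftrightarrow>
    (\<forall>p\<in>frontier \<Omega>. \<exists>U T \<phi> C. open U \<and> p \<in> U \<and> orthogonal_transformation T \<and>
       C-lipschitz_on UNIV (\<phi> :: real \<Rightarrow> real) \<and>
       \<Omega> \<inter> U = {x \<in> U. \<phi> (fst (T x)) < snd (T x)})"

text \<open>Regular arcs that are smooth up to and including their endpoints. Only the values of
  \<open>\<gamma>\<close> on \<open>{0..1}\<close> matter geometrically; elsewhere \<open>\<gamma>\<close> is a smooth extension.\<close>

definition smooth_arc :: "(real \<Rightarrow> real \<times> real) \<Rightarrow> bool" where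
  "smooth_arc \<gamma> \<longleftrightarrow> arc \<gamma> \<and> smooth \<gamma> \<and> (\<forall>t\<in>{0..1}. vector_derivative \<gamma> (at t) \<noteq> 0)"

definition piecewise_smooth :: "(real \<times> real) set \<Rightarrow> bool" where
  "piecewise_smooth S \<longleftrightarrow>
    (\<exists>\<Gamma>. finite \<Gamma> \<and> (\<forall>\<gamma>\<in>\<Gamma>. smooth_arc \<gamma>) \<and> S = (\<Union>\<gamma>\<in>\<Gamma>. path_image \<gamma>) \<and>
       pairwise (\<lambda>\<gamma> \<delta>. \<gamma> ` {0<..<1} \<inter> path_image \<delta> = {}) \<Gamma>)"

definition admissible_domain ::
    "(real \<times> real) set \<Rightarrow> real set \<Rightarrow> (real \<times> real) set \<Rightarrow> bool" where
  "admissible_domain \<Omega> F B \<longleftrightarrow>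
     open \<Omega> \<and> connected \<Omega> \<and> \<Omega> \<noteq> {} \<and> bounded \<Omega> \<and>
     lipschitz_boundary \<Omega> \<and> piecewise_smooth (frontier \<Omega>) \<and>
     frontier \<Omega> = F \<times> {0} \<union> B \<and> B \<subseteq> {x. snd x < 0} \<and>
     measure lebesgue F > 0"


subsection \<open>The Sobolev space and boundary values\<close>

definition square_integrable :: "'a measure \<Rightarrow> ('a \<Rightarrow> 'b::euclidean_space) \<Rightarrow> bool" where
  "square_integrable M f \<longleftrightarrow> f \<in> borel_measurable M \<and> integrable M (\<lambda>x. (norm (f x))\<^sup>2)"

definition test_function :: "(real \<times> real) set \<Rightarrow> (real \<times> real \<Rightarrow> real) \<Rightarrow> bool" where
  "test_function \<Omega> \<phi> \<longleftrightarrow> smooth \<phi> \<and>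
     compact (closure {x. \<phi> x \<noteq> 0}) \<and> closure {x. \<phi> x \<noteq> 0} \<subseteq> \<Omega>"

definition is_weak_gradient ::
    "(real \<times> real) set \<Rightarrow> (real \<times> real \<Rightarrow> real) \<Rightarrow> (real \<times> real \<Rightarrow> real \<times> real) \<Rightarrow> bool" where
  "is_weak_gradient \<Omega> u G \<longleftrightarrow>
    (\<forall>\<phi> e. test_function \<Omega> \<phi> \<longrightarrow>
       (LINT x|lebesgue_on \<Omega>. u x * frechet_derivative \<phi> (at x) e) =
       - (LINT x|lebesgue_on \<Omega>. (G x \<bullet> e) * \<phi> x))"

definition H1 :: "(real \<times> real) set \<Rightarrow> (real \<times> real \<Rightarrow> real) set" where
  "H1 \<Omega> = {u. square_integrable (lebesgue_on \<Omega>) u \<and>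
              (\<exists>G. square_integrable (lebesgue_on \<Omega>) G \<and> is_weak_gradient \<Omega> u G)}"

text \<open>The choice below is immaterial: weak gradients are unique almost everywhere.\<close>

definition weak_grad ::
    "(real \<times> real) set \<Rightarrow> (real \<times> real \<Rightarrow> real) \<Rightarrow> real \<times> real \<Rightarrow> real \<times> real" where
  "weak_grad \<Omega> u = (SOME G. square_integrable (lebesgue_on \<Omega>) G \<and> is_weak_gradient \<Omega> u G)"

definition H1_norm :: "(real \<times> real) set \<Rightarrow> (real \<times> real \<Rightarrow> real) \<Rightarrow> real" where
  "H1_norm \<Omega> u = sqrt ((LINT x|lebesgue_on \<Omega>. (u x)\<^sup>2) +
                      (LINT x|lebesgue_on \<Omega>. (norm (weak_grad \<Omega> u x))\<^sup>2))"

text \<open>\<open>u \<in> H\<^sup>1(\<Omega>)\<close> vanishes on \<open>B\<close> and has the trace \<open>g \<in> L\<^sup>2(F)\<close> on \<open>F\<close>. As usual both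
  are obtained by density: \<open>u\<close> belongs to the \<open>H\<^sup>1\<close>-closure of the functions smooth up to the
  boundary that are zero on \<open>B\<close>, and \<open>g\<close> is the \<open>L\<^sup>2(F)\<close>-limit of the restrictions to \<open>F\<close>.
  By the trace theorem \<open>g\<close> is determined by \<open>u\<close> when the boundary is Lipschitz.\<close>

definition dirichlet_trace :: "(real \<times> real) set \<Rightarrow> real set \<Rightarrow> (real \<times> real) set \<Rightarrow>
    (real \<times> real \<Rightarrow> real) \<Rightarrow> (real \<Rightarrow> real) \<Rightarrow> bool" where
  "dirichlet_trace \<Omega> F B u g \<longleftrightarrow>
     u \<in> H1 \<Omega> \<and> square_integrable (lebesgue_on F) g \<and>
     (\<exists>\<phi> :: nat \<Rightarrow> real \<times> real \<Rightarrow> real.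
        (\<forall>n. smooth (\<phi> n) \<and> (\<forall>x\<in>B. \<phi> n x = 0)) \<and>
        (\<lambda>n. H1_norm \<Omega> (\<lambda>x. \<phi> n x - u x)) \<longlonglongrightarrow> 0 \<and>
        (\<lambda>n. LINT s|lebesgue_on F. (\<phi> n (s, 0) - g s)\<^sup>2) \<longlonglongrightarrow> 0)"


subsection \<open>Steklov--Dirichlet eigenvalues\<close>

text \<open>Weak solutions, including zero, of \<open>\<Delta>u = 0\<close> in \<open>\<Omega>\<close>, \<open>u = 0\<close> on \<open>B\<close> and
  \<open>\<partial>u/\<partial>x\<^sub>2 = \<mu>u\<close> on \<open>F\<close>.\<close>

definition steklov_eigenspace :: "(real \<times> real) set \<Rightarrow> real set \<Rightarrow> (real \<times> real) set \<Rightarrow>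
    real \<Rightarrow> (real \<times> real \<Rightarrow> real) set" where
  "steklov_eigenspace \<Omega> F B \<mu> =
    {u. \<exists>g. dirichlet_trace \<Omega> F B u g \<and>
       (\<forall>v h. dirichlet_trace \<Omega> F B v h \<longrightarrow>
          (LINT x|lebesgue_on \<Omega>. weak_grad \<Omega> u x \<bullet> weak_grad \<Omega> v x) =
          \<mu> * (LINT s|lebesgue_on F. g s * h s))}"

text \<open>\<open>V\<close> has dimension \<open>m\<close> when functions that agree almost everywhere on \<open>\<Omega>\<close> are
  identified: the list \<open>b\<^sub>0, \<dots>, b\<^bsub>m-1\<^esub>\<close> represents a basis.\<close>

definition has_dimension_ae ::
    "(real \<times> real) set \<Rightarrow> (real \<times> real \<Rightarrow> real) set \<Rightarrow> nat \<Rightarrow> bool" where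
  "has_dimension_ae \<Omega> V m \<longleftrightarrow>
    (\<exists>b :: nat \<Rightarrow> real \<times> real \<Rightarrow> real.
       (\<forall>i<m. b i \<in> V) \<and>
       (\<forall>c :: nat \<Rightarrow> real. (AE x in lebesgue_on \<Omega>. (\<Sum>i<m. c i * b i x) = 0) \<longrightarrow> (\<forall>i<m. c i = 0)) \<and>
       (\<forall>v\<in>V. \<exists>c :: nat \<Rightarrow> real. AE x in lebesgue_on \<Omega>. v x = (\<Sum>i<m. c i * b i x)))"

text \<open>\<open>\<eta> 0 \<le> \<eta> 1 \<le> \<dots>\<close> is the sequence of eigenvalues, each repeated according to its
  multiplicity. Indices start at 0, so \<open>\<eta> j\<close> is the eigenvalue usually written
  \<open>\<eta>\<^bsub>j+1\<^esub>\<close>. For a number that is not an eigenvalue the last condition says that it does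
  not occur in the sequence.\<close>

definition steklov_dirichlet_eigenvalues ::
    "(real \<times> real) set \<Rightarrow> real set \<Rightarrow> (real \<times> real) set \<Rightarrow> (nat \<Rightarrow> real) \<Rightarrow> bool" where
  "steklov_dirichlet_eigenvalues \<Omega> F B \<eta> \<longleftrightarrow>
     (\<forall>j. 0 < \<eta> j) \<and> incseq \<eta> \<and> filterlim \<eta> at_top sequentially \<and>
     (\<forall>\<mu>. has_dimension_ae \<Omega> (steklov_eigenspace \<Omega> F B \<mu>) (card {j. \<eta> j = \<mu>}))"

text \<open>The first-order Riesz mean. All but finitely many terms vanish when \<open>\<eta>\<close> tends to
  infinity.\<close>

definition riesz_mean_1 :: "(nat \<Rightarrow> real) \<Rightarrow> real \<Rightarrow> real" where
  "riesz_mean_1 \<eta> z = (\<Sum>j. max 0 (z - \<eta> j))"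

end

theory Submission
  imports Defs
begin

text \<open>The John condition and the shape of the boundary force \<open>F = {a..b}\<close> and place \<open>\<Omega>\<close> in the
  half-strip \<open>{a<..<b} \<times> {..<0}\<close>, whose eigenvalues are \<open>k\<^sub>n = n\<pi> / (b - a)\<close>. Domain monotonicity gives
  \<open>\<eta>\<^sub>n \<ge> k\<^sub>n\<close>: testing the gradient of \<open>u\<close> against the harmonic extension of a sine polynomial bounds
  the Dirichlet energy of \<open>u\<close> below by \<open>(2 / (b - a)) \<Sum> k\<^sub>n B\<^sub>n\<^sup>2\<close>, where \<open>B\<^sub>n\<close> are the sine coefficients
  of the trace, and among the combinations of the first \<open>n\<close> eigenfunctions there is one that is orthogonal
  to the first \<open>n - 1\<close> sines. It remains to sum: \<open>\<Sum> (z - nq)\<^sub>+ \<le> z\<^sup>2 / (2q) - z / 2 + q / 2\<close> for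
  \<open>q = \<pi> / (b - a)\<close>. Only trial fields multiplied by functions vanishing on \<open>B\<close> are integrated by parts,
  so slicing and the fundamental theorem of calculus replace the divergence theorem.\<close>

subsection \<open>Smooth functions\<close>

text \<open>Domain monotonicity is usually read off from min-max by extending functions by zero to
  the half-strip. Here the eigenvalues are given only through dimensions of spaces of weak
  solutions, and Sobolev functions only as limits of smooth functions vanishing on \<open>B\<close>.
  The extension is therefore replaced by duality: the trial field is defined on the whole plane and
  divergence-free, and Cauchy-Schwarz uses it on \<Omega> alone, so that enlarging the domain
  affects just the explicit energy of the field. Of min-max one half suffices: an energy bound on
  the span of finitely many eigenfunctions and their independence, both consequences of the
  orthogonality of different eigenspaces. Turning sine coefficients back into the norm of the trace
  requires completeness of the sines, which comes from Weierstrass approximation in the variable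
  \<open>cos t\<close>. Slices of \<Omega> are treated as arbitrary bounded open sets, with no
  control of their components; this is why the integral of a derivative over such a set is computed
  in one piece and not component by component.\<close>

lemma Ck_Suc_imp_Ck: "Ck (Suc k) f \<Longrightarrow> Ck k f"
proof (induction k arbitrary: f)
  case 0
  then show ?case by (simp add: differentiable_imp_continuous_on)
next
  case (Suc k)
  then show ?case by (metis Ck.simps(2))
qed

lemma Ck_const: "Ck k (\<lambda>x. c)"
proof (induction k arbitrary: c)
  case 0
  then show ?case by simp
next
  case (Suc k)
  have "frechet_derivative (\<lambda>x::'a. c) (at x) v = 0" for x v
    by simp
  then show ?case using Suc by simp
qed

lemma frechet_derivative_eqI:
  "(f has_derivative f') (at x) \<Longrightarrow> frechet_derivative f (at x) v = f' v"
  using frechet_derivative_at by metis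

lemma differentiable_on_UNIV_has_derivative:
  "f differentiable_on UNIV \<Longrightarrow> (f has_derivative frechet_derivative f (at x)) (at x)"
  by (simp add: differentiable_on_def frechet_derivative_works)

lemma Ck_add: "Ck k f \<Longrightarrow> Ck k g \<Longrightarrow> Ck k (\<lambda>x. f x + g x)"
proof (induction k arbitrary: f g)
  case 0
  then show ?case by (simp add: continuous_on_add)
next
  case (Suc k)
  then have d: "f differentiable_on UNIV" "g differentiable_on UNIV" by auto
  have "frechet_derivative (\<lambda>x. f x + g x) (at x) v =
      frechet_derivative f (at x) v + frechet_derivative g (at x) v" for x v
    using d by (intro frechet_derivative_eqI has_derivative_add differentiable_on_UNIV_has_derivative)
  moreover have "(\<lambda>x. f x + g x) differentiable_on UNIV"
    using d by (rule differentiable_on_add)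
  ultimately show ?case using Suc by simp
qed

lemma Ck_mult:
  fixes f g :: "'a::euclidean_space \<Rightarrow> real"
  shows "Ck k f \<Longrightarrow> Ck k g \<Longrightarrow> Ck k (\<lambda>x. f x * g x)"
proof (induction k arbitrary: f g)
  case 0
  then show ?case by (simp add: continuous_on_mult)
next
  case (Suc k)
  then have d: "f differentiable_on UNIV" "g differentiable_on UNIV" by auto
  have "frechet_derivative (\<lambda>x. f x * g x) (at x) v =
      f x * frechet_derivative g (at x) v + frechet_derivative f (at x) v * g x" for x v
    using d by (intro frechet_derivative_eqI has_derivative_mult differentiable_on_UNIV_has_derivative)
  moreover have "(\<lambda>x. f x * g x) differentiable_on UNIV"
    using d by (rule differentiable_on_mult)
  moreover have "Ck k f" "Ck k g"
    using Suc.prems by (auto intro: Ck_Suc_imp_Ck simp del: Ck.simps)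
  ultimately show ?case using Suc by (auto intro!: Ck_add)
qed

text \<open>The polynomial factor makes the family closed under differentiation.\<close>

definition flat :: "real poly \<Rightarrow> real \<Rightarrow> real" where
  "flat p t = (if 0 < t then poly p (1 / t) * exp (- (1 / t)) else 0)"

lemma poly_times_exp_neg_tendsto_0:
  fixes p :: "real poly"
  shows "((\<lambda>s. poly p s * exp (- s)) \<longlongrightarrow> 0) at_top"
proof -
  have "((\<lambda>s. \<Sum>i\<le>degree p. coeff p i * (s ^ i / exp s)) \<longlongrightarrow> (\<Sum>i\<le>degree p. coeff p i * 0)) at_top"
    by (intro tendsto_sum tendsto_mult tendsto_const tendsto_power_div_exp_0)
  then show ?thesis
    by (simp add: poly_altdef exp_minus sum_distrib_right divide_inverse mult.assoc)
qed

text \<open>Differentiating \<open>poly p (1 / t) * exp (- (1 / t))\<close> produces the factor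
  \<open>1 / t^2\<close>, encoded by the two leading zero coefficients. At 0 the difference quotient
  from the right is again of this form, with \<open>pCons 0 p\<close> in place of \<open>p\<close>,
  and the exponential beats every polynomial.\<close>

lemma flat_has_derivative:
  "(flat p has_real_derivative flat (pCons 0 (pCons 0 (p - pderiv p))) t) (at t)"
proof -
  consider "t < 0" | "t = 0" | "t > 0" by linarith
  then show ?thesis
  proof cases
    case 1
    have "((\<lambda>_. 0) has_real_derivative flat (pCons 0 (pCons 0 (p - pderiv p))) t) (at t)"
      using 1 by (simp add: flat_def)
    moreover have "\<forall>\<^sub>F s in nhds t. flat p s = 0"
      using eventually_nhds_in_open[of "{..<0}" t] 1 by (auto elim!: eventually_mono simp: flat_def)
    ultimately show ?thesis by (subst DERIV_cong_ev) auto
  next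
    case 2
    have "((\<lambda>h. flat p h / h) \<longlongrightarrow> 0) (at_right 0)"
    proof -
      have "filterlim (\<lambda>h::real. 1 / h) at_top (at_right 0)"
        using filterlim_inverse_at_top_right by (simp add: inverse_eq_divide)
      from filterlim_compose[OF poly_times_exp_neg_tendsto_0[of "pCons 0 p"] this]
      have "((\<lambda>h. poly (pCons 0 p) (1 / h) * exp (- (1 / h))) \<longlongrightarrow> 0) (at_right 0)" .
      then show ?thesis
        by (rule Lim_transform_eventually)
          (auto simp: eventually_at_filter flat_def field_simps)
    qed
    moreover have "((\<lambda>h. flat p h / h) \<longlongrightarrow> 0) (at_left 0)"
      by (rule Lim_transform_eventually[OF tendsto_const])
        (auto simp: eventually_at_filter flat_def)
    ultimately have "((\<lambda>h. flat p h / h) \<longlongrightarrow> 0) (at 0)"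
      by (simp add: filterlim_split_at)
    then show ?thesis using 2 by (simp add: DERIV_def flat_def)
  next
    case 3
    have inv: "((\<lambda>s. 1 / s) has_real_derivative - (1 / t * (1 / t))) (at t)"
      using 3 by (auto intro!: derivative_eq_intros simp: divide_inverse)
    have "((\<lambda>s. poly p (1 / s) * exp (- (1 / s))) has_real_derivative
        poly (pderiv p) (1 / t) * - (1 / t * (1 / t)) * exp (- (1 / t)) +
        exp (- (1 / t)) * - (- (1 / t * (1 / t))) * poly p (1 / t)) (at t)"
      by (intro DERIV_mult DERIV_chain2[OF poly_DERIV inv] DERIV_fun_exp DERIV_minus inv)
    also have "poly (pderiv p) (1 / t) * - (1 / t * (1 / t)) * exp (- (1 / t)) +
        exp (- (1 / t)) * - (- (1 / t * (1 / t))) * poly p (1 / t) =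
        flat (pCons 0 (pCons 0 (p - pderiv p))) t"
      using 3 by (simp add: flat_def algebra_simps)
    finally have "((\<lambda>s. poly p (1 / s) * exp (- (1 / s))) has_real_derivative
        flat (pCons 0 (pCons 0 (p - pderiv p))) t) (at t)" .
    moreover have "\<forall>\<^sub>F s in nhds t. flat p s = poly p (1 / s) * exp (- (1 / s))"
      using eventually_nhds_in_open[of "{0<..}" t] 3 by (auto elim!: eventually_mono simp: flat_def)
    ultimately show ?thesis by (subst DERIV_cong_ev) auto
  qed
qed

lemma Ck_flat:
  fixes e :: "'a::euclidean_space"
  shows "Ck k (\<lambda>x. flat p (e \<bullet> x + c))"
proof (induction k arbitrary: p)
  case 0
  have "continuous_on UNIV (flat p)"
    by (meson DERIV_isCont continuous_at_imp_continuous_on flat_has_derivative)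
  then have "continuous_on UNIV (\<lambda>x. flat p (e \<bullet> x + c))"
    by (rule continuous_on_compose2) (auto intro!: continuous_intros)
  then show ?case by simp
next
  case (Suc k)
  let ?q = "pCons 0 (pCons 0 (p - pderiv p))"
  have der: "((\<lambda>x. flat p (e \<bullet> x + c)) has_derivative (\<lambda>v. (e \<bullet> v) * flat ?q (e \<bullet> x + c))) (at x)"
    for x
  proof -
    have "((\<lambda>x. e \<bullet> x + c) has_derivative (\<lambda>v. e \<bullet> v)) (at x)"
      by (auto intro!: derivative_eq_intros)
    from DERIV_compose_FDERIV[OF flat_has_derivative this] show ?thesis .
  qed
  have "frechet_derivative (\<lambda>x. flat p (e \<bullet> x + c)) (at x) v = (e \<bullet> v) * flat ?q (e \<bullet> x + c)" for x v
    by (rule frechet_derivative_eqI[OF der])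
  moreover have "(\<lambda>x. flat p (e \<bullet> x + c)) differentiable_on UNIV"
    using der by (meson differentiableI differentiable_at_imp_differentiable_on)
  ultimately show ?case by (auto intro!: Ck_mult Ck_const Suc)
qed

text \<open>A product of four one-sided cutoffs. The dilation by \<open>Suc n\<close> steepens them
  without moving the set where they are positive, so all these functions live on the same rectangle
  while they converge to its indicator.\<close>

definition bump :: "nat \<Rightarrow> real \<times> real \<Rightarrow> real \<times> real \<Rightarrow> real \<times> real \<Rightarrow> real" where
  "bump n a b x = flat 1 (real (Suc n) * (fst x - fst a)) * flat 1 (real (Suc n) * (fst b - fst x)) *
     (flat 1 (real (Suc n) * (snd x - snd a)) * flat 1 (real (Suc n) * (snd b - snd x)))"

lemma smooth_bump: "smooth (bump n a b)"
proof -
  let ?N = "real (Suc n)"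
  have "bump n a b = (\<lambda>x. flat 1 ((?N, 0) \<bullet> x + - ?N * fst a) * flat 1 ((- ?N, 0) \<bullet> x + ?N * fst b) *
     (flat 1 ((0, ?N) \<bullet> x + - ?N * snd a) * flat 1 ((0, - ?N) \<bullet> x + ?N * snd b)))"
    unfolding bump_def by (intro ext arg_cong2[of _ _ _ _ times] arg_cong[of _ _ "flat 1"])
      (simp_all add: inner_prod_def algebra_simps)
  then show ?thesis
    unfolding smooth_def by (auto intro!: Ck_mult Ck_flat)
qed

lemma mem_box_real_pair:
  fixes x :: "real \<times> real"
  shows "x \<in> box a b \<longleftrightarrow> fst a < fst x \<and> fst x < fst b \<and> snd a < snd x \<and> snd x < snd b"
  by (auto simp: box_def Basis_prod_def inner_prod_def)

lemma bump_nonzero_iff: "bump n a b x \<noteq> 0 \<longleftrightarrow> x \<in> box a b"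
  by (auto simp: bump_def flat_def mem_box_real_pair zero_less_mult_iff)

lemma test_function_bump:
  assumes "cbox a b \<subseteq> \<Omega>"
  shows "test_function \<Omega> (bump n a b)"
proof -
  have "closure {x. bump n a b x \<noteq> 0} \<subseteq> cbox a b"
    using box_subset_cbox by (intro closure_minimal) (auto simp: bump_nonzero_iff closed_cbox)
  then show ?thesis
    using assms bounded_subset[OF bounded_cbox, of _ a b]
    unfolding test_function_def compact_eq_bounded_closed by (simp add: smooth_bump)
qed

lemma flat_one_bounds: "0 \<le> flat 1 t" "flat 1 t \<le> 1"
  by (auto simp: flat_def)

lemma bump_bounds: "0 \<le> bump n a b x" "bump n a b x \<le> 1"
  unfolding bump_def by (auto intro!: mult_nonneg_nonneg mult_le_one flat_one_bounds)

lemma flat_one_dilation_tendsto: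
  "(\<lambda>n. flat 1 (real (Suc n) * s)) \<longlonglongrightarrow> (if 0 < s then 1 else 0)"
proof (cases "0 < s")
  case True
  have "(\<lambda>n. inverse (real (Suc n)) * (1 / s)) \<longlonglongrightarrow> 0 * (1 / s)"
    by (intro tendsto_mult tendsto_const LIMSEQ_inverse_real_of_nat)
  then have "(\<lambda>n. 1 / (real (Suc n) * s)) \<longlonglongrightarrow> 0"
    by (simp add: field_simps)
  then have "(\<lambda>n. exp (- (1 / (real (Suc n) * s)))) \<longlonglongrightarrow> exp (- 0)"
    by (intro tendsto_intros)
  then show ?thesis using True by (simp add: flat_def zero_less_mult_iff)
next
  case False
  then have "flat 1 (real (Suc n) * s) = 0" for n
    by (auto simp: flat_def zero_less_mult_iff)
  then show ?thesis using False by simp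
qed

lemma bump_tendsto_indicator: "(\<lambda>n. bump n a b x) \<longlonglongrightarrow> indicat_real (box a b) x"
proof -
  let ?c = "\<lambda>s::real. if 0 < s then 1 else (0::real)"
  have "(\<lambda>n. bump n a b x) \<longlonglongrightarrow> ?c (fst x - fst a) * ?c (fst b - fst x) *
      (?c (snd x - snd a) * ?c (snd b - snd x))"
    unfolding bump_def by (intro tendsto_mult flat_one_dilation_tendsto)
  moreover have "?c (fst x - fst a) * ?c (fst b - fst x) * (?c (snd x - snd a) * ?c (snd b - snd x))
      = indicator (box a b) x"
    by (simp add: indicator_def mem_box_real_pair)
  ultimately show ?thesis by metis
qed

definition gradient :: "(real \<times> real \<Rightarrow> real) \<Rightarrow> real \<times> real \<Rightarrow> real \<times> real" where
  "gradient f x = (frechet_derivative f (at x) (1, 0), frechet_derivative f (at x) (0, 1))"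

lemma smooth_has_derivative:
  assumes "smooth f"
  shows "(f has_derivative (\<lambda>v. gradient f x \<bullet> v)) (at x)"
proof -
  have "Ck 1 f" using assms unfolding smooth_def by blast
  then have d: "(f has_derivative frechet_derivative f (at x)) (at x)"
    by (simp add: differentiable_on_UNIV_has_derivative)
  then interpret linear "frechet_derivative f (at x)"
    by (rule has_derivative_linear)
  have "frechet_derivative f (at x) v = gradient f x \<bullet> v" for v
  proof -
    have "frechet_derivative f (at x) (fst v *\<^sub>R (1, 0) + snd v *\<^sub>R (0, 1)) = gradient f x \<bullet> v"
      by (simp only: add scale) (simp add: gradient_def inner_prod_def)
    then show ?thesis by simp
  qed
  then show ?thesis using d by presburger
qed

lemma smooth_frechet_derivative:
  "smooth f \<Longrightarrow> frechet_derivative f (at x) v = gradient f x \<bullet> v"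
  by (rule frechet_derivative_eqI[OF smooth_has_derivative])

lemma smooth_imp_continuous_on: "smooth f \<Longrightarrow> continuous_on S f"
  using continuous_on_subset[of UNIV f S] by (auto simp: smooth_def dest: spec[of _ 0])

lemma continuous_on_gradient:
  assumes "smooth f"
  shows "continuous_on S (gradient f)"
proof -
  have "Ck 1 f" using assms unfolding smooth_def by blast
  then have "continuous_on UNIV (gradient f)"
    unfolding gradient_def by (intro continuous_on_Pair) auto
  then show ?thesis by (rule continuous_on_subset) simp
qed

subsection \<open>The divergence theorem for fields vanishing on part of the boundary\<close>

text \<open>Near a simple zero the difference quotient is nonzero, so the zero is isolated. A pair
  of rationals enclosing it and no other simple zero labels it injectively.\<close>

lemma countable_simple_zeros:
  fixes f f' :: "real \<Rightarrow> real"
  assumes "\<And>x. (f has_real_derivative f' x) (at x)"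
  shows "countable {x. f x = 0 \<and> f' x \<noteq> 0}" (is "countable ?Z")
proof -
  have ex: "\<exists>q. q \<in> \<rat> \<times> \<rat> \<and> {fst q<..<snd q} \<inter> ?Z = {x}" if x: "x \<in> ?Z" for x
  proof -
    have "(\<lambda>h. (f (x + h) - f x) / h) \<midarrow>0\<rightarrow> f' x"
      using assms[of x] by (simp add: DERIV_def)
    then have "\<forall>\<^sub>F h in at 0. (f (x + h) - f x) / h \<noteq> 0"
      using x by (intro tendsto_imp_eventually_ne) auto
    then obtain d where d: "d > 0" "\<And>h. h \<noteq> 0 \<Longrightarrow> \<bar>h\<bar> < d \<Longrightarrow> (f (x + h) - f x) / h \<noteq> 0"
      unfolding eventually_at by (auto simp: dist_real_def)
    obtain p where p: "p \<in> \<rat>" "x - d < p" "p < x"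
      using Rats_dense_in_real[of "x - d" x] d by auto
    obtain q where q: "q \<in> \<rat>" "x < q" "q < x + d"
      using Rats_dense_in_real[of x "x + d"] d by auto
    have uniq: "y = x" if "p < y" "y < q" "f y = 0" for y
      using d(2)[of "y - x"] that p q x by (auto simp: abs_less_iff)
    have "{p<..<q} \<inter> ?Z = {x}"
    proof
      show "{x} \<subseteq> {p<..<q} \<inter> ?Z" using p q x by simp
    qed (auto intro: uniq)
    then show ?thesis
      using p q by (intro exI[of _ "(p, q)"]) simp
  qed
  obtain q where q: "\<forall>x\<in>?Z. q x \<in> \<rat> \<times> \<rat> \<and> {fst (q x)<..<snd (q x)} \<inter> ?Z = {x}"
    using bchoice[of ?Z "\<lambda>x q. q \<in> \<rat> \<times> \<rat> \<and> {fst q<..<snd q} \<inter> ?Z = {x}"] ex by blast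
  have "inj_on q ?Z"
  proof (rule inj_onI)
    fix x y assume xy: "x \<in> ?Z" "y \<in> ?Z" and "q x = q y"
    have "{x} = {y}"
      using bspec[OF q xy(1), THEN conjunct2] bspec[OF q xy(2), THEN conjunct2]
      unfolding \<open>q x = q y\<close> by (rule trans[OF sym])
    then show "x = y" by simp
  qed
  moreover have "countable (q ` ?Z)"
  proof (rule countable_subset)
    show "q ` ?Z \<subseteq> \<rat> \<times> \<rat>"
      by (rule image_subsetI) (rule bspec[OF q, THEN conjunct1])
  qed (intro countable_SIGMA countable_rat)
  ultimately show ?thesis using countable_image_inj_on by blast
qed

text \<open>Extending \<open>g\<close> by zero from \<open>U\<close> keeps it differentiable: at a
  frontier point the extension is dominated by \<open>g\<close>, whose value and derivative vanish
  there. The fundamental theorem then applies once on the whole interval, whatever the components of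
  \<open>U\<close>. Only at \<open>d\<close> may a boundary value survive, and there
  \<open>top\<close> ensures continuity.\<close>

lemma integral_deriv_double_zeros:
  fixes g g' :: "real \<Rightarrow> real"
  assumes der: "\<And>y. (g has_real_derivative g' y) (at y)" and cont: "continuous_on UNIV g'"
    and U: "open U" "U \<subseteq> {c<..<d}" and "c < d"
    and zero: "\<And>y. y \<in> frontier U \<Longrightarrow> c \<le> y \<Longrightarrow> y < d \<Longrightarrow> g y = 0 \<and> g' y = 0"
    and top: "g d = 0 \<or> (\<exists>e<d. {e<..<d} \<subseteq> U)"
  shows "(LINT y|lborel. indicator U y * g' y) = g d"
proof -
  \<comment> \<open>The point \<open>d\<close> lies outside \<open>U\<close>, yet the extension has
    to keep the value \<open>g d\<close> there: it is the boundary term of the result. At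
    \<open>c\<close> the extension is 0.\<close>
  define F where "F y = (if y \<in> U \<or> y = d then g y else 0)" for y
  have F_le: "\<bar>F t\<bar> \<le> \<bar>g t\<bar>" for t by (simp add: F_def)
  have frontier_iff: "y \<in> frontier U \<longleftrightarrow> y \<in> closure U \<and> y \<notin> U" for y
    using U by (simp add: frontier_def interior_open)
  have squeeze: "(F \<longlongrightarrow> 0) (at y within S)" if "g y = 0" for y S
  proof -
    have "(g \<longlongrightarrow> g y) (at y within S)"
      using der DERIV_isCont continuous_at_imp_continuous_at_within continuous_within by blast
    then have "((\<lambda>t. \<bar>g t\<bar>) \<longlongrightarrow> 0) (at y within S)"
      using that by (simp add: tendsto_rabs_zero)
    then show ?thesis
      by (rule Lim_null_comparison[rotated]) (simp add: F_le)
  qed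
  have derF: "(F has_real_derivative indicator U y * g' y) (at y)" if y: "c < y" "y < d" for y
  proof -
    consider "y \<in> U" | "y \<notin> closure U" | "y \<in> frontier U"
      using frontier_iff by blast
    then show ?thesis
    proof cases
      case 1
      have "\<forall>\<^sub>F t in nhds y. F t = g t"
        using eventually_nhds_in_open[OF U(1) 1] by (auto elim!: eventually_mono simp: F_def)
      then show ?thesis using der[of y] 1 by (subst DERIV_cong_ev) auto
    next
      case 2
      have "\<forall>\<^sub>F t in nhds y. F t = 0"
        by (rule eventually_mono[OF eventually_nhds_in_open[of "- closure U \<inter> {..<d}" y]])
          (use 2 y closure_subset[of U] in \<open>auto simp: F_def intro!: open_Int\<close>)
      moreover have "indicator U y * g' y = 0"
        using 2 closure_subset[of U] by (auto simp: indicator_def)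
      ultimately show ?thesis by (subst DERIV_cong_ev[of _ _ _ "\<lambda>_. 0"]) auto
    next
      case 3
      then have *: "g y = 0" "g' y = 0" "y \<notin> U" using zero[of y] y frontier_iff by auto
      have lim: "((\<lambda>h. \<bar>(g (y + h) - g y) / h\<bar>) \<longlongrightarrow> 0) (at 0)"
        using der[of y] * by (intro tendsto_rabs_zero) (simp add: DERIV_def)
      have le: "\<bar>(F (y + h) - F y) / h\<bar> \<le> \<bar>(g (y + h) - g y) / h\<bar>" for h
      proof -
        have "\<bar>F (y + h) - F y\<bar> \<le> \<bar>g (y + h) - g y\<bar>"
          using * y F_le[of "y + h"] by (simp add: F_def)
        then show ?thesis unfolding abs_divide by (rule divide_right_mono) simp
      qed
      have "((\<lambda>h. (F (y + h) - F y) / h) \<longlongrightarrow> 0) (at 0)"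
        by (rule Lim_null_comparison[OF _ lim]) (intro always_eventually allI, unfold real_norm_def, rule le)
      moreover have "indicator U y * g' y = 0" using * by simp
      ultimately show ?thesis unfolding DERIV_def by metis
    qed
  qed
  have contF: "continuous_on {c..d} F"
    unfolding continuous_on_def
  proof
    fix y assume "y \<in> {c..d}"
    then consider "c < y" "y < d" | "y = c" | "y = d" by force
    then show "(F \<longlongrightarrow> F y) (at y within {c..d})"
    proof cases
      case 1
      then show ?thesis
        using derF DERIV_isCont continuous_at_imp_continuous_at_within continuous_within by blast
    next
      case 2
      have c: "c \<notin> U" using U by auto
      then have Fc: "F c = 0" using \<open>c < d\<close> by (simp add: F_def)
      show ?thesis
      proof (cases "c \<in> closure U")
        case True
        then show ?thesis using squeeze[of c] zero[of c] frontier_iff c Fc \<open>c < d\<close> 2 by simp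
      next
        case False
        have "\<forall>\<^sub>F t in nhds c. F t = 0"
          by (rule eventually_mono[OF eventually_nhds_in_open[of "- closure U \<inter> {..<d}" c]])
            (use False \<open>c < d\<close> closure_subset[of U] in \<open>auto simp: F_def intro!: open_Int\<close>)
        then have "\<forall>\<^sub>F t in at y within {c..d}. F t = F y"
          unfolding eventually_at_filter 2 by (rule eventually_mono) (simp add: Fc)
        then show ?thesis by (rule tendsto_eventually)
      qed
    next
      case 3
      show ?thesis
      proof (cases "g d = 0")
        case True
        then show ?thesis using squeeze[of d] 3 by (simp add: F_def)
      next
        case False
        then obtain e where e: "e < d" "{e<..<d} \<subseteq> U" using top by auto
        have "(g \<longlongrightarrow> g d) (at d within {c..d})"
          using der DERIV_isCont continuous_at_imp_continuous_at_within continuous_within by blast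
        moreover have "\<forall>\<^sub>F t in at d within {c..d}. g t = F t"
          unfolding eventually_at
        proof (intro exI[of _ "d - e"] conjI ballI impI)
          fix t assume "t \<in> {c..d}" "t \<noteq> d \<and> dist t d < d - e"
          then have "t \<in> U" by (intro subsetD[OF e(2)]) (auto simp: dist_real_def)
          then show "g t = F t" by (simp add: F_def)
        qed (use e in simp)
        ultimately have "(F \<longlongrightarrow> g d) (at d within {c..d})"
          by (rule Lim_transform_eventually)
        then show ?thesis using 3 by (simp add: F_def)
      qed
    qed
  qed
  have FTC: "((\<lambda>y. indicator U y * g' y) has_integral F d - F c) {c..d}"
    using \<open>c < d\<close> derF contF
    by (intro fundamental_theorem_of_calculus_interior)
      (auto simp: has_real_derivative_iff_has_vector_derivative)
  have "((\<lambda>y. if y \<in> U then g' y else 0) has_integral g d) {c..d}"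
  proof -
    have "c \<notin> U" using U by auto
    then have "F d - F c = g d" using \<open>c < d\<close> by (simp add: F_def)
    moreover have "(\<lambda>y. indicator U y * g' y) = (\<lambda>y. if y \<in> U then g' y else 0)" by auto
    ultimately show ?thesis using FTC by simp
  qed
  then have I: "(g' has_integral g d) U"
    using U(2) by (subst (asm) has_integral_restrict) auto
  have "set_integrable lborel {c..d} g'"
    using cont by (intro borel_integrable_atLeastAtMost' continuous_on_subset[OF cont]) auto
  then have "set_integrable lborel U g'"
    by (rule set_integrable_subset) (use U in auto)
  then have "(LINT y:U|lborel. g' y) = integral U g'"
    by (rule set_borel_integral_eq_integral)
  then show ?thesis
    using I by (simp add: set_lebesgue_integral_def integral_unique)
qed

text \<open>Composing with \<open>t\<^sup>3 / (t\<^sup>2 + \<epsilon>)\<close> turns zeros into double zeros, so that the extension by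
  zero is differentiable; the simple zeros that are lost as \<open>\<epsilon> \<rightarrow> 0\<close> are isolated.\<close>

lemma integral_deriv_open:
  fixes f f' :: "real \<Rightarrow> real"
  assumes der: "\<And>y. (f has_real_derivative f' y) (at y)" and cont: "continuous_on UNIV f'"
    and U: "open U" "U \<subseteq> {c<..<d}" and "c < d"
    and zero: "\<And>y. y \<in> frontier U \<Longrightarrow> c \<le> y \<Longrightarrow> y < d \<Longrightarrow> f y = 0"
    and top: "f d = 0 \<or> (\<exists>e<d. {e<..<d} \<subseteq> U)"
  shows "(LINT y|lborel. indicator U y * f' y) = f d"
proof -
  \<comment> \<open>For positive \<epsilon> this has a triple zero at 0; as \<epsilon> tends to 0 it
    tends to \<open>t\<close>, with derivatives bounded uniformly in \<epsilon>.\<close>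
  define h where "h \<epsilon> t = t ^ 3 / (t\<^sup>2 + \<epsilon>)" for \<epsilon> t :: real
  define h' where "h' \<epsilon> t = (t ^ 4 + 3 * \<epsilon> * t\<^sup>2) / (t\<^sup>2 + \<epsilon>)\<^sup>2" for \<epsilon> t :: real
  define \<epsilon> where "\<epsilon> n = inverse (real (Suc n))" for n
  have \<epsilon>: "\<epsilon> n > 0" for n by (simp add: \<epsilon>_def)
  have \<epsilon>0: "\<epsilon> \<longlonglongrightarrow> 0" unfolding \<epsilon>_def by (rule LIMSEQ_inverse_real_of_nat)
  have pos: "t\<^sup>2 + \<epsilon> n > 0" for t n using \<epsilon>[of n] by (simp add: add_nonneg_pos)
  have h_der: "(h (\<epsilon> n) has_real_derivative h' (\<epsilon> n) t) (at t)" for n t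
  proof -
    have "((\<lambda>t. t ^ 3 / (t\<^sup>2 + \<epsilon> n)) has_real_derivative
        (3 * t\<^sup>2 * (t\<^sup>2 + \<epsilon> n) - t ^ 3 * (2 * t)) / ((t\<^sup>2 + \<epsilon> n) * (t\<^sup>2 + \<epsilon> n))) (at t)"
      using pos[of t n] by (intro DERIV_divide) (auto intro!: derivative_eq_intros)
    also have "3 * t\<^sup>2 * (t\<^sup>2 + \<epsilon> n) - t ^ 3 * (2 * t) = t ^ 4 + 3 * \<epsilon> n * t\<^sup>2"
      by (simp add: power2_eq_square power3_eq_cube power4_eq_xxxx algebra_simps)
    finally show ?thesis by (simp add: h_def [abs_def] h'_def power2_eq_square)
  qed
  \<comment> \<open>Bounds independent of \<open>n\<close> and \<open>t\<close> yield the dominating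
    function for the limit below. The supremum is 9/8; with 2 the claim is a polynomial with
    nonnegative terms.\<close>
  have h'_bounds: "0 \<le> h' (\<epsilon> n) t" "h' (\<epsilon> n) t \<le> 2" for n t
  proof -
    have "2 * (t\<^sup>2 + \<epsilon> n)\<^sup>2 - (t ^ 4 + 3 * \<epsilon> n * t\<^sup>2) = t ^ 4 + \<epsilon> n * t\<^sup>2 + 2 * (\<epsilon> n)\<^sup>2"
      by (simp add: power2_eq_square power4_eq_xxxx algebra_simps)
    also have "\<dots> \<ge> 0" using \<epsilon>[of n] by simp
    finally show "h' (\<epsilon> n) t \<le> 2"
      unfolding h'_def using pos[of t n] by (simp add: divide_le_eq)
    show "0 \<le> h' (\<epsilon> n) t"
      unfolding h'_def using \<epsilon>[of n] by (auto intro!: divide_nonneg_nonneg add_nonneg_nonneg)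
  qed
  have contf: "continuous_on UNIV f"
    by (meson DERIV_isCont continuous_at_imp_continuous_on der)
  have conth': "continuous_on UNIV (\<lambda>y. h' (\<epsilon> n) (f y) * f' y)" for n
  proof -
    have "((f y)\<^sup>2 + \<epsilon> n)\<^sup>2 \<noteq> 0" for y using pos[of "f y" n] by simp
    then show ?thesis
      unfolding h'_def using contf cont by (intro continuous_intros) auto
  qed
  have int_n: "(LINT y|lborel. indicator U y * (h' (\<epsilon> n) (f y) * f' y)) = h (\<epsilon> n) (f d)" for n
  proof (rule integral_deriv_double_zeros[where g = "\<lambda>y. h (\<epsilon> n) (f y)"])
    show "((\<lambda>y. h (\<epsilon> n) (f y)) has_real_derivative h' (\<epsilon> n) (f y) * f' y) (at y)" for y
      by (rule DERIV_chain2[OF h_der der])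
    show "h (\<epsilon> n) (f d) = 0 \<or> (\<exists>e<d. {e<..<d} \<subseteq> U)"
      using top by (auto simp: h_def)
  qed (use U \<open>c < d\<close> zero conth' in \<open>auto simp: h_def h'_def\<close>)
  have "(\<lambda>n. (f d) ^ 3 / ((f d)\<^sup>2 + \<epsilon> n)) \<longlonglongrightarrow> f d"
  proof (cases "f d = 0")
    case False
    have "(\<lambda>n. (f d) ^ 3 / ((f d)\<^sup>2 + \<epsilon> n)) \<longlonglongrightarrow> (f d) ^ 3 / ((f d)\<^sup>2 + 0)"
      using False by (intro tendsto_intros \<epsilon>0) auto
    then show ?thesis by (simp add: power2_eq_square power3_eq_cube False)
  qed simp
  then have lim1: "(\<lambda>n. h (\<epsilon> n) (f d)) \<longlonglongrightarrow> f d" by (simp add: h_def)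
  have lim2: "(\<lambda>n. LINT y|lborel. indicator U y * (h' (\<epsilon> n) (f y) * f' y)) \<longlonglongrightarrow>
      (LINT y|lborel. indicator U y * (if f y = 0 then 0 else f' y))"
  proof (rule integral_dominated_convergence[where w = "\<lambda>y. indicator {c..d} y * (2 * \<bar>f' y\<bar>)"])
    have "set_integrable lborel {c..d} (\<lambda>y. 2 * \<bar>f' y\<bar>)"
      using cont by (intro borel_integrable_atLeastAtMost' continuous_intros continuous_on_subset[OF cont]) auto
    then show "integrable lborel (\<lambda>y. indicator {c..d} y * (2 * \<bar>f' y\<bar>))"
      by (simp add: set_integrable_def)
    have [measurable]: "f \<in> borel_measurable borel" "f' \<in> borel_measurable borel" "U \<in> sets borel"
      using contf cont U by (auto intro: borel_measurable_continuous_onI)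
    show "(\<lambda>y. indicator U y * (if f y = 0 then 0 else f' y)) \<in> borel_measurable lborel"
      by measurable
    show "(\<lambda>y. indicator U y * (h' (\<epsilon> n) (f y) * f' y)) \<in> borel_measurable lborel" for n
      unfolding h'_def by measurable
    show "AE y in lborel. (\<lambda>n. indicator U y * (h' (\<epsilon> n) (f y) * f' y)) \<longlonglongrightarrow>
        indicator U y * (if f y = 0 then 0 else f' y)"
    proof (rule AE_I2)
      fix y
      have "(\<lambda>n. h' (\<epsilon> n) (f y)) \<longlonglongrightarrow> (if f y = 0 then 0 else 1)"
      proof (cases "f y = 0")
        case False
        have "(\<lambda>n. h' (\<epsilon> n) (f y)) \<longlonglongrightarrow> ((f y) ^ 4 + 3 * 0 * (f y)\<^sup>2) / ((f y)\<^sup>2 + 0)\<^sup>2"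
          unfolding h'_def using False by (intro tendsto_intros \<epsilon>0) auto
        then show ?thesis using False by (simp add: power2_eq_square power4_eq_xxxx)
      qed (simp add: h'_def)
      then have "(\<lambda>n. indicator U y * (h' (\<epsilon> n) (f y) * f' y)) \<longlonglongrightarrow>
          indicator U y * ((if f y = 0 then 0 else 1) * f' y)"
        by (intro tendsto_intros)
      then show "(\<lambda>n. indicator U y * (h' (\<epsilon> n) (f y) * f' y)) \<longlonglongrightarrow>
          indicator U y * (if f y = 0 then 0 else f' y)"
        by (simp split: if_splits)
    qed
    show "AE y in lborel. norm (indicator U y * (h' (\<epsilon> n) (f y) * f' y)) \<le>
        indicator {c..d} y * (2 * \<bar>f' y\<bar>)" for n
      using U h'_bounds[of n]
      by (intro AE_I2) (auto simp: indicator_def abs_mult intro!: mult_right_mono)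
  qed
  have "AE y in lborel. y \<notin> {x. f x = 0 \<and> f' x \<noteq> 0}"
    by (intro AE_not_in countable_imp_null_set_lborel countable_simple_zeros der)
  then have "(LINT y|lborel. indicator U y * (if f y = 0 then 0 else f' y)) =
      (LINT y|lborel. indicator U y * f' y)"
  proof (intro integral_cong_AE)
    have [measurable]: "f \<in> borel_measurable borel" "f' \<in> borel_measurable borel" "U \<in> sets borel"
      using contf cont U by (auto intro: borel_measurable_continuous_onI)
    show "(\<lambda>y. indicator U y * (if f y = 0 then 0 else f' y)) \<in> borel_measurable lborel"
      by measurable
    show "(\<lambda>y. indicator U y * f' y) \<in> borel_measurable lborel"
      by measurable
  qed (auto elim!: eventually_mono)
  then show ?thesis
    using LIMSEQ_unique[OF lim1, of "LINT y|lborel. indicator U y * f' y"] lim2 by (simp only: int_n)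
qed

text \<open>Taking \<open>Sup U\<close> as the right end point makes it a frontier point of
  \<open>U\<close>, so the boundary term vanishes too.\<close>

lemma integral_deriv_open_frontier_zero:
  fixes f f' :: "real \<Rightarrow> real"
  assumes der: "\<And>y. (f has_real_derivative f' y) (at y)" and cont: "continuous_on UNIV f'"
    and U: "open U" "bounded U" and zero: "\<And>y. y \<in> frontier U \<Longrightarrow> f y = 0"
  shows "(LINT y|lborel. indicator U y * f' y) = 0"
proof (cases "U = {}")
  case False
  have bdd: "bdd_above U" using U by (simp add: bounded_imp_bdd_above)
  have S: "Sup U \<in> closure U"
    using False bdd by (rule closure_contains_Sup)
  have notin: "Sup U \<notin> U"
  proof
    assume "Sup U \<in> U"
    then obtain e where e: "e > 0" "ball (Sup U) e \<subseteq> U"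
      using U(1) open_contains_ball by blast
    then have "Sup U + e / 2 \<in> U" by (intro subsetD[OF e(2)]) (simp add: dist_real_def)
    then show False using cSup_upper[OF _ bdd, of "Sup U + e / 2"] e(1) by simp
  qed
  then have "f (Sup U) = 0"
    using zero S U by (simp add: frontier_def interior_open)
  obtain c where c: "\<And>u. u \<in> U \<Longrightarrow> c < u"
    using bounded_imp_bdd_below[OF U(2)] unfolding bdd_below_def
    by (meson lt_ex order_less_le_trans)
  have sub: "U \<subseteq> {c<..<Sup U}"
  proof
    fix u assume u: "u \<in> U"
    then have "u \<le> Sup U" "u \<noteq> Sup U" using cSup_upper[OF u bdd] notin by auto
    then show "u \<in> {c<..<Sup U}" using c[OF u] by simp
  qed
  show ?thesis
    using integral_deriv_open[OF der cont U(1) sub] False sub zero \<open>f (Sup U) = 0\<close> by fastforce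
qed simp

section \<open>Integration by parts over slices of a domain in the half-strip\<close>

locale lower_domain =
  fixes \<Omega> B :: "(real \<times> real) set" and a b :: real
  assumes open_domain: "open \<Omega>" and bounded_domain: "bounded \<Omega>"
    and domain_subset: "\<Omega> \<subseteq> {a<..<b} \<times> {..<0}" and a_less_b: "a < b"
    and frontier_domain: "frontier \<Omega> = {a..b} \<times> {0} \<union> B"
    and B_below: "B \<subseteq> {x. snd x < 0}"
begin

lemma integrable_indicator_continuous:
  fixes p :: "real \<times> real \<Rightarrow> real"
  assumes "continuous_on UNIV p"
  shows "integrable lborel (\<lambda>z. indicator \<Omega> z * p z)"
proof -
  obtain c d where cd: "\<Omega> \<subseteq> cbox c d"
    using bounded_subset_cbox_symmetric[OF bounded_domain] by blast
  have "set_integrable lborel (cbox c d) p"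
    unfolding set_integrable_def
    by (intro borel_integrable_compact compact_cbox continuous_on_subset[OF assms]) auto
  then have "set_integrable lborel \<Omega> p"
    by (rule set_integrable_subset) (use cd open_domain in auto)
  then show ?thesis by (simp add: set_integrable_def)
qed

lemma Fubini_indicator:
  fixes p :: "real \<times> real \<Rightarrow> real"
  assumes "continuous_on UNIV p"
  shows "(LINT z|lborel. indicator \<Omega> z * p z) =
      (LINT x|lborel. LINT y|lborel. indicator {y. (x, y) \<in> \<Omega>} y * p (x, y))"
    and "(LINT z|lborel. indicator \<Omega> z * p z) =
      (LINT y|lborel. LINT x|lborel. indicator {x. (x, y) \<in> \<Omega>} x * p (x, y))"
proof -
  have int: "integrable (lborel \<Otimes>\<^sub>M lborel) (\<lambda>(x, y). indicator \<Omega> (x, y) * p (x, y))"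
    using integrable_indicator_continuous[OF assms] by (simp add: lborel_prod case_prod_unfold)
  have ind: "indicator {y. (x, y) \<in> \<Omega>} y = (indicator \<Omega> (x, y) :: real)"
    "indicator {x. (x, y) \<in> \<Omega>} x = (indicator \<Omega> (x, y) :: real)" for x y
    by (simp_all add: indicator_def)
  show "(LINT z|lborel. indicator \<Omega> z * p z) =
      (LINT x|lborel. LINT y|lborel. indicator {y. (x, y) \<in> \<Omega>} y * p (x, y))"
    unfolding ind using lborel_pair.integral_fst[OF int] by (simp add: lborel_prod case_prod_unfold)
  show "(LINT z|lborel. indicator \<Omega> z * p z) =
      (LINT y|lborel. LINT x|lborel. indicator {x. (x, y) \<in> \<Omega>} x * p (x, y))"
    unfolding ind using lborel_pair.integral_snd[OF int] by (simp add: lborel_prod case_prod_unfold)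
qed

text \<open>The closure of a slice lies in the slice of the closure, and slices of an open set are
  open. Only this inclusion is available: a point of the frontier of \<Omega> need not be a frontier
  point of the slice through it.\<close>

lemma frontier_slice:
  shows "y \<in> frontier {y. (x, y) \<in> \<Omega>} \<Longrightarrow> (x, y) \<in> frontier \<Omega>"
    and "x \<in> frontier {x. (x, y) \<in> \<Omega>} \<Longrightarrow> (x, y) \<in> frontier \<Omega>"
    and "open {y. (x, y) \<in> \<Omega>}" and "open {x. (x, y) \<in> \<Omega>}"
proof -
  have 1: "continuous_on UNIV (\<lambda>y. (x, y))" "continuous_on UNIV (\<lambda>x. (x, y))" for x y :: real
    by (auto intro!: continuous_intros)
  have 2: "{y. (x, y) \<in> S} = (\<lambda>y. (x, y)) -` S" "{x. (x, y) \<in> S} = (\<lambda>x. (x, y)) -` S"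
    for S :: "(real \<times> real) set" and x y by auto
  show op: "open {y. (x, y) \<in> \<Omega>}" "open {x. (x, y) \<in> \<Omega>}"
    unfolding 2 using 1 open_domain by (auto intro: open_vimage)
  have cl: "closure {y. (x, y) \<in> \<Omega>} \<subseteq> {y. (x, y) \<in> closure \<Omega>}"
    "closure {x. (x, y) \<in> \<Omega>} \<subseteq> {x. (x, y) \<in> closure \<Omega>}"
    using closure_subset[of \<Omega>] unfolding 2
    by (intro closure_minimal closed_vimage closed_closure 1; auto)+
  show "y \<in> frontier {y. (x, y) \<in> \<Omega>} \<Longrightarrow> (x, y) \<in> frontier \<Omega>"
    "x \<in> frontier {x. (x, y) \<in> \<Omega>} \<Longrightarrow> (x, y) \<in> frontier \<Omega>"
    using cl op open_domain by (auto simp: frontier_def interior_open)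
qed

lemma frontier_domain_negative: "(x, y) \<in> frontier \<Omega> \<Longrightarrow> y < 0 \<Longrightarrow> (x, y) \<in> B"
  using frontier_domain by auto

text \<open>A nonempty horizontal slice has negative height, where the frontier of \<Omega> is
  contained in \<open>B\<close>. Hence no boundary term appears.\<close>

lemma integral_partial_fst:
  assumes der: "\<And>x y. ((\<lambda>t. \<psi> (t, y)) has_real_derivative p (x, y)) (at x)"
    and cont: "continuous_on UNIV p" and zero: "\<And>z. z \<in> B \<Longrightarrow> \<psi> z = 0"
  shows "(LINT z|lborel. indicator \<Omega> z * p z) = 0"
proof -
  have "(LINT x|lborel. indicator {x. (x, y) \<in> \<Omega>} x * p (x, y)) = 0" for y
  proof (rule integral_deriv_open_frontier_zero[where f = "\<lambda>t. \<psi> (t, y)"])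
    show "continuous_on UNIV (\<lambda>x. p (x, y))"
      by (rule continuous_on_compose2[OF cont]) (auto intro!: continuous_intros)
    show "bounded {x. (x, y) \<in> \<Omega>}"
      by (rule bounded_subset[of "{a..b}"]) (use domain_subset in auto)
    fix x assume x: "x \<in> frontier {x. (x, y) \<in> \<Omega>}"
    then have "{x. (x, y) \<in> \<Omega>} \<noteq> {}" by (rule contrapos_pn) (simp only: frontier_empty empty_iff not_False_eq_True)
    then have "y < 0" using domain_subset by auto
    then show "\<psi> (x, y) = 0" using zero frontier_domain_negative frontier_slice(2)[OF x] by auto
  qed (use der frontier_slice in auto)
  then show ?thesis by (simp add: Fubini_indicator(2)[OF cont])
qed

text \<open>Provides the dichotomy at the upper end of a vertical slice. On the closure of
  \<open>B\<close> the function vanishes by continuity. Away from it a small lower half-disc about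
  \<open>(x, 0)\<close> is connected, meets \<Omega> and misses the frontier, hence lies inside
  \<Omega>.\<close>

lemma top_slice:
  assumes x: "x \<in> {a..b}" and cont: "continuous_on UNIV \<psi>"
    and zero: "\<And>z. z \<in> B \<Longrightarrow> \<psi> z = (0::real)"
  shows "\<psi> (x, 0) = 0 \<or> (\<exists>e<0. {e<..<0} \<subseteq> {y. (x, y) \<in> \<Omega>})"
proof (cases "(x, 0) \<in> closure B")
  case True
  have "closure B \<subseteq> {z. \<psi> z = 0}"
    using zero by (intro closure_minimal closed_Collect_eq cont continuous_intros) auto
  then show ?thesis using True by auto
next
  case False
  then obtain r where r: "r > 0" "ball (x, 0) r \<inter> B = {}"
    using open_contains_ball[of "- closure B"] closure_subset[of B] by blast
  define K where "K = ball (x, 0 :: real) r \<inter> {z. snd z < 0}"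
  have half: "convex {z::real \<times> real. snd z < 0}"
    using convex_halfspace_lt[of "(0, 1) :: real \<times> real" 0] by (simp add: inner_prod_def)
  have "connected K"
    unfolding K_def by (rule convex_connected[OF convex_Int[OF convex_ball half]])
  moreover have "K \<inter> \<Omega> \<noteq> {}"
  proof -
    have "(x, 0) \<in> frontier \<Omega>" using x by (simp add: frontier_domain)
    then have "(x, 0) \<in> closure \<Omega>" by (simp add: frontier_def)
    then obtain z where "z \<in> \<Omega>" "dist z (x, 0) < r"
      using r closure_approachable by blast
    then have "z \<in> K \<inter> \<Omega>" using domain_subset by (auto simp: K_def mem_ball dist_commute)
    then show ?thesis by blast
  qed
  moreover have "K \<inter> frontier \<Omega> = {}"
    using r frontier_domain by (auto simp: K_def)
  ultimately have K: "K \<subseteq> \<Omega>"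
    using connected_Int_frontier[of K \<Omega>] by blast
  have "(x, y) \<in> K" if "- r < y" "y < 0" for y
    using that r by (simp add: K_def dist_Pair_Pair dist_real_def)
  then show ?thesis using K r by (intro disjI2 exI[of _ "- r"]) auto
qed

text \<open>Every vertical slice is bounded below by \<open>- H\<close>, and its frontier points of
  negative height lie on \<open>B\<close>; what survives is the value at height 0. The end points
  \<open>a\<close> and \<open>b\<close> form a null set.\<close>

lemma integral_partial_snd:
  assumes cont\<psi>: "continuous_on UNIV \<psi>"
    and der: "\<And>x y. ((\<lambda>t. \<psi> (x, t)) has_real_derivative p (x, y)) (at y)"
    and cont: "continuous_on UNIV p" and zero: "\<And>z. z \<in> B \<Longrightarrow> \<psi> z = 0"
  shows "(LINT z|lborel. indicator \<Omega> z * p z) = (LINT s|lborel. indicator {a..b} s * \<psi> (s, 0))"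
proof -
  obtain H where H: "H > 0" "\<And>z. z \<in> \<Omega> \<Longrightarrow> norm z < H"
    using bounded_domain unfolding bounded_pos_less by auto
  have slice: "(LINT y|lborel. indicator {y. (x, y) \<in> \<Omega>} y * p (x, y)) = indicator {a<..<b} x * \<psi> (x, 0)" for x
  proof (cases "x \<in> {a<..<b}")
    case True
    have "(LINT y|lborel. indicator {y. (x, y) \<in> \<Omega>} y * p (x, y)) = \<psi> (x, 0)"
    proof (rule integral_deriv_open[where f = "\<lambda>t. \<psi> (x, t)" and c = "- H"])
      show "continuous_on UNIV (\<lambda>y. p (x, y))"
        by (rule continuous_on_compose2[OF cont]) (auto intro!: continuous_intros)
      show "{y. (x, y) \<in> \<Omega>} \<subseteq> {- H<..<0}"
      proof
        fix y assume "y \<in> {y. (x, y) \<in> \<Omega>}"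
        then have "(x, y) \<in> \<Omega>" by simp
        then have "norm y < H" "y < 0"
          using H(2) norm_snd_le[of y x] domain_subset by fastforce+
        then show "y \<in> {- H<..<0}" by auto
      qed
      show "\<psi> (x, y) = 0" if "y \<in> frontier {y. (x, y) \<in> \<Omega>}" "y < 0" for y
        using zero frontier_domain_negative frontier_slice(1)[OF that(1)] that(2) by auto
      show "\<psi> (x, 0) = 0 \<or> (\<exists>e<0. {e<..<0} \<subseteq> {y. (x, y) \<in> \<Omega>})"
        using True by (intro top_slice cont\<psi> zero) auto
    qed (use der frontier_slice H in auto)
    then show ?thesis using True by simp
  next
    case False
    then have "{y. (x, y) \<in> \<Omega>} = {}" using domain_subset by auto
    then show ?thesis using False by simp
  qed
  have "continuous_on UNIV (\<lambda>x. \<psi> (x, 0))"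
    by (rule continuous_on_compose2[OF cont\<psi>]) (auto intro!: continuous_intros)
  then have [measurable]: "(\<lambda>x. \<psi> (x, 0)) \<in> borel_measurable borel"
    by (rule borel_measurable_continuous_onI)
  have AE: "AE x in lborel. x \<notin> {a, b}"
    by (intro AE_not_in countable_imp_null_set_lborel) auto
  have "(LINT x|lborel. indicator {a<..<b} x * \<psi> (x, 0)) = (LINT s|lborel. indicator {a..b} s * \<psi> (s, 0))"
  proof (rule integral_cong_AE)
    show "AE x in lborel. indicator {a<..<b} x * \<psi> (x, 0) = indicator {a..b} x * \<psi> (x, 0)"
      by (rule eventually_mono[OF AE]) (auto simp: indicator_def)
  qed simp_all
  then show ?thesis by (simp add: Fubini_indicator(1)[OF cont] slice)
qed

end

subsection \<open>Square integrable functions\<close>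

lemma square_integrable_inner:
  fixes f g :: "'a \<Rightarrow> 'b::euclidean_space"
  assumes "square_integrable M f" "square_integrable M g"
  shows "integrable M (\<lambda>x. f x \<bullet> g x)"
proof (rule Bochner_Integration.integrable_bound)
  show "integrable M (\<lambda>x. (norm (f x))\<^sup>2 + (norm (g x))\<^sup>2)"
    using assms by (auto simp: square_integrable_def)
  show "(\<lambda>x. f x \<bullet> g x) \<in> borel_measurable M"
    using assms by (auto simp: square_integrable_def)
  have "\<bar>u \<bullet> v\<bar> \<le> (norm u)\<^sup>2 + (norm v)\<^sup>2" for u v :: 'b
  proof -
    have "\<bar>u \<bullet> v\<bar> \<le> norm u * norm v" by (rule Cauchy_Schwarz_ineq2)
    also have "\<dots> \<le> (norm u)\<^sup>2 + (norm v)\<^sup>2"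
      using sum_squares_bound[of "norm u" "norm v"] mult_nonneg_nonneg[OF norm_ge_zero[of u] norm_ge_zero[of v]]
      by linarith
    finally show ?thesis .
  qed
  then show "AE x in M. norm (f x \<bullet> g x) \<le> norm ((norm (f x))\<^sup>2 + (norm (g x))\<^sup>2)"
    by (intro AE_I2) (auto simp: abs_of_nonneg)
qed

lemma square_integrable_add:
  fixes f g :: "'a \<Rightarrow> 'b::euclidean_space"
  assumes "square_integrable M f" "square_integrable M g"
  shows "square_integrable M (\<lambda>x. f x + g x)"
proof -
  have "integrable M (\<lambda>x. (norm (f x))\<^sup>2 + 2 * (f x \<bullet> g x) + (norm (g x))\<^sup>2)"
    using assms square_integrable_inner[OF assms] by (auto simp: square_integrable_def)
  moreover have "(norm (f x + g x))\<^sup>2 = (norm (f x))\<^sup>2 + 2 * (f x \<bullet> g x) + (norm (g x))\<^sup>2" for x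
    by (simp add: power2_norm_eq_inner inner_add inner_commute)
  ultimately show ?thesis using assms by (auto simp: square_integrable_def)
qed

lemma square_integrable_scaleR:
  fixes f :: "'a \<Rightarrow> 'b::euclidean_space"
  assumes "square_integrable M f"
  shows "square_integrable M (\<lambda>x. c *\<^sub>R f x)"
  using assms by (auto simp: square_integrable_def power_mult_distrib)

lemma square_integrable_diff:
  fixes f g :: "'a \<Rightarrow> 'b::euclidean_space"
  assumes "square_integrable M f" "square_integrable M g"
  shows "square_integrable M (\<lambda>x. f x - g x)"
  using square_integrable_add[OF assms(1) square_integrable_scaleR[OF assms(2), of "-1"]] by simp

lemma integral_Cauchy_Schwarz:
  fixes f g :: "'a \<Rightarrow> 'b::euclidean_space"
  assumes f: "square_integrable M f" and g: "square_integrable M g"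
  shows "(LINT x|M. f x \<bullet> g x)\<^sup>2 \<le> (LINT x|M. (norm (f x))\<^sup>2) * (LINT x|M. (norm (g x))\<^sup>2)"
proof -
  define A B C where "A = (LINT x|M. (norm (f x))\<^sup>2)" and "B = (LINT x|M. f x \<bullet> g x)"
    and "C = (LINT x|M. (norm (g x))\<^sup>2)"
  have pos: "0 \<le> A - 2 * t * B + t\<^sup>2 * C" for t
  proof -
    have "A - 2 * t * B + t\<^sup>2 * C =
        (LINT x|M. (norm (f x))\<^sup>2 - 2 * t * (f x \<bullet> g x) + t\<^sup>2 * (norm (g x))\<^sup>2)"
      using f g square_integrable_inner[OF f g] by (simp add: A_def B_def C_def square_integrable_def)
    also have "\<dots> = (LINT x|M. (norm (f x - t *\<^sub>R g x))\<^sup>2)"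
      by (intro Bochner_Integration.integral_cong refl)
        (simp add: power2_norm_eq_inner inner_diff inner_commute power2_eq_square[of t] algebra_simps)
    also have "\<dots> \<ge> 0" by simp
    finally show ?thesis .
  qed
  show ?thesis
  proof (cases "C = 0")
    case True
    have "B = 0"
    proof (rule ccontr)
      assume "B \<noteq> 0"
      \<comment> \<open>With \<open>C = 0\<close> the quadratic in \<open>t\<close> is affine, and
        this choice of \<open>t\<close> gives it the value -1.\<close>
      then have "A - 2 * ((A + 1) / (2 * B)) * B + 0 = - 1" by (simp add: field_simps)
      then show False using pos[of "(A + 1) / (2 * B)"] True by simp
    qed
    then show ?thesis using True by (simp add: A_def B_def C_def)
  next
    case False
    have "C \<ge> 0" by (simp add: C_def)
    with False have C: "C > 0" by simp
    have "0 \<le> (A - 2 * (B / C) * B + (B / C)\<^sup>2 * C) * C"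
      using pos[of "B / C"] C by simp
    also have "\<dots> = A * C - B\<^sup>2" using C by (simp add: field_simps power2_eq_square)
    finally show ?thesis by (simp add: A_def B_def C_def)
  qed
qed

lemma integral_inner_tendsto:
  fixes f :: "nat \<Rightarrow> 'a \<Rightarrow> 'b::euclidean_space"
  assumes fn: "\<And>n. square_integrable M (f n)" and f: "square_integrable M f0"
    and g: "square_integrable M g"
    and lim: "(\<lambda>n. LINT x|M. (norm (f n x - f0 x))\<^sup>2) \<longlonglongrightarrow> 0"
  shows "(\<lambda>n. LINT x|M. f n x \<bullet> g x) \<longlonglongrightarrow> (LINT x|M. f0 x \<bullet> g x)"
proof -
  let ?D = "\<lambda>n. LINT x|M. (f n x - f0 x) \<bullet> g x"
  have "(\<lambda>n. (LINT x|M. (norm (f n x - f0 x))\<^sup>2) * (LINT x|M. (norm (g x))\<^sup>2)) \<longlonglongrightarrow> 0"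
    using tendsto_mult_left_zero[OF lim] by simp
  then have "(\<lambda>n. (?D n)\<^sup>2) \<longlonglongrightarrow> 0"
    by (rule Lim_null_comparison[rotated])
      (simp add: integral_Cauchy_Schwarz square_integrable_diff fn f g)
  from tendsto_real_sqrt[OF this] have "?D \<longlonglongrightarrow> 0"
    by (simp add: tendsto_rabs_zero_iff)
  moreover have "?D n = (LINT x|M. f n x \<bullet> g x) - (LINT x|M. f0 x \<bullet> g x)" for n
    by (simp add: inner_diff_left square_integrable_inner fn f g)
  ultimately show ?thesis by (simp add: LIM_zero_iff)
qed

lemma square_integrable_eq_zero_AE:
  fixes f :: "'a \<Rightarrow> 'b::euclidean_space"
  assumes "square_integrable M f" "(LINT x|M. (norm (f x))\<^sup>2) \<le> 0"
  shows "AE x in M. f x = 0"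
proof -
  have "(LINT x|M. (norm (f x))\<^sup>2) \<ge> 0" by simp
  then have "(LINT x|M. (norm (f x))\<^sup>2) = 0" using assms(2) by linarith
  then show ?thesis
    using assms(1) integral_nonneg_eq_0_iff_AE[of M "\<lambda>x. (norm (f x))\<^sup>2"]
    by (simp add: square_integrable_def)
qed

lemma square_integrable_continuous:
  fixes f :: "'a::euclidean_space \<Rightarrow> 'b::euclidean_space"
  assumes cont: "continuous_on UNIV f" and S: "bounded S" "S \<in> sets lebesgue"
  shows "square_integrable (lebesgue_on S) f"
proof -
  have meas: "f \<in> borel_measurable (lebesgue_on S)"
    using borel_measurable_continuous_onI[OF cont]
    by (intro measurable_restrict_space1 measurable_completion) simp
  obtain c d where cd: "S \<subseteq> cbox c d"
    using bounded_subset_cbox_symmetric[OF S(1)] by blast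
  have "bounded (f ` cbox c d)"
    by (intro compact_imp_bounded compact_continuous_image continuous_on_subset[OF cont] compact_cbox) auto
  then obtain K where K: "\<And>x. x \<in> cbox c d \<Longrightarrow> norm (f x) \<le> K"
    unfolding bounded_iff by auto
  have "S \<in> lmeasurable" using S by (simp add: bounded_set_imp_lmeasurable)
  then have fin: "finite_measure (lebesgue_on S)"
    by (rule finite_measure_lebesgue_on)
  have "AE x in lebesgue_on S. norm ((norm (f x))\<^sup>2) \<le> K\<^sup>2"
    using cd K by (intro AE_I2) (auto simp: space_restrict_space power_mono)
  then have "integrable (lebesgue_on S) (\<lambda>x. (norm (f x))\<^sup>2)"
    using meas by (intro finite_measure.integrable_const_bound[OF fin]) auto
  then show ?thesis using meas by (simp add: square_integrable_def)
qed

text \<open>Passes from the Lebesgue-complete integrals of the definitions to \<open>lborel\<close>,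
  where product measures and slicing are available.\<close>

lemma integral_lebesgue_on_eq_lborel:
  fixes f :: "'a::euclidean_space \<Rightarrow> real"
  assumes "f \<in> borel_measurable borel" "S \<in> sets borel"
  shows "(LINT x|lebesgue_on S. f x) = (LINT x|lborel. indicator S x * f x)"
proof -
  have "(LINT x|lebesgue_on S. f x) = (LINT x|lebesgue. indicator S x *\<^sub>R f x)"
    using assms by (intro integral_restrict_space) auto
  also have "\<dots> = (LINT x|lborel. indicator S x *\<^sub>R f x)"
    using assms by (intro integral_completion) auto
  finally show ?thesis by simp
qed

subsection \<open>Weak gradients\<close>

text \<open>Boxes are stable under intersection and generate the Borel sets, so vanishing integrals
  spread to all Borel sets by Dynkin's argument. Complements require the total integral, which is
  the limit over growing cubes.\<close>

lemma AE_eq_zero_if_box_integrals_zero: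
  fixes f :: "'a::euclidean_space \<Rightarrow> real"
  assumes f: "integrable lborel f"
    and box: "\<And>a b. (LINT x:box a b|lborel. f x) = 0"
  shows "AE x in lborel. f x = 0"
proof (rule density_unique_real)
  have sint: "set_integrable lborel A f" if "A \<in> sets borel" for A
    using integrable_mult_indicator[of A lborel f] that f by (simp add: set_integrable_def)
  have total: "(LINT x|lborel. f x) = 0"
  proof -
    have One: "x \<in> box (- real n *\<^sub>R One) (real n *\<^sub>R One)" if "norm x < real n" for x :: 'a and n
    proof -
      have "\<bar>x \<bullet> i\<bar> < real n" if "i \<in> Basis" for i
        using Basis_le_norm[OF that, of x] \<open>norm x < real n\<close> by linarith
      then show ?thesis by (auto simp: mem_box abs_less_iff minus_less_iff)
    qed
    have "(\<lambda>n. LINT x|lborel. indicator (box (- real n *\<^sub>R One) (real n *\<^sub>R One)) x *\<^sub>R f x)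
        \<longlonglongrightarrow> (LINT x|lborel. f x)"
    proof (rule integral_dominated_convergence[where w = "\<lambda>x. \<bar>f x\<bar>"])
      show "AE x in lborel. (\<lambda>n. indicator (box (- real n *\<^sub>R One) (real n *\<^sub>R One)) x *\<^sub>R f x) \<longlonglongrightarrow> f x"
      proof (rule AE_I2)
        fix x :: 'a
        obtain N where N: "norm x < real N" using reals_Archimedean2 by blast
        have "\<forall>\<^sub>F n in sequentially. indicator (box (- real n *\<^sub>R One) (real n *\<^sub>R One)) x *\<^sub>R f x = f x"
          using eventually_ge_at_top[of N]
        proof eventually_elim
          case (elim n)
          then have "norm x < real n" using N by linarith
          then show ?case using One by simp
        qed
        then show "(\<lambda>n. indicator (box (- real n *\<^sub>R One) (real n *\<^sub>R One)) x *\<^sub>R f x) \<longlonglongrightarrow> f x"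
          by (rule tendsto_eventually)
      qed
    qed (use f in \<open>auto simp: indicator_def\<close>)
    moreover have "(LINT x|lborel. indicator (box (- real n *\<^sub>R One) (real n *\<^sub>R One)) x *\<^sub>R f x) = 0" for n
      using box unfolding set_lebesgue_integral_def by blast
    ultimately show ?thesis by (simp add: LIMSEQ_const_iff)
  qed
  fix A :: "'a set" assume "A \<in> sets lborel"
  then have gen: "A \<in> sigma_sets UNIV (range (\<lambda>(a, b). box a b))"
    by (simp add: borel_eq_box)
  have stable: "Int_stable (range (\<lambda>(a, b). box a b :: 'a set))"
  proof (rule Int_stableI, clarify)
    fix p q r s :: 'a
    obtain u v where "box p q \<inter> box r s = box u v" using box_Int_box[of p q r s] by blast
    then show "box p q \<inter> box r s \<in> range (\<lambda>(a, b). box a b)"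
      by (intro range_eqI[of _ _ "(u, v)"]) simp
  qed
  from stable subset_UNIV[of "range (\<lambda>(a, b). box a b)", folded Pow_UNIV] gen
  have "(LINT x:A|lborel. f x) = 0"
  proof (induction rule: sigma_sets_induct_disjoint)
    case (compl A)
    then have A: "A \<in> sets borel" by (simp add: borel_eq_box)
    have "(LINT x:A \<union> (UNIV - A)|lborel. f x) = (LINT x:A|lborel. f x) + (LINT x:(UNIV - A)|lborel. f x)"
      using A by (intro set_integral_Un sint) auto
    then show ?case using compl total by (simp add: set_lebesgue_integral_def)
  next
    case (union A)
    then have A: "range A \<subseteq> sets borel" by (simp add: borel_eq_box)
    have "(LINT x:(\<Union>i. A i)|lborel. f x) = (\<Sum>i. (LINT x:(A i)|lborel. f x))"
      using union A by (intro lebesgue_integral_countable_add sint) (auto simp: disjoint_family_on_def)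
    then show ?case using union by simp
  next
    case (basic A)
    then show ?case using box by auto
  qed (auto simp: set_lebesgue_integral_def)
  then show "(LINT x:A|lborel. f x) = (LINT x:A|lborel. 0)" by (simp add: set_lebesgue_integral_def)
qed (use f in auto)

text \<open>The fundamental lemma of the calculus of variations. Since \<open>bump n c d\<close>
  converges boundedly to the indicator of the box, orthogonality gives zero integrals over boxes
  whose closed box lies in \<Omega>. Vanishing is then shown on each closed box inside \<Omega>,
  countably many of which cover it.\<close>

lemma AE_eq_zero_if_orthogonal_to_test_functions:
  assumes \<Omega>: "open \<Omega>" and g: "integrable (lebesgue_on \<Omega>) g"
    and orth: "\<And>\<phi>. test_function \<Omega> \<phi> \<Longrightarrow> (LINT x|lebesgue_on \<Omega>. g x * \<phi> x) = 0"
  shows "AE x in lebesgue_on \<Omega>. g x = 0"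
proof -
  have \<Omega>_meas: "\<Omega> \<in> sets lebesgue" using \<Omega> by simp
  have g': "integrable lebesgue (\<lambda>x. indicator \<Omega> x * g x)"
    using g \<Omega>_meas integrable_restrict_space[of \<Omega> lebesgue g] by simp
  \<comment> \<open>A Borel representative is chosen because \<open>g\<close> is only Lebesgue
    measurable, while the argument with boxes takes place in \<open>lborel\<close>.\<close>
  then obtain f where f: "f \<in> borel_measurable lborel" "AE x in lborel. indicator \<Omega> x * g x = f x"
    using completion_ex_borel_measurable_real[of "\<lambda>x. indicator \<Omega> x * g x" lborel] by auto
  have f_leb: "AE x in lebesgue. indicator \<Omega> x * g x = f x"
    using f(2) by (rule AE_completion)
  have f_int_leb: "integrable lebesgue f"
    using f(1) by (intro integrable_cong_AE_imp[OF g' _ f_leb] measurable_completion) simp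
  then have f_int: "integrable lborel f" using f(1) by (simp add: integrable_completion)
  have box_zero: "(LINT x:box c d|lborel. f x) = 0" if "cbox c d \<subseteq> \<Omega>" for c d
  proof -
    have [measurable]: "bump n c d \<in> borel_measurable borel" for n
      using smooth_imp_continuous_on[OF smooth_bump] by (rule borel_measurable_continuous_onI)
    note [measurable] = f(1)
    have "(LINT x|lborel. f x * bump n c d x) = 0" for n
    proof -
      have "(LINT x|lborel. f x * bump n c d x) = (LINT x|lebesgue. f x * bump n c d x)"
        by (rule integral_completion[symmetric]) measurable
      also have "\<dots> = (LINT x|lebesgue. indicator \<Omega> x *\<^sub>R (g x * bump n c d x))"
      proof (rule integral_cong_AE)
        show "AE x in lebesgue. f x * bump n c d x = indicator \<Omega> x *\<^sub>R (g x * bump n c d x)"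
          using f_leb by eventually_elim (metis mult.assoc real_scaleR_def)
        have m: "bump n c d \<in> borel_measurable lebesgue" by (rule measurable_completion) measurable
        have "(\<lambda>x. (indicator \<Omega> x * g x) * bump n c d x) \<in> borel_measurable lebesgue"
          by (rule borel_measurable_times[OF borel_measurable_integrable[OF g'] m])
        then show "(\<lambda>x. indicator \<Omega> x *\<^sub>R (g x * bump n c d x)) \<in> borel_measurable lebesgue"
          by (simp add: mult.assoc)
        show "(\<lambda>x. f x * bump n c d x) \<in> borel_measurable lebesgue"
          by (rule measurable_completion) measurable
      qed
      also have "\<dots> = (LINT x|lebesgue_on \<Omega>. g x * bump n c d x)"
        using \<Omega>_meas by (intro integral_restrict_space[symmetric]) auto
      also have "\<dots> = 0" by (intro orth test_function_bump that)
      finally show ?thesis .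
    qed
    moreover have "(\<lambda>n. LINT x|lborel. f x * bump n c d x) \<longlonglongrightarrow> (LINT x|lborel. indicator (box c d) x *\<^sub>R f x)"
    proof (rule integral_dominated_convergence[where w = "\<lambda>x. \<bar>f x\<bar>"])
      show "AE x in lborel. (\<lambda>n. f x * bump n c d x) \<longlonglongrightarrow> indicator (box c d) x *\<^sub>R f x"
        using tendsto_mult_left[OF bump_tendsto_indicator] by (intro AE_I2) (simp add: mult.commute)
      show "AE x in lborel. norm (f x * bump n c d x) \<le> \<bar>f x\<bar>" for n
        by (intro AE_I2, unfold real_norm_def abs_mult abs_of_nonneg[OF bump_bounds(1)],
            rule mult_left_le[OF bump_bounds(2) abs_ge_zero])
    qed (use f_int in \<open>auto intro: integrable_abs\<close>)
    ultimately show ?thesis by (simp add: set_lebesgue_integral_def LIMSEQ_const_iff)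
  qed
  have local_zero: "AE x in lborel. x \<in> cbox c d \<longrightarrow> f x = 0" if cd: "cbox c d \<subseteq> \<Omega>" for c d
  proof -
    \<comment> \<open>After cutting off to \<open>box c d\<close>, the integral over an arbitrary
      box becomes one over its intersection with \<open>box c d\<close>, which is again a box, and
      one to which \<open>box_zero\<close> applies.\<close>
    have "AE x in lborel. indicator (box c d) x *\<^sub>R f x = 0"
    proof (rule AE_eq_zero_if_box_integrals_zero)
      show "integrable lborel (\<lambda>x. indicator (box c d) x *\<^sub>R f x)"
        using f_int by (intro integrable_mult_indicator) auto
      fix p q :: "real \<times> real"
      obtain r s where rs: "box p q \<inter> box c d = box r s"
        using box_Int_box[of p q c d] by blast
      have "(LINT x:box p q|lborel. indicator (box c d) x *\<^sub>R f x) = (LINT x:box r s|lborel. f x)"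
        unfolding set_lebesgue_integral_def rs[symmetric]
        by (intro Bochner_Integration.integral_cong refl) (simp add: indicator_def)
      also have "\<dots> = 0"
      proof (cases "box r s = {}")
        case False
        then have "cbox r s = closure (box r s)" by (simp add: closure_box)
        also have "\<dots> \<subseteq> closure (cbox c d)" using rs box_subset_cbox by (intro closure_mono) blast
        also have "\<dots> \<subseteq> \<Omega>" using cd by (simp add: closure_closed closed_cbox)
        finally show ?thesis by (rule box_zero)
      qed (simp add: set_lebesgue_integral_def)
      finally show "(LINT x:box p q|lborel. indicator (box c d) x *\<^sub>R f x) = 0" .
    qed
    moreover have "AE x in lborel. x \<notin> cbox c d - box c d"
    proof (rule AE_not_in)
      have "negligible (cbox c d - box c d)" by (rule negligible_frontier_interval)
      then have "cbox c d - box c d \<in> null_sets lebesgue" by (simp add: negligible_iff_null_sets)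
      then show "cbox c d - box c d \<in> null_sets lborel"
        by (auto simp: null_sets_completion_iff)
    qed
    ultimately show ?thesis by eventually_elim (auto simp: indicator_def split: if_splits)
  qed
  obtain \<D> where \<D>: "countable \<D>" "\<D> \<subseteq> Pow \<Omega>" "\<And>X. X \<in> \<D> \<Longrightarrow> \<exists>a b. X = cbox a b" "\<Union>\<D> = \<Omega>"
    using open_countable_Union_open_cbox[OF \<Omega>] by blast
  have "AE x in lborel. x \<in> X \<longrightarrow> f x = 0" if "X \<in> \<D>" for X
    using \<D>(3)[OF that] \<D>(2) that local_zero by blast
  then have "AE x in lborel. \<forall>X\<in>\<D>. x \<in> X \<longrightarrow> f x = 0"
    by (rule AE_ball_countable'[OF _ \<D>(1)])
  then have "AE x in lebesgue. \<forall>X\<in>\<D>. x \<in> X \<longrightarrow> f x = 0"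
    by (rule AE_completion)
  then have "AE x in lebesgue. x \<in> \<Omega> \<longrightarrow> g x = 0"
    using f_leb by eventually_elim (use \<D>(4) in \<open>auto simp: indicator_def split: if_splits\<close>)
  then show ?thesis using \<Omega>_meas by (simp add: AE_restrict_space_iff)
qed

lemma continuous_on_gradient_inner_scaled:
  assumes "smooth \<phi>"
  shows "continuous_on UNIV (\<lambda>x. gradient \<phi> x \<bullet> e)" "continuous_on UNIV (\<lambda>x. \<phi> x *\<^sub>R (e :: real \<times> real))"
  by (intro continuous_intros continuous_on_gradient smooth_imp_continuous_on assms)+

lemma is_weak_gradientD:
  assumes "is_weak_gradient \<Omega> u G" "test_function \<Omega> \<phi>"
  shows "(LINT x|lebesgue_on \<Omega>. u x * (gradient \<phi> x \<bullet> e)) = - (LINT x|lebesgue_on \<Omega>. (G x \<bullet> e) * \<phi> x)"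
proof -
  have "smooth \<phi>" using assms(2) by (simp add: test_function_def)
  then show ?thesis
    using assms(1)[unfolded is_weak_gradient_def, rule_format, OF assms(2), of e]
    by (simp only: smooth_frechet_derivative)
qed

text \<open>Allowing two functions that agree only almost everywhere makes this serve twice: it
  identifies the gradient selected by \<open>weak_grad\<close> with any explicit one, and it shows
  that a function vanishing almost everywhere has gradient zero almost everywhere.\<close>

lemma weak_gradient_unique_AE:
  assumes \<Omega>: "open \<Omega>" "bounded \<Omega>"
    and u: "square_integrable (lebesgue_on \<Omega>) u" "square_integrable (lebesgue_on \<Omega>) v"
    and G: "square_integrable (lebesgue_on \<Omega>) G" "square_integrable (lebesgue_on \<Omega>) H"
    and weak: "is_weak_gradient \<Omega> u G" "is_weak_gradient \<Omega> v H"
    and eq: "AE x in lebesgue_on \<Omega>. u x = v x"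
  shows "AE x in lebesgue_on \<Omega>. G x = H x"
proof -
  have \<Omega>_meas: "\<Omega> \<in> sets lebesgue" using \<Omega> by simp
  note sq_cont = square_integrable_continuous[OF _ \<Omega>(2) \<Omega>_meas]
  have comp: "AE x in lebesgue_on \<Omega>. (G x - H x) \<bullet> e = 0" for e
  proof (rule AE_eq_zero_if_orthogonal_to_test_functions[OF \<Omega>(1)])
    show "integrable (lebesgue_on \<Omega>) (\<lambda>x. (G x - H x) \<bullet> e)"
      by (intro square_integrable_inner square_integrable_diff G sq_cont continuous_on_const)
    fix \<phi> assume \<phi>: "test_function \<Omega> \<phi>"
    then have s: "smooth \<phi>" by (simp add: test_function_def)
    have int: "integrable (lebesgue_on \<Omega>) (\<lambda>x. (K x \<bullet> e) * \<phi> x)" if "square_integrable (lebesgue_on \<Omega>) K" for K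
      using square_integrable_inner[OF that sq_cont[OF continuous_on_gradient_inner_scaled(2)[OF s], of e]]
      by (simp add: mult.commute)
    have meas: "(\<lambda>x. gradient \<phi> x \<bullet> e) \<in> borel_measurable (lebesgue_on \<Omega>)"
      using sq_cont[OF continuous_on_gradient_inner_scaled(1)[OF s, of e]] by (simp add: square_integrable_def)
    have "(LINT x|lebesgue_on \<Omega>. (G x \<bullet> e) * \<phi> x) = - (LINT x|lebesgue_on \<Omega>. u x * (gradient \<phi> x \<bullet> e))"
      by (simp add: is_weak_gradientD[OF weak(1) \<phi>])
    also have "(LINT x|lebesgue_on \<Omega>. u x * (gradient \<phi> x \<bullet> e)) = (LINT x|lebesgue_on \<Omega>. v x * (gradient \<phi> x \<bullet> e))"
      using eq u meas by (intro integral_cong_AE borel_measurable_times) (auto simp: square_integrable_def)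
    also have "- \<dots> = (LINT x|lebesgue_on \<Omega>. (H x \<bullet> e) * \<phi> x)"
      by (simp add: is_weak_gradientD[OF weak(2) \<phi>])
    finally show "(LINT x|lebesgue_on \<Omega>. ((G x - H x) \<bullet> e) * \<phi> x) = 0"
      using int[OF G(1)] int[OF G(2)] by (simp add: inner_diff_left left_diff_distrib)
  qed
  show ?thesis
    using comp[of "(1, 0)"] comp[of "(0, 1)"]
    by eventually_elim (simp add: inner_prod_def prod_eq_iff)
qed

lemma is_weak_gradient_lincomb:
  assumes \<Omega>: "open \<Omega>" "bounded \<Omega>"
    and u: "square_integrable (lebesgue_on \<Omega>) u" "square_integrable (lebesgue_on \<Omega>) v"
    and G: "square_integrable (lebesgue_on \<Omega>) G" "square_integrable (lebesgue_on \<Omega>) H"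
    and weak: "is_weak_gradient \<Omega> u G" "is_weak_gradient \<Omega> v H"
  shows "is_weak_gradient \<Omega> (\<lambda>x. \<alpha> * u x + \<beta> * v x) (\<lambda>x. \<alpha> *\<^sub>R G x + \<beta> *\<^sub>R H x)"
  unfolding is_weak_gradient_def
proof (intro allI impI)
  fix \<phi> and e :: "real \<times> real" assume \<phi>: "test_function \<Omega> \<phi>"
  then have s: "smooth \<phi>" by (simp add: test_function_def)
  have \<Omega>_meas: "\<Omega> \<in> sets lebesgue" using \<Omega> by simp
  note sq_cont = square_integrable_continuous[OF _ \<Omega>(2) \<Omega>_meas]
  have int1: "integrable (lebesgue_on \<Omega>) (\<lambda>x. (K x \<bullet> e) * \<phi> x)" if "square_integrable (lebesgue_on \<Omega>) K" for K
    using square_integrable_inner[OF that sq_cont[OF continuous_on_gradient_inner_scaled(2)[OF s], of e]]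
    by (simp add: mult.commute)
  have int2: "integrable (lebesgue_on \<Omega>) (\<lambda>x. w x * (gradient \<phi> x \<bullet> e))" if "square_integrable (lebesgue_on \<Omega>) w" for w
    using square_integrable_inner[OF that sq_cont[OF continuous_on_gradient_inner_scaled(1)[OF s], of e]]
    by simp
  show "(LINT x|lebesgue_on \<Omega>. (\<alpha> * u x + \<beta> * v x) * frechet_derivative \<phi> (at x) e) =
       - (LINT x|lebesgue_on \<Omega>. ((\<alpha> *\<^sub>R G x + \<beta> *\<^sub>R H x) \<bullet> e) * \<phi> x)"
    using int1[OF G(1)] int1[OF G(2)] int2[OF u(1)] int2[OF u(2)]
    by (simp add: smooth_frechet_derivative[OF s] inner_add_left distrib_right mult.assoc
        is_weak_gradientD[OF weak(1) \<phi>] is_weak_gradientD[OF weak(2) \<phi>])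
qed

lemma smooth_lincomb:
  fixes \<phi> \<psi> :: "real \<times> real \<Rightarrow> real"
  assumes "smooth \<phi>" "smooth \<psi>"
  shows "smooth (\<lambda>x. \<alpha> * \<phi> x + \<beta> * \<psi> x)"
  using assms unfolding smooth_def by (intro allI Ck_add Ck_mult Ck_const) auto

lemma gradient_eqI:
  assumes "(f has_derivative (\<lambda>v. g \<bullet> v)) (at x)"
  shows "gradient f x = g"
  unfolding gradient_def frechet_derivative_eqI[OF assms] by (simp add: inner_prod_def prod_eq_iff)

lemma gradient_lincomb:
  assumes "smooth \<phi>" "smooth \<psi>"
  shows "gradient (\<lambda>x. \<alpha> * \<phi> x + \<beta> * \<psi> x) x = \<alpha> *\<^sub>R gradient \<phi> x + \<beta> *\<^sub>R gradient \<psi> x"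
proof (rule gradient_eqI)
  have "((\<lambda>x. \<alpha> * \<phi> x + \<beta> * \<psi> x) has_derivative
      (\<lambda>v. \<alpha> * (gradient \<phi> x \<bullet> v) + \<beta> * (gradient \<psi> x \<bullet> v))) (at x)"
    by (intro has_derivative_add has_derivative_mult_right smooth_has_derivative assms)
  then show "((\<lambda>x. \<alpha> * \<phi> x + \<beta> * \<psi> x) has_derivative
      (\<lambda>v. (\<alpha> *\<^sub>R gradient \<phi> x + \<beta> *\<^sub>R gradient \<psi> x) \<bullet> v)) (at x)"
    by (simp add: inner_add_left)
qed

section \<open>Green's formula and the Poincare inequality for smooth functions\<close>

context lower_domain
begin

lemma domain_sets: "\<Omega> \<in> sets borel" "\<Omega> \<in> sets lebesgue"
  using open_domain by auto

lemmas square_integrable_domain = square_integrable_continuous[OF _ bounded_domain domain_sets(2)]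

lemma square_integrable_interval:
  "continuous_on UNIV f \<Longrightarrow> square_integrable (lebesgue_on {a..b}) (f :: real \<Rightarrow> real)"
  by (rule square_integrable_continuous) auto

lemma square_integrable_trace:
  assumes "smooth \<phi>"
  shows "square_integrable (lebesgue_on {a..b}) (\<lambda>s. \<phi> (s, 0 :: real) :: real)"
proof (rule square_integrable_interval)
  have "continuous_on UNIV (\<lambda>s. (s, 0 :: real))" by (intro continuous_intros)
  from continuous_on_compose2[OF smooth_imp_continuous_on[OF assms] this subset_UNIV]
  show "continuous_on UNIV (\<lambda>s. \<phi> (s, 0))" by simp
qed

text \<open>The divergence theorem for the constant direction \<open>e\<close>: the part
  \<open>B\<close> contributes nothing, and on the free part the outer normal is
  \<open>(0, 1)\<close>, whence the factor \<open>snd e\<close>.\<close>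

lemma integral_gradient:
  assumes der: "\<And>z. (f has_derivative (\<lambda>v. g z \<bullet> v)) (at z)" and cont: "continuous_on UNIV g"
    and zero: "\<And>z. z \<in> B \<Longrightarrow> f z = 0"
  shows "(LINT z|lebesgue_on \<Omega>. g z \<bullet> e) = snd e * (LINT s|lebesgue_on {a..b}. f (s, 0))"
proof -
  have contf: "continuous_on UNIV f"
    by (intro continuous_at_imp_continuous_on ballI has_derivative_continuous[OF der])
  have contf0: "continuous_on UNIV (\<lambda>s. f (s, 0))"
    by (rule continuous_on_compose2[OF contf]) (auto intro!: continuous_intros)
  have cont12: "continuous_on UNIV (\<lambda>z. fst (g z))" "continuous_on UNIV (\<lambda>z. snd (g z))"
    by (intro continuous_intros cont)+
  have 1: "(LINT z|lborel. indicator \<Omega> z * fst (g z)) = 0"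
  proof (rule integral_partial_fst[OF _ cont12(1) zero])
    fix x y :: real
    have "((\<lambda>t. (t, y)) has_derivative (\<lambda>h. (h, 0))) (at x)"
      by (intro derivative_intros)
    from has_derivative_compose[OF this der]
    show "((\<lambda>t. f (t, y)) has_real_derivative fst (g (x, y))) (at x)"
      by (simp add: has_field_derivative_def inner_prod_def)
  qed
  have 2: "(LINT z|lborel. indicator \<Omega> z * snd (g z)) = (LINT s|lborel. indicator {a..b} s * f (s, 0))"
  proof (rule integral_partial_snd[OF contf _ cont12(2) zero])
    fix x y :: real
    have "((\<lambda>t. (x, t)) has_derivative (\<lambda>h. (0, h))) (at y)"
      by (intro derivative_intros)
    from has_derivative_compose[OF this der]
    show "((\<lambda>t. f (x, t)) has_real_derivative snd (g (x, y))) (at y)"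
      by (simp add: has_field_derivative_def inner_prod_def)
  qed
  have "(LINT z|lebesgue_on \<Omega>. g z \<bullet> e) = (LINT z|lborel. indicator \<Omega> z * (g z \<bullet> e))"
    by (intro integral_lebesgue_on_eq_lborel borel_measurable_continuous_onI continuous_intros cont domain_sets)
  also have "\<dots> = (LINT z|lborel. fst e * (indicator \<Omega> z * fst (g z)) + snd e * (indicator \<Omega> z * snd (g z)))"
    by (intro Bochner_Integration.integral_cong refl) (simp add: inner_prod_def algebra_simps)
  also have "\<dots> = fst e * 0 + snd e * (LINT s|lborel. indicator {a..b} s * f (s, 0))"
    using integrable_indicator_continuous[OF cont12(1)] integrable_indicator_continuous[OF cont12(2)]
    by (simp add: 1 2)
  also have "(LINT s|lborel. indicator {a..b} s * f (s, 0)) = (LINT s|lebesgue_on {a..b}. f (s, 0))"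
    by (intro integral_lebesgue_on_eq_lborel[symmetric] borel_measurable_continuous_onI contf0) auto
  finally show ?thesis by simp
qed

text \<open>Apply \<open>integral_gradient\<close> to the two products of \<phi> with a component of
  the field; the terms in which the field is differentiated add up to \<phi> times its
  divergence.\<close>

lemma integral_gradient_inner_divergence_free:
  assumes \<phi>: "smooth \<phi>" "\<And>z. z \<in> B \<Longrightarrow> \<phi> z = 0"
    and W1: "\<And>z. (W1 has_derivative (\<lambda>v. g1 z \<bullet> v)) (at z)" "continuous_on UNIV g1"
    and W2: "\<And>z. (W2 has_derivative (\<lambda>v. g2 z \<bullet> v)) (at z)" "continuous_on UNIV g2"
    and div: "\<And>z. fst (g1 z) + snd (g2 z) = 0"
  shows "(LINT z|lebesgue_on \<Omega>. gradient \<phi> z \<bullet> (W1 z, W2 z)) = (LINT s|lebesgue_on {a..b}. \<phi> (s, 0) * W2 (s, 0))"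
proof -
  have contW: "continuous_on UNIV W1" "continuous_on UNIV W2"
    by (intro continuous_at_imp_continuous_on ballI has_derivative_continuous[OF W1(1)]
        has_derivative_continuous[OF W2(1)])+
  note cont = contW W1(2) W2(2) smooth_imp_continuous_on[OF \<phi>(1)] continuous_on_gradient[OF \<phi>(1)]
  have der: "((\<lambda>z. \<phi> z * W1 z) has_derivative (\<lambda>v. (\<phi> z *\<^sub>R g1 z + W1 z *\<^sub>R gradient \<phi> z) \<bullet> v)) (at z)"
    "((\<lambda>z. \<phi> z * W2 z) has_derivative (\<lambda>v. (\<phi> z *\<^sub>R g2 z + W2 z *\<^sub>R gradient \<phi> z) \<bullet> v)) (at z)" for z
    by (auto intro!: derivative_eq_intros smooth_has_derivative \<phi> W1 W2 simp: inner_add_left mult.commute)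
  have i1: "(LINT z|lebesgue_on \<Omega>. (\<phi> z *\<^sub>R g1 z + W1 z *\<^sub>R gradient \<phi> z) \<bullet> (1, 0)) = 0"
    using integral_gradient[OF der(1), of "(1, 0)"] \<phi>(2) by (simp add: continuous_intros cont)
  have i2: "(LINT z|lebesgue_on \<Omega>. (\<phi> z *\<^sub>R g2 z + W2 z *\<^sub>R gradient \<phi> z) \<bullet> (0, 1)) =
      (LINT s|lebesgue_on {a..b}. \<phi> (s, 0) * W2 (s, 0))"
    using integral_gradient[OF der(2), of "(0, 1)"] \<phi>(2) by (simp add: continuous_intros cont)
  have int: "integrable (lebesgue_on \<Omega>) (\<lambda>z. (\<phi> z *\<^sub>R g1 z + W1 z *\<^sub>R gradient \<phi> z) \<bullet> (1, 0))"
    "integrable (lebesgue_on \<Omega>) (\<lambda>z. (\<phi> z *\<^sub>R g2 z + W2 z *\<^sub>R gradient \<phi> z) \<bullet> (0, 1))"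
    by (intro square_integrable_inner square_integrable_domain continuous_intros cont)+
  have "gradient \<phi> z \<bullet> (W1 z, W2 z) = (\<phi> z *\<^sub>R g1 z + W1 z *\<^sub>R gradient \<phi> z) \<bullet> (1, 0) +
      (\<phi> z *\<^sub>R g2 z + W2 z *\<^sub>R gradient \<phi> z) \<bullet> (0, 1)" for z
    using div[of z] by (simp add: inner_prod_def algebra_simps flip: distrib_left)
  then show ?thesis
    using Bochner_Integration.integral_add[OF int] by (simp add: i1 i2)
qed

text \<open>The product with a test function vanishes on the entire frontier, the free part
  included, so the boundary integral is zero although \<phi> itself is unrestricted.\<close>

lemma smooth_is_weak_gradient:
  assumes \<phi>: "smooth \<phi>"
  shows "is_weak_gradient \<Omega> \<phi> (gradient \<phi>)"
  unfolding is_weak_gradient_def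
proof (intro allI impI)
  fix \<psi> and e :: "real \<times> real" assume t: "test_function \<Omega> \<psi>"
  then have \<psi>: "smooth \<psi>" by (simp add: test_function_def)
  have outside: "\<psi> z = 0" if "z \<notin> \<Omega>" for z
    using t that closure_subset[of "{x. \<psi> x \<noteq> 0}"] unfolding test_function_def by blast
  have fr: "z \<in> frontier \<Omega> \<Longrightarrow> z \<notin> \<Omega>" for z
    using open_domain by (simp add: frontier_def interior_open)
  note cont = smooth_imp_continuous_on[OF \<phi>] continuous_on_gradient[OF \<phi>]
    smooth_imp_continuous_on[OF \<psi>] continuous_on_gradient[OF \<psi>]
  have der: "((\<lambda>z. \<phi> z * \<psi> z) has_derivative (\<lambda>v. (\<phi> z *\<^sub>R gradient \<psi> z + \<psi> z *\<^sub>R gradient \<phi> z) \<bullet> v)) (at z)" for z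
    by (auto intro!: derivative_eq_intros smooth_has_derivative \<phi> \<psi> simp: inner_add_left mult.commute)
  have "(LINT z|lebesgue_on \<Omega>. (\<phi> z *\<^sub>R gradient \<psi> z + \<psi> z *\<^sub>R gradient \<phi> z) \<bullet> e) =
      snd e * (LINT s|lebesgue_on {a..b}. \<phi> (s, 0) * \<psi> (s, 0))"
    using fr frontier_domain by (intro integral_gradient der continuous_intros cont) (simp add: outside)
  also have "(LINT s|lebesgue_on {a..b}. \<phi> (s, 0) * \<psi> (s, 0)) = 0"
    using fr frontier_domain by (intro integral_eq_zero_AE AE_I2) (simp add: space_restrict_space outside)
  finally have "(LINT z|lebesgue_on \<Omega>. \<phi> z * (gradient \<psi> z \<bullet> e) + (gradient \<phi> z \<bullet> e) * \<psi> z) = 0"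
    by (simp add: inner_add_left mult.commute)
  moreover have "integrable (lebesgue_on \<Omega>) (\<lambda>z. \<phi> z \<bullet> (gradient \<psi> z \<bullet> e))"
    "integrable (lebesgue_on \<Omega>) (\<lambda>z. (gradient \<phi> z \<bullet> e) \<bullet> \<psi> z)"
    by (intro square_integrable_inner square_integrable_domain continuous_intros cont)+
  ultimately show "(LINT x|lebesgue_on \<Omega>. \<phi> x * frechet_derivative \<psi> (at x) e) =
       - (LINT x|lebesgue_on \<Omega>. (gradient \<phi> x \<bullet> e) * \<psi> x)"
    by (simp add: smooth_frechet_derivative[OF \<psi>])
qed

text \<open>Differentiate \<open>X * \<phi>^2\<close> in the first direction, where \<open>X\<close>
  is the distance from the left side of the strip. The normal on the free part is vertical, so
  integration leaves no boundary term. Since \<open>X\<close> is at most \<open>b - a\<close> on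
  \<Omega>, Young's inequality bounds the mixed term, and half of the integral of
  \<open>\<phi>^2\<close> is absorbed on the left, which produces the factor 4.\<close>

lemma Poincare_smooth:
  assumes \<phi>: "smooth \<phi>" "\<And>z. z \<in> B \<Longrightarrow> \<phi> z = 0"
  shows "(LINT z|lebesgue_on \<Omega>. (\<phi> z)\<^sup>2) \<le> 4 * (b - a)\<^sup>2 * (LINT z|lebesgue_on \<Omega>. (norm (gradient \<phi> z))\<^sup>2)"
proof -
  note cont = smooth_imp_continuous_on[OF \<phi>(1)] continuous_on_gradient[OF \<phi>(1)]
  define d where "d z = fst (gradient \<phi> z)" for z
  define X where "X z = fst z - a" for z :: "real \<times> real"
  have contd: "continuous_on UNIV d" "continuous_on UNIV X"
    unfolding d_def X_def by (intro continuous_intros cont)+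
  let ?g = "\<lambda>z. (\<phi> z)\<^sup>2 *\<^sub>R (1, 0) + (2 * X z * \<phi> z) *\<^sub>R gradient \<phi> z"
  have der: "((\<lambda>z. X z * (\<phi> z)\<^sup>2) has_derivative (\<lambda>v. ?g z \<bullet> v)) (at z)" for z
    unfolding X_def
    by (auto intro!: derivative_eq_intros smooth_has_derivative \<phi> simp: inner_prod_def algebra_simps)
  have "(LINT z|lebesgue_on \<Omega>. ?g z \<bullet> (1, 0)) = 0"
    using \<phi>(2) by (subst integral_gradient[OF der]) (auto intro!: continuous_intros cont contd)
  then have "(LINT z|lebesgue_on \<Omega>. (\<phi> z)\<^sup>2 + 2 * X z * \<phi> z * d z) = 0"
    by (simp add: inner_prod_def d_def algebra_simps)
  moreover have int: "integrable (lebesgue_on \<Omega>) (\<lambda>z. (2 * X z * \<phi> z) \<bullet> d z)"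
    by (intro square_integrable_inner square_integrable_domain continuous_intros cont contd)
  moreover have int2: "integrable (lebesgue_on \<Omega>) (\<lambda>z. (\<phi> z)\<^sup>2)"
    "integrable (lebesgue_on \<Omega>) (\<lambda>z. (norm (gradient \<phi> z))\<^sup>2)"
    using square_integrable_domain[OF cont(1)] square_integrable_domain[OF cont(2)]
    by (simp_all add: square_integrable_def)
  ultimately have "(LINT z|lebesgue_on \<Omega>. (\<phi> z)\<^sup>2) = (LINT z|lebesgue_on \<Omega>. - (2 * X z * \<phi> z * d z))"
    by simp
  also have "\<dots> \<le> (LINT z|lebesgue_on \<Omega>. (\<phi> z)\<^sup>2 / 2 + 2 * (b - a)\<^sup>2 * (norm (gradient \<phi> z))\<^sup>2)"
  proof (rule integral_mono)
    show "integrable (lebesgue_on \<Omega>) (\<lambda>z. - (2 * X z * \<phi> z * d z))"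
      using int by simp
    show "integrable (lebesgue_on \<Omega>) (\<lambda>z. (\<phi> z)\<^sup>2 / 2 + 2 * (b - a)\<^sup>2 * (norm (gradient \<phi> z))\<^sup>2)"
      using int2 by simp
    fix z assume "z \<in> space (lebesgue_on \<Omega>)"
    then have "z \<in> \<Omega>" by (simp add: space_restrict_space)
    then have X: "0 \<le> X z" "X z \<le> b - a" using domain_subset by (auto simp: X_def)
    have "0 \<le> (\<phi> z + 2 * (X z * d z))\<^sup>2" by simp
    then have "- (2 * X z * \<phi> z * d z) \<le> (\<phi> z)\<^sup>2 / 2 + 2 * ((X z)\<^sup>2 * (d z)\<^sup>2)"
      by (simp add: power2_eq_square algebra_simps)
    also have "(X z)\<^sup>2 * (d z)\<^sup>2 \<le> (b - a)\<^sup>2 * (norm (gradient \<phi> z))\<^sup>2"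
    proof (intro mult_mono)
      show "(X z)\<^sup>2 \<le> (b - a)\<^sup>2" by (intro power_mono X)
      have "\<bar>d z\<bar> \<le> norm (gradient \<phi> z)"
        using norm_fst_le[of "fst (gradient \<phi> z)" "snd (gradient \<phi> z)"] by (simp add: d_def)
      from power_mono[OF this abs_ge_zero, of 2]
      show "(d z)\<^sup>2 \<le> (norm (gradient \<phi> z))\<^sup>2" by simp
    qed auto
    finally show "- (2 * X z * \<phi> z * d z) \<le> (\<phi> z)\<^sup>2 / 2 + 2 * (b - a)\<^sup>2 * (norm (gradient \<phi> z))\<^sup>2"
      by simp
  qed
  also have "\<dots> = (LINT z|lebesgue_on \<Omega>. (\<phi> z)\<^sup>2) / 2 + 2 * (b - a)\<^sup>2 * (LINT z|lebesgue_on \<Omega>. (norm (gradient \<phi> z))\<^sup>2)"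
    using int2 by simp
  finally show ?thesis by linarith
qed

end

subsection \<open>Functions with weak gradient and boundary trace\<close>

lemma integral_norm_add_square_le:
  fixes f g :: "'a \<Rightarrow> 'b::euclidean_space"
  assumes f: "square_integrable M f" and g: "square_integrable M g"
  shows "(LINT x|M. (norm (f x + g x))\<^sup>2) \<le> 2 * (LINT x|M. (norm (f x))\<^sup>2) + 2 * (LINT x|M. (norm (g x))\<^sup>2)"
proof -
  have "(LINT x|M. (norm (f x + g x))\<^sup>2) \<le> (LINT x|M. 2 * (norm (f x))\<^sup>2 + 2 * (norm (g x))\<^sup>2)"
  proof (rule integral_mono)
    show "integrable M (\<lambda>x. (norm (f x + g x))\<^sup>2)" "integrable M (\<lambda>x. 2 * (norm (f x))\<^sup>2 + 2 * (norm (g x))\<^sup>2)"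
      using f g square_integrable_add[OF f g] by (auto simp: square_integrable_def)
    fix x
    have "(norm (f x + g x))\<^sup>2 + (norm (f x - g x))\<^sup>2 = 2 * (norm (f x))\<^sup>2 + 2 * (norm (g x))\<^sup>2"
      by (simp add: power2_norm_eq_inner inner_add inner_diff inner_commute)
    then show "(norm (f x + g x))\<^sup>2 \<le> 2 * (norm (f x))\<^sup>2 + 2 * (norm (g x))\<^sup>2"
      using zero_le_power2[of "norm (f x - g x)"] by linarith
  qed
  also have "\<dots> = 2 * (LINT x|M. (norm (f x))\<^sup>2) + 2 * (LINT x|M. (norm (g x))\<^sup>2)"
    using f g by (simp add: square_integrable_def)
  finally show ?thesis .
qed

lemma integral_norm_lincomb_tendsto_0:
  fixes d e :: "nat \<Rightarrow> 'a \<Rightarrow> 'b::euclidean_space"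
  assumes d: "\<And>n. square_integrable M (d n)" "(\<lambda>n. LINT x|M. (norm (d n x))\<^sup>2) \<longlonglongrightarrow> 0"
    and e: "\<And>n. square_integrable M (e n)" "(\<lambda>n. LINT x|M. (norm (e n x))\<^sup>2) \<longlonglongrightarrow> 0"
  shows "(\<lambda>n. LINT x|M. (norm (\<alpha> *\<^sub>R d n x + \<beta> *\<^sub>R e n x))\<^sup>2) \<longlonglongrightarrow> 0"
proof (rule Lim_null_comparison)
  show "(\<lambda>n. 2 * (\<alpha>\<^sup>2 * (LINT x|M. (norm (d n x))\<^sup>2)) + 2 * (\<beta>\<^sup>2 * (LINT x|M. (norm (e n x))\<^sup>2))) \<longlonglongrightarrow> 0"
    by (intro tendsto_add_zero tendsto_mult_right_zero d e)
  have "(LINT x|M. (norm (\<alpha> *\<^sub>R d n x + \<beta> *\<^sub>R e n x))\<^sup>2) \<le>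
      2 * (\<alpha>\<^sup>2 * (LINT x|M. (norm (d n x))\<^sup>2)) + 2 * (\<beta>\<^sup>2 * (LINT x|M. (norm (e n x))\<^sup>2))" for n
    using integral_norm_add_square_le[OF square_integrable_scaleR[OF d(1)] square_integrable_scaleR[OF e(1)], of \<alpha> n \<beta> n]
    by (simp add: power_mult_distrib)
  then show "\<forall>\<^sub>F n in sequentially. norm (LINT x|M. (norm (\<alpha> *\<^sub>R d n x + \<beta> *\<^sub>R e n x))\<^sup>2) \<le>
      2 * (\<alpha>\<^sup>2 * (LINT x|M. (norm (d n x))\<^sup>2)) + 2 * (\<beta>\<^sup>2 * (LINT x|M. (norm (e n x))\<^sup>2))"
    by (intro always_eventually allI) simp
qed

context lower_domain
begin

text \<open>Carrying the weak gradient as a component avoids the arbitrary choice in \<open>weak_grad\<close>, so that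
  linear combinations are immediate.\<close>

definition sobolev_triple ::
  "(real \<times> real \<Rightarrow> real) \<Rightarrow> (real \<times> real \<Rightarrow> real \<times> real) \<Rightarrow> (real \<Rightarrow> real) \<Rightarrow> bool" where
  "sobolev_triple u G g \<longleftrightarrow>
     square_integrable (lebesgue_on \<Omega>) u \<and> square_integrable (lebesgue_on \<Omega>) G \<and>
     square_integrable (lebesgue_on {a..b}) g \<and> is_weak_gradient \<Omega> u G \<and>
     (\<exists>\<phi> :: nat \<Rightarrow> real \<times> real \<Rightarrow> real.
        (\<forall>n. smooth (\<phi> n) \<and> (\<forall>x\<in>B. \<phi> n x = 0)) \<and>
        (\<lambda>n. LINT x|lebesgue_on \<Omega>. (norm (\<phi> n x - u x))\<^sup>2) \<longlonglongrightarrow> 0 \<and>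
        (\<lambda>n. LINT x|lebesgue_on \<Omega>. (norm (gradient (\<phi> n) x - G x))\<^sup>2) \<longlonglongrightarrow> 0 \<and>
        (\<lambda>n. LINT s|lebesgue_on {a..b}. (norm (\<phi> n (s, 0) - g s))\<^sup>2) \<longlonglongrightarrow> 0)"

lemma square_integrable_smooth:
  assumes "smooth \<phi>"
  shows "square_integrable (lebesgue_on \<Omega>) \<phi>" "square_integrable (lebesgue_on \<Omega>) (gradient \<phi>)"
  using assms by (auto intro!: square_integrable_domain smooth_imp_continuous_on continuous_on_gradient)

lemma weak_grad_spec:
  assumes "square_integrable (lebesgue_on \<Omega>) G" "is_weak_gradient \<Omega> u G"
  shows "square_integrable (lebesgue_on \<Omega>) (weak_grad \<Omega> u)" "is_weak_gradient \<Omega> u (weak_grad \<Omega> u)"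
  using someI[of "\<lambda>G. square_integrable (lebesgue_on \<Omega>) G \<and> is_weak_gradient \<Omega> u G" G] assms
  by (simp_all add: weak_grad_def)

text \<open>\<open>H1_norm\<close> of \<open>\<phi> n - u\<close> contains the gradient chosen for
  the difference. Uniqueness replaces it by the difference of the gradients, after which convergence
  of the norm splits into convergence of functions and of gradients.\<close>

lemma dirichlet_trace_imp_sobolev_triple:
  assumes "dirichlet_trace \<Omega> {a..b} B u g"
  shows "sobolev_triple u (weak_grad \<Omega> u) g"
proof -
  let ?M = "lebesgue_on \<Omega>" and ?G = "weak_grad \<Omega> u"
  from assms obtain \<phi> where u: "u \<in> H1 \<Omega>" and g: "square_integrable (lebesgue_on {a..b}) g"
    and \<phi>: "\<And>n. smooth (\<phi> n)" "\<And>n x. x \<in> B \<Longrightarrow> \<phi> n x = 0"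
    and lim: "(\<lambda>n. H1_norm \<Omega> (\<lambda>x. \<phi> n x - u x)) \<longlonglongrightarrow> 0"
    and limg: "(\<lambda>n. LINT s|lebesgue_on {a..b}. (\<phi> n (s, 0) - g s)\<^sup>2) \<longlonglongrightarrow> 0"
    unfolding dirichlet_trace_def by blast
  have u2: "square_integrable ?M u" using u by (simp add: H1_def)
  have G: "square_integrable ?M ?G" "is_weak_gradient \<Omega> u ?G"
    using u weak_grad_spec by (auto simp: H1_def)
  have d: "square_integrable ?M (\<lambda>x. \<phi> n x - u x)" for n
    by (intro square_integrable_diff square_integrable_smooth \<phi> u2)
  have D: "square_integrable ?M (\<lambda>x. gradient (\<phi> n) x - ?G x)" for n
    by (intro square_integrable_diff square_integrable_smooth \<phi> G)
  have w: "is_weak_gradient \<Omega> (\<lambda>x. \<phi> n x - u x) (\<lambda>x. gradient (\<phi> n) x - ?G x)" for n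
    using is_weak_gradient_lincomb[OF open_domain bounded_domain square_integrable_smooth(1)[OF \<phi>(1)[of n]] u2
        square_integrable_smooth(2)[OF \<phi>(1)[of n]] G(1) smooth_is_weak_gradient[OF \<phi>(1)[of n]]
        G(2), of 1 "-1"] by simp
  have AE_eq: "AE x in ?M. weak_grad \<Omega> (\<lambda>x. \<phi> n x - u x) x = gradient (\<phi> n) x - ?G x" for n
    by (rule weak_gradient_unique_AE[OF open_domain bounded_domain d d
          weak_grad_spec(1)[OF D w] D weak_grad_spec(2)[OF D w] w]) simp
  have H1_eq: "(H1_norm \<Omega> (\<lambda>x. \<phi> n x - u x))\<^sup>2 =
      (LINT x|?M. (norm (\<phi> n x - u x))\<^sup>2) + (LINT x|?M. (norm (gradient (\<phi> n) x - ?G x))\<^sup>2)" for n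
  proof -
    have "(LINT x|?M. (norm (weak_grad \<Omega> (\<lambda>x. \<phi> n x - u x) x))\<^sup>2) =
        (LINT x|?M. (norm (gradient (\<phi> n) x - ?G x))\<^sup>2)"
    proof (rule integral_cong_AE)
      show "AE x in ?M. (norm (weak_grad \<Omega> (\<lambda>x. \<phi> n x - u x) x))\<^sup>2 = (norm (gradient (\<phi> n) x - ?G x))\<^sup>2"
        using AE_eq[of n] by eventually_elim simp
    qed (use D[of n] weak_grad_spec(1)[OF D w, of n] in \<open>auto simp: square_integrable_def\<close>)
    then show ?thesis by (simp add: H1_norm_def)
  qed
  have lim2: "(\<lambda>n. (H1_norm \<Omega> (\<lambda>x. \<phi> n x - u x))\<^sup>2) \<longlonglongrightarrow> 0"
    using tendsto_power[OF lim, of 2] by simp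
  have l1: "(\<lambda>n. LINT x|?M. (norm (\<phi> n x - u x))\<^sup>2) \<longlonglongrightarrow> 0"
    by (rule Lim_null_comparison[OF always_eventually lim2]) (simp add: H1_eq)
  have l2: "(\<lambda>n. LINT x|?M. (norm (gradient (\<phi> n) x - ?G x))\<^sup>2) \<longlonglongrightarrow> 0"
    by (rule Lim_null_comparison[OF always_eventually lim2]) (simp add: H1_eq)
  show ?thesis
    unfolding sobolev_triple_def using u2 G g \<phi> l1 l2 limg
    by (intro conjI exI[of _ \<phi>]) auto
qed

lemma sobolev_triple_zero: "sobolev_triple (\<lambda>_. 0) (\<lambda>_. 0) (\<lambda>_. 0)"
proof -
  have s: "smooth (\<lambda>_::real \<times> real. 0::real)" by (simp add: smooth_def Ck_const)
  have g: "gradient (\<lambda>_. 0) = (\<lambda>_. 0)" by (simp add: gradient_def fun_eq_iff zero_prod_def)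
  show ?thesis
    unfolding sobolev_triple_def
    using square_integrable_smooth[OF s] square_integrable_trace[OF s] smooth_is_weak_gradient[OF s] s
    by (intro conjI exI[of _ "\<lambda>_ _. 0"]) (auto simp: g)
qed

lemma sobolev_triple_lincomb:
  assumes "sobolev_triple u G g" "sobolev_triple v H h"
  shows "sobolev_triple (\<lambda>x. \<alpha> * u x + \<beta> * v x) (\<lambda>x. \<alpha> *\<^sub>R G x + \<beta> *\<^sub>R H x) (\<lambda>s. \<alpha> * g s + \<beta> * h s)"
proof -
  from assms obtain \<phi> where u: "square_integrable (lebesgue_on \<Omega>) u" "square_integrable (lebesgue_on \<Omega>) G"
      "square_integrable (lebesgue_on {a..b}) g" "is_weak_gradient \<Omega> u G"
    and \<phi>: "\<And>n. smooth (\<phi> n)" "\<And>n x. x \<in> B \<Longrightarrow> \<phi> n x = 0"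
      "(\<lambda>n. LINT x|lebesgue_on \<Omega>. (norm (\<phi> n x - u x))\<^sup>2) \<longlonglongrightarrow> 0"
      "(\<lambda>n. LINT x|lebesgue_on \<Omega>. (norm (gradient (\<phi> n) x - G x))\<^sup>2) \<longlonglongrightarrow> 0"
      "(\<lambda>n. LINT s|lebesgue_on {a..b}. (norm (\<phi> n (s, 0) - g s))\<^sup>2) \<longlonglongrightarrow> 0"
    unfolding sobolev_triple_def by blast
  from assms obtain \<psi> where v: "square_integrable (lebesgue_on \<Omega>) v" "square_integrable (lebesgue_on \<Omega>) H"
      "square_integrable (lebesgue_on {a..b}) h" "is_weak_gradient \<Omega> v H"
    and \<psi>: "\<And>n. smooth (\<psi> n)" "\<And>n x. x \<in> B \<Longrightarrow> \<psi> n x = 0"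
      "(\<lambda>n. LINT x|lebesgue_on \<Omega>. (norm (\<psi> n x - v x))\<^sup>2) \<longlonglongrightarrow> 0"
      "(\<lambda>n. LINT x|lebesgue_on \<Omega>. (norm (gradient (\<psi> n) x - H x))\<^sup>2) \<longlonglongrightarrow> 0"
      "(\<lambda>n. LINT s|lebesgue_on {a..b}. (norm (\<psi> n (s, 0) - h s))\<^sup>2) \<longlonglongrightarrow> 0"
    unfolding sobolev_triple_def by blast
  let ?\<chi> = "\<lambda>n x. \<alpha> * \<phi> n x + \<beta> * \<psi> n x"
  have s: "smooth (?\<chi> n)" for n by (intro smooth_lincomb \<phi> \<psi>)
  have l1: "(\<lambda>n. LINT x|lebesgue_on \<Omega>. (norm (\<alpha> *\<^sub>R (\<phi> n x - u x) + \<beta> *\<^sub>R (\<psi> n x - v x)))\<^sup>2) \<longlonglongrightarrow> 0"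
    by (intro integral_norm_lincomb_tendsto_0 square_integrable_diff square_integrable_smooth u v \<phi> \<psi>)
  have l2: "(\<lambda>n. LINT x|lebesgue_on \<Omega>.
      (norm (\<alpha> *\<^sub>R (gradient (\<phi> n) x - G x) + \<beta> *\<^sub>R (gradient (\<psi> n) x - H x)))\<^sup>2) \<longlonglongrightarrow> 0"
    by (intro integral_norm_lincomb_tendsto_0 square_integrable_diff square_integrable_smooth u v \<phi> \<psi>)
  have l3: "(\<lambda>n. LINT s|lebesgue_on {a..b}.
      (norm (\<alpha> *\<^sub>R (\<phi> n (s, 0) - g s) + \<beta> *\<^sub>R (\<psi> n (s, 0) - h s)))\<^sup>2) \<longlonglongrightarrow> 0"
    by (intro integral_norm_lincomb_tendsto_0 square_integrable_diff square_integrable_trace u v \<phi> \<psi>)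
  have "\<alpha> *\<^sub>R (\<phi> n x - u x) + \<beta> *\<^sub>R (\<psi> n x - v x) = ?\<chi> n x - (\<alpha> * u x + \<beta> * v x)" for n x
    by (simp add: algebra_simps)
  note l1 = l1[unfolded this]
  have "\<alpha> *\<^sub>R (gradient (\<phi> n) x - G x) + \<beta> *\<^sub>R (gradient (\<psi> n) x - H x) =
      gradient (?\<chi> n) x - (\<alpha> *\<^sub>R G x + \<beta> *\<^sub>R H x)" for n x
    by (simp add: gradient_lincomb \<phi> \<psi> algebra_simps)
  note l2 = l2[unfolded this]
  have "\<alpha> *\<^sub>R (\<phi> n (s, 0) - g s) + \<beta> *\<^sub>R (\<psi> n (s, 0) - h s) = ?\<chi> n (s, 0) - (\<alpha> * g s + \<beta> * h s)" for n s
    by (simp add: algebra_simps)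
  note l3 = l3[unfolded this]
  have sq: "square_integrable (lebesgue_on \<Omega>) (\<lambda>x. \<alpha> *\<^sub>R u x + \<beta> *\<^sub>R v x)"
    "square_integrable (lebesgue_on \<Omega>) (\<lambda>x. \<alpha> *\<^sub>R G x + \<beta> *\<^sub>R H x)"
    "square_integrable (lebesgue_on {a..b}) (\<lambda>x. \<alpha> *\<^sub>R g x + \<beta> *\<^sub>R h x)"
    by (intro square_integrable_add square_integrable_scaleR u v)+
  have w: "is_weak_gradient \<Omega> (\<lambda>x. \<alpha> * u x + \<beta> * v x) (\<lambda>x. \<alpha> *\<^sub>R G x + \<beta> *\<^sub>R H x)"
    by (rule is_weak_gradient_lincomb[OF open_domain bounded_domain u(1) v(1) u(2) v(2) u(4) v(4)])
  show ?thesis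
    unfolding sobolev_triple_def
  proof (intro conjI exI[of _ ?\<chi>])
    show "\<forall>n. smooth (?\<chi> n) \<and> (\<forall>x\<in>B. ?\<chi> n x = 0)" using s \<phi>(2) \<psi>(2) by simp
  qed (use l1 l2 l3 sq w in simp_all)
qed

lemma sobolev_triple_sum:
  fixes m :: nat
  assumes "\<And>i. i < m \<Longrightarrow> sobolev_triple (u i) (G i) (g i)"
  shows "sobolev_triple (\<lambda>x. \<Sum>i<m. c i * u i x) (\<lambda>x. \<Sum>i<m. c i *\<^sub>R G i x) (\<lambda>s. \<Sum>i<m. c i * g i s)"
  using assms
proof (induction m)
  case 0
  then show ?case by (simp add: sobolev_triple_zero)
next
  case (Suc m)
  have "sobolev_triple (\<lambda>x. \<Sum>i<m. c i * u i x) (\<lambda>x. \<Sum>i<m. c i *\<^sub>R G i x) (\<lambda>s. \<Sum>i<m. c i * g i s)"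
    by (intro Suc.IH Suc.prems) simp
  from sobolev_triple_lincomb[OF this Suc.prems[of m], of 1 "c m"] show ?case by simp
qed

text \<open>Green's formula passes to the limit because each side pairs a sequence convergent in the
  square mean with a fixed square integrable function.\<close>

lemma sobolev_triple_divergence_free:
  assumes t: "sobolev_triple u G g"
    and W1: "\<And>z. (W1 has_derivative (\<lambda>v. g1 z \<bullet> v)) (at z)" "continuous_on UNIV g1"
    and W2: "\<And>z. (W2 has_derivative (\<lambda>v. g2 z \<bullet> v)) (at z)" "continuous_on UNIV g2"
    and div: "\<And>z. fst (g1 z) + snd (g2 z) = 0"
  shows "(LINT z|lebesgue_on \<Omega>. G z \<bullet> (W1 z, W2 z)) = (LINT s|lebesgue_on {a..b}. g s * W2 (s, 0))"
proof -
  from t obtain \<phi> where u: "square_integrable (lebesgue_on \<Omega>) G" "square_integrable (lebesgue_on {a..b}) g"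
    and \<phi>: "\<And>n. smooth (\<phi> n)" "\<And>n x. x \<in> B \<Longrightarrow> \<phi> n x = 0"
      "(\<lambda>n. LINT x|lebesgue_on \<Omega>. (norm (gradient (\<phi> n) x - G x))\<^sup>2) \<longlonglongrightarrow> 0"
      "(\<lambda>n. LINT s|lebesgue_on {a..b}. (norm (\<phi> n (s, 0) - g s))\<^sup>2) \<longlonglongrightarrow> 0"
    unfolding sobolev_triple_def by blast
  have contW: "continuous_on UNIV W1" "continuous_on UNIV W2"
    by (intro continuous_at_imp_continuous_on ballI has_derivative_continuous[OF W1(1)]
        has_derivative_continuous[OF W2(1)])+
  have "continuous_on UNIV (\<lambda>s::real. (s, 0 :: real))" by (intro continuous_intros)
  from continuous_on_compose2[OF contW(2) this subset_UNIV]
  have W2_sq: "square_integrable (lebesgue_on {a..b}) (\<lambda>s. W2 (s, 0))"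
    by (rule square_integrable_interval)
  have W_sq: "square_integrable (lebesgue_on \<Omega>) (\<lambda>z. (W1 z, W2 z))"
    by (intro square_integrable_domain continuous_intros contW)
  have "(\<lambda>n. LINT z|lebesgue_on \<Omega>. gradient (\<phi> n) z \<bullet> (W1 z, W2 z)) \<longlonglongrightarrow>
      (LINT z|lebesgue_on \<Omega>. G z \<bullet> (W1 z, W2 z))"
    by (intro integral_inner_tendsto square_integrable_smooth u W_sq \<phi>)
  moreover have "(\<lambda>n. LINT s|lebesgue_on {a..b}. \<phi> n (s, 0) \<bullet> W2 (s, 0)) \<longlonglongrightarrow>
      (LINT s|lebesgue_on {a..b}. g s \<bullet> W2 (s, 0))"
    by (intro integral_inner_tendsto square_integrable_trace u W2_sq \<phi>)
  moreover have "(LINT z|lebesgue_on \<Omega>. gradient (\<phi> n) z \<bullet> (W1 z, W2 z)) =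
      (LINT s|lebesgue_on {a..b}. \<phi> n (s, 0) \<bullet> W2 (s, 0))" for n
    using integral_gradient_inner_divergence_free[OF \<phi>(1) \<phi>(2) W1 W2 div] by simp
  ultimately show ?thesis using LIMSEQ_unique by simp
qed

text \<open>The factor 4 of the smooth case becomes 16: the squared triangle inequality, which costs
  a factor 2, is used once for the function and once for its gradient.\<close>

lemma sobolev_triple_Poincare:
  assumes t: "sobolev_triple u G g"
  shows "(LINT z|lebesgue_on \<Omega>. (u z)\<^sup>2) \<le> 16 * (b - a)\<^sup>2 * (LINT z|lebesgue_on \<Omega>. (norm (G z))\<^sup>2)"
proof -
  from t obtain \<phi> where u: "square_integrable (lebesgue_on \<Omega>) u" "square_integrable (lebesgue_on \<Omega>) G"
    and \<phi>: "\<And>n. smooth (\<phi> n)" "\<And>n x. x \<in> B \<Longrightarrow> \<phi> n x = 0"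
      "(\<lambda>n. LINT x|lebesgue_on \<Omega>. (norm (\<phi> n x - u x))\<^sup>2) \<longlonglongrightarrow> 0"
      "(\<lambda>n. LINT x|lebesgue_on \<Omega>. (norm (gradient (\<phi> n) x - G x))\<^sup>2) \<longlonglongrightarrow> 0"
    unfolding sobolev_triple_def by blast
  let ?C = "4 * (b - a)\<^sup>2" and ?I = "LINT z|lebesgue_on \<Omega>. (norm (G z))\<^sup>2"
  let ?e = "\<lambda>n. LINT x|lebesgue_on \<Omega>. (norm (\<phi> n x - u x))\<^sup>2"
  let ?d = "\<lambda>n. LINT x|lebesgue_on \<Omega>. (norm (gradient (\<phi> n) x - G x))\<^sup>2"
  have le: "(LINT z|lebesgue_on \<Omega>. (u z)\<^sup>2) \<le> 2 * ?e n + 2 * (?C * (2 * ?d n + 2 * ?I))" for n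
  proof -
    have sq: "square_integrable (lebesgue_on \<Omega>) (\<lambda>x. u x - \<phi> n x)"
      "square_integrable (lebesgue_on \<Omega>) (\<lambda>x. gradient (\<phi> n) x - G x)"
      by (intro square_integrable_diff square_integrable_smooth u \<phi>)+
    have "(LINT z|lebesgue_on \<Omega>. (u z)\<^sup>2) \<le> 2 * (LINT x|lebesgue_on \<Omega>. (norm (u x - \<phi> n x))\<^sup>2)
        + 2 * (LINT x|lebesgue_on \<Omega>. (norm (\<phi> n x))\<^sup>2)"
      using integral_norm_add_square_le[OF sq(1) square_integrable_smooth(1)[OF \<phi>(1)[of n]]] by simp
    moreover have "(LINT x|lebesgue_on \<Omega>. (norm (u x - \<phi> n x))\<^sup>2) = ?e n"
      by (simp add: power2_commute)
    moreover have "(LINT x|lebesgue_on \<Omega>. (norm (\<phi> n x))\<^sup>2) \<le> ?C * (LINT z|lebesgue_on \<Omega>. (norm (gradient (\<phi> n) z))\<^sup>2)"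
      using Poincare_smooth[OF \<phi>(1) \<phi>(2)] by simp
    moreover have "(LINT z|lebesgue_on \<Omega>. (norm (gradient (\<phi> n) z))\<^sup>2) \<le> 2 * ?d n + 2 * ?I"
      using integral_norm_add_square_le[OF sq(2) u(2)] by simp
    then have "?C * (LINT z|lebesgue_on \<Omega>. (norm (gradient (\<phi> n) z))\<^sup>2) \<le> ?C * (2 * ?d n + 2 * ?I)"
      by (rule mult_left_mono) simp
    ultimately show ?thesis by linarith
  qed
  have "(\<lambda>n. 2 * ?e n + 2 * (?C * (2 * ?d n + 2 * ?I))) \<longlonglongrightarrow> 2 * 0 + 2 * (?C * (2 * 0 + 2 * ?I))"
    by (intro tendsto_intros \<phi>)
  then have "(LINT z|lebesgue_on \<Omega>. (u z)\<^sup>2) \<le> 2 * 0 + 2 * (?C * (2 * 0 + 2 * ?I))"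
    by (rule Lim_bounded2) (use le in blast)
  then show ?thesis by simp
qed

lemma sobolev_triple_zero_gradient:
  assumes t: "sobolev_triple u G g" and "(LINT z|lebesgue_on \<Omega>. (norm (G z))\<^sup>2) \<le> 0"
  shows "AE z in lebesgue_on \<Omega>. u z = 0"
proof (rule square_integrable_eq_zero_AE)
  show "square_integrable (lebesgue_on \<Omega>) u" using t by (simp add: sobolev_triple_def)
  have "16 * (b - a)\<^sup>2 * (LINT z|lebesgue_on \<Omega>. (norm (G z))\<^sup>2) \<le> 0"
    using assms(2) by (intro mult_nonneg_nonpos) auto
  then show "(LINT z|lebesgue_on \<Omega>. (norm (u z))\<^sup>2) \<le> 0"
    using sobolev_triple_Poincare[OF t] by simp
qed

lemma sobolev_triple_zero_AE:
  assumes t: "sobolev_triple u G g" and "AE z in lebesgue_on \<Omega>. u z = 0"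
  shows "AE z in lebesgue_on \<Omega>. G z = 0"
proof -
  have z: "sobolev_triple (\<lambda>_. 0) (\<lambda>_. 0) (\<lambda>_. 0)" by (rule sobolev_triple_zero)
  show ?thesis
    using t z assms(2) unfolding sobolev_triple_def
    by (intro weak_gradient_unique_AE[OF open_domain bounded_domain, of u "\<lambda>_. 0" G "\<lambda>_. 0"]) auto
qed

end

subsection \<open>Sine polynomials\<close>

definition sine_poly :: "nat \<Rightarrow> (real \<Rightarrow> real) \<Rightarrow> bool" where
  "sine_poly K f \<longleftrightarrow> (\<exists>c. \<forall>t. f t = (\<Sum>n\<in>{1..K}. c n * sin (real n * t)))"

lemma sine_poly_lincomb:
  assumes "sine_poly K f" "sine_poly K g"
  shows "sine_poly K (\<lambda>t. \<alpha> * f t + \<beta> * g t)"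
proof -
  obtain c d where "\<And>t. f t = (\<Sum>n\<in>{1..K}. c n * sin (real n * t))"
    "\<And>t. g t = (\<Sum>n\<in>{1..K}. d n * sin (real n * t))"
    using assms unfolding sine_poly_def by blast
  then have "\<alpha> * f t + \<beta> * g t = (\<Sum>n\<in>{1..K}. (\<alpha> * c n + \<beta> * d n) * sin (real n * t))" for t
    by (simp add: sum_distrib_left sum.distrib algebra_simps)
  then show ?thesis unfolding sine_poly_def by (intro exI allI)
qed

lemma sine_poly_sum:
  assumes "\<And>i. i \<in> I \<Longrightarrow> sine_poly K (f i)"
  shows "sine_poly K (\<lambda>t. \<Sum>i\<in>I. f i t)"
  using assms
proof (induction I rule: infinite_finite_induct)
  case (insert i I)
  then show ?case using sine_poly_lincomb[of K "f i" "\<lambda>t. \<Sum>i\<in>I. f i t" 1 1] by simp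
qed (auto simp: sine_poly_def intro: exI[of _ "\<lambda>_. 0"])

lemma sine_poly_mono:
  assumes "sine_poly K f" "K \<le> K'"
  shows "sine_poly K' f"
proof -
  obtain c where c: "\<And>t. f t = (\<Sum>n\<in>{1..K}. c n * sin (real n * t))"
    using assms unfolding sine_poly_def by blast
  have "f t = (\<Sum>n\<in>{1..K'}. (if n \<le> K then c n else 0) * sin (real n * t))" for t
    unfolding c using assms(2) by (intro sum.mono_neutral_cong_left) auto
  then show ?thesis unfolding sine_poly_def by (intro exI allI)
qed

lemma sine_poly_sin:
  assumes "1 \<le> n" "n \<le> K"
  shows "sine_poly K (\<lambda>t. sin (real n * t))"
  unfolding sine_poly_def
proof (intro exI allI)
  fix t
  show "sin (real n * t) = (\<Sum>m\<in>{1..K}. (if m = n then 1 else 0) * sin (real m * t))"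
    using assms by (simp add: if_distrib [of "\<lambda>x. x * _"] cong: if_cong)
qed

lemma sine_poly_mult_cos:
  assumes "sine_poly K f"
  shows "sine_poly (Suc K) (\<lambda>t. f t * cos t)"
proof -
  obtain c where c: "\<And>t. f t = (\<Sum>n\<in>{1..K}. c n * sin (real n * t))"
    using assms unfolding sine_poly_def by blast
  have "sine_poly (Suc K) (\<lambda>t. c n * sin (real n * t) * cos t)" if n: "n \<in> {1..K}" for n
  proof -
    have lower: "sine_poly (Suc K) (\<lambda>t. sin (real (n - 1) * t))"
    proof (cases "n = 1")
      case True
      then show ?thesis by (auto simp: sine_poly_def intro: exI[of _ "\<lambda>_. 0"])
    qed (use n in \<open>intro sine_poly_sin, auto\<close>)
    have upper: "sine_poly (Suc K) (\<lambda>t. sin (real (n + 1) * t))"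
      using n by (intro sine_poly_sin) auto
    have "c n * sin (real n * t) * cos t =
        c n / 2 * sin (real (n - 1) * t) + c n / 2 * sin (real (n + 1) * t)" for t
      using n by (simp add: of_nat_diff distrib_right left_diff_distrib sin_add sin_diff) (simp add: field_simps)
    then show ?thesis using sine_poly_lincomb[OF lower upper, of "c n / 2" "c n / 2"] by (simp only:)
  qed
  from sine_poly_sum[of "{1..K}" "Suc K" "\<lambda>n t. c n * sin (real n * t) * cos t", OF this] show ?thesis by (simp add: c sum_distrib_right)
qed

text \<open>Connects the polynomials in \<open>cos t\<close> delivered by Weierstrass approximation
  with finite sine sums.\<close>

lemma sine_poly_sin_times_poly_cos:
  "\<exists>K. sine_poly K (\<lambda>t. sin t * (\<Sum>i\<le>N. a i * cos t ^ i))"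
proof -
  have pow: "sine_poly (Suc i) (\<lambda>t. sin t * cos t ^ i)" for i
  proof (induction i)
    case 0
    then show ?case using sine_poly_sin[of 1 1] by simp
  next
    case (Suc i)
    from sine_poly_mult_cos[OF this] show ?case by (simp add: mult_ac)
  qed
  have "sine_poly (Suc N) (\<lambda>t. a i * (sin t * cos t ^ i))" if "i \<in> {..N}" for i
    using sine_poly_lincomb[OF sine_poly_mono[OF pow] sine_poly_mono[OF pow], of i "Suc N" i "a i" 0] that by simp
  from sine_poly_sum[of "{..N}" "Suc N" "\<lambda>i t. a i * (sin t * cos t ^ i)", OF this] show ?thesis
    by (intro exI[of _ "Suc N"]) (simp add: sum_distrib_left mult_ac)
qed

section \<open>Completeness of the sine system on the interval\<close>

context lower_domain
begin

text \<open>For positive \<open>n\<close>, the function \<open>mode n x * exp (freq n * y)\<close>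
  is harmonic, vanishes on the sides of the half-strip and has normal derivative
  \<open>freq n\<close> times itself at height 0; thus \<open>freq n\<close> is at once a decay rate
  and an eigenvalue.\<close>

definition freq :: "nat \<Rightarrow> real" where "freq n = real n * pi / (b - a)"

definition mode :: "nat \<Rightarrow> real \<Rightarrow> real" where "mode n x = sin (freq n * (x - a))"

lemma freq_pos: "n > 0 \<Longrightarrow> freq n > 0"
  using a_less_b by (simp add: freq_def)

lemma continuous_on_mode: "continuous_on S (mode n)"
  unfolding mode_def by (intro continuous_intros)

lemma integrable_interval: "continuous_on UNIV f \<Longrightarrow> integrable (lebesgue_on {c..d}) (f :: real \<Rightarrow> real)"
  by (rule continuous_imp_integrable_real) (auto intro: continuous_on_subset)

lemma integral_cos_interval:
  fixes j :: int
  shows "(LINT x|lebesgue_on {a..b}. cos (of_int j * pi / (b - a) * (x - a))) = (if j = 0 then b - a else 0)"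
proof -
  define k where "k = of_int j * pi / (b - a)"
  have "integrable (lebesgue_on {a..b}) (\<lambda>x. cos (k * (x - a)))"
    by (intro integrable_interval continuous_intros)
  then have eq: "(LINT x|lebesgue_on {a..b}. cos (k * (x - a))) = integral {a..b} (\<lambda>x. cos (k * (x - a)))"
    by (rule lebesgue_integral_eq_integral) simp
  have "integral {a..b} (\<lambda>x. cos (k * (x - a))) = (if j = 0 then b - a else 0)"
  proof (cases "j = 0")
    case True
    then show ?thesis using a_less_b by (simp add: k_def)
  next
    case False
    then have k: "k \<noteq> 0" using a_less_b by (simp add: k_def)
    have "((\<lambda>x. cos (k * (x - a))) has_integral sin (k * (b - a)) / k - sin (k * (a - a)) / k) {a..b}"
    proof (rule fundamental_theorem_of_calculus)
      fix x
      have "((\<lambda>x. sin (k * (x - a))) has_real_derivative cos (k * (x - a)) * k) (at x within {a..b})"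
        by (auto intro!: derivative_eq_intros)
      from DERIV_cdivide[OF this, of k] k
      show "((\<lambda>x. sin (k * (x - a)) / k) has_vector_derivative cos (k * (x - a))) (at x within {a..b})"
        by (simp add: has_real_derivative_iff_has_vector_derivative)
    qed (use a_less_b in simp)
    moreover have "k * (b - a) = pi * of_int j" using a_less_b by (simp add: k_def)
    then have "sin (k * (b - a)) = 0" by (simp only: sin_npi_int)
    ultimately show ?thesis using False by (simp add: integral_unique)
  qed
  then show ?thesis using eq by (simp only: k_def)
qed

lemma integral_mode_mode:
  assumes "n > 0" "m > 0"
  shows "(LINT x|lebesgue_on {a..b}. mode n x * mode m x) = (if n = m then (b - a) / 2 else 0)"
proof -
  let ?c = "\<lambda>j::int. \<lambda>x. cos (of_int j * pi / (b - a) * (x - a))"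
  have prod: "mode n x * mode m x = (?c (int n - int m) x - ?c (int n + int m) x) / 2" for x
    unfolding mode_def freq_def sin_times_sin
    by (simp add: left_diff_distrib distrib_right diff_divide_distrib add_divide_distrib)
  have "(LINT x|lebesgue_on {a..b}. mode n x * mode m x) =
      (LINT x|lebesgue_on {a..b}. (?c (int n - int m) x - ?c (int n + int m) x) / 2)" by (simp only: prod)
  also have "\<dots> = ((LINT x|lebesgue_on {a..b}. ?c (int n - int m) x) - (LINT x|lebesgue_on {a..b}. ?c (int n + int m) x)) / 2"
    by (subst integral_divide_zero, subst Bochner_Integration.integral_diff)
      (intro integrable_interval continuous_intros refl)+
  also have "\<dots> = (if n = m then (b - a) / 2 else 0)"
    unfolding integral_cos_interval using assms by auto
  finally show ?thesis .
qed

text \<open>A polynomial in the cosine, multiplied by the sine, is a sine polynomial, so Weierstrass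
  approximation on \<open>{-1..1}\<close> reaches every function that is the sine times a continuous
  function of the cosine. As \<open>f\<close> need not vanish at the end points, it is first damped
  there, at a small cost in the square mean.\<close>

lemma continuous_approx_by_modes:
  assumes f: "continuous_on UNIV (f :: real \<Rightarrow> real)" and "\<delta> > 0"
  obtains K c where "(LINT x|lebesgue_on {a..b}. (f x - (\<Sum>n\<in>{1..K}. c n * mode n x))\<^sup>2) < \<delta>"
proof -
  define S where "S x = sin (pi / (b - a) * (x - a))" for x
  define C where "C x = cos (pi / (b - a) * (x - a))" for x
  define \<epsilon> where "\<epsilon> n = inverse (real (Suc n))" for n
  \<comment> \<open>The damping factor vanishes at \<open>a\<close> and \<open>b\<close> and tends
    to 1 in between; being quadratic in \<open>S x\<close>, it allows one factor \<open>S x\<close>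
    to be split off with a continuous quotient.\<close>
  define g where "g n x = f x * (S x)\<^sup>2 / ((S x)\<^sup>2 + \<epsilon> n)" for n x
  have \<epsilon>: "\<epsilon> n > 0" for n by (simp add: \<epsilon>_def)
  have \<epsilon>0: "\<epsilon> \<longlonglongrightarrow> 0" unfolding \<epsilon>_def by (rule LIMSEQ_inverse_real_of_nat)
  have pos: "t\<^sup>2 + \<epsilon> n > 0" for t n using \<epsilon>[of n] by (simp add: add_nonneg_pos)
  have nz: "t\<^sup>2 + \<epsilon> n \<noteq> 0" for t n using pos[of t n] by simp
  have contS: "continuous_on UNIV S" "continuous_on UNIV C"
    unfolding S_def C_def by (intro continuous_intros)+
  have contg: "continuous_on UNIV (g n)" for n
    unfolding g_def by (intro continuous_intros f contS ballI nz)
  have diff: "f x - g n x = f x * (\<epsilon> n / ((S x)\<^sup>2 + \<epsilon> n))" for n x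
    using nz[of "S x" n] by (simp add: g_def field_simps)
  have S_pos: "S x > 0" if "a < x" "x < b" for x
  proof -
    have "pi / (b - a) * (x - a) < pi / (b - a) * (b - a)" using that by (intro mult_strict_left_mono) auto
    then have "pi / (b - a) * (x - a) < pi" using a_less_b by simp
    moreover have "0 < pi / (b - a) * (x - a)" using that by simp
    ultimately show ?thesis unfolding S_def by (intro sin_gt_zero)
  qed
  have "(\<lambda>n. LINT x|lebesgue_on {a..b}. (f x - g n x)\<^sup>2) \<longlonglongrightarrow> (LINT x|lebesgue_on {a..b}. 0)"
  proof (rule integral_dominated_convergence[where w = "\<lambda>x. (f x)\<^sup>2"])
    show "integrable (lebesgue_on {a..b}) (\<lambda>x. (f x)\<^sup>2)"
      by (intro integrable_interval continuous_intros f)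
    show "(\<lambda>x. (f x - g n x)\<^sup>2) \<in> borel_measurable (lebesgue_on {a..b})" for n
      by (intro borel_measurable_integrable integrable_interval continuous_intros f contg)
    have "{a, b} \<in> null_sets lebesgue"
      by (intro null_sets_completionI countable_imp_null_set_lborel) auto
    then have AE: "AE x in lebesgue. x \<notin> {a, b}" by (rule AE_not_in)
    have AE': "AE x in lebesgue. x \<in> {a..b} \<longrightarrow> a < x \<and> x < b"
      by (rule eventually_mono[OF AE]) auto
    have "{a..b} \<inter> space lebesgue \<in> sets lebesgue" by simp
    from AE_restrict_space_iff[OF this] AE' have "AE x in lebesgue_on {a..b}. a < x \<and> x < b"
      by (rule iffD2)
    then show "AE x in lebesgue_on {a..b}. (\<lambda>n. (f x - g n x)\<^sup>2) \<longlonglongrightarrow> 0"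
    proof eventually_elim
      case (elim x)
      then have "S x \<noteq> 0" using S_pos[of x] by simp
      then have "(\<lambda>n. (f x * (\<epsilon> n / ((S x)\<^sup>2 + \<epsilon> n)))\<^sup>2) \<longlonglongrightarrow> (f x * (0 / ((S x)\<^sup>2 + 0)))\<^sup>2"
        by (intro tendsto_intros \<epsilon>0) auto
      then show ?case by (simp add: diff)
    qed
    show "AE x in lebesgue_on {a..b}. norm ((f x - g n x)\<^sup>2) \<le> (f x)\<^sup>2" for n
    proof (rule AE_I2)
      fix x
      have "\<bar>\<epsilon> n / ((S x)\<^sup>2 + \<epsilon> n)\<bar> \<le> 1" using \<epsilon>[of n] pos[of "S x" n] by simp
      then have "\<bar>f x - g n x\<bar> \<le> \<bar>f x\<bar>" unfolding diff abs_mult by (rule mult_left_le) simp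
      then show "norm ((f x - g n x)\<^sup>2) \<le> (f x)\<^sup>2" by (simp add: abs_le_square_iff)
    qed
  qed simp
  then have "\<forall>\<^sub>F n in sequentially. (LINT x|lebesgue_on {a..b}. (f x - g n x)\<^sup>2) < \<delta> / 4"
    using \<open>\<delta> > 0\<close> by (intro order_tendstoD) auto
  then obtain N where N: "(LINT x|lebesgue_on {a..b}. (f x - g N x)\<^sup>2) < \<delta> / 4"
    unfolding eventually_sequentially by blast
  \<comment> \<open>The damped function with one sine removed, written in the variable
    \<open>c = C x\<close>: on the interval \<open>g N x = S x * h (C x)\<close>.\<close>
  define h where "h c = f (a + (b - a) / pi * arccos c) * sqrt (1 - c\<^sup>2) / (1 - c\<^sup>2 + \<epsilon> N)" for c
  have "continuous_on {-1..1} h"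
  proof -
    have "continuous_on {-1..1} (\<lambda>c. a + (b - a) / pi * arccos c)"
      by (intro continuous_intros) auto
    from continuous_on_compose2[OF f this subset_UNIV]
    have "continuous_on {-1..1} (\<lambda>c. f (a + (b - a) / pi * arccos c))" .
    moreover have "1 - c\<^sup>2 + \<epsilon> N \<noteq> 0" if "c \<in> {-1..1}" for c :: real
      using that \<epsilon>[of N] abs_square_le_1[of c] by (auto simp: abs_le_iff)
    ultimately show ?thesis unfolding h_def by (intro continuous_intros) auto
  qed
  \<comment> \<open>A uniform error of this size costs at most \<open>\<delta> / 8\<close> in the
    integral. Together with \<open>\<delta> / 4\<close> from the damping, both doubled by the
    squared triangle inequality, the total stays below \<open>3 * \<delta> / 4\<close>.\<close>
  define \<eta> where "\<eta> = sqrt (\<delta> / (8 * (b - a)))"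
  have \<eta>: "\<eta> > 0" "\<eta>\<^sup>2 = \<delta> / (8 * (b - a))" using \<open>\<delta> > 0\<close> a_less_b by (simp_all add: \<eta>_def)
  obtain p where p: "polynomial_function p" "\<And>c. c \<in> {-1..1} \<Longrightarrow> norm (h c - p c) < \<eta>"
    using Stone_Weierstrass_polynomial_function[OF compact_Icc \<open>continuous_on {-1..1} h\<close> \<eta>(1)] by blast
  then obtain coeffs M where coeffs: "p = (\<lambda>c. \<Sum>i\<le>M. coeffs i * c ^ i)"
    using real_polynomial_function_iff_sum by (auto simp: real_polynomial_function_eq)
  obtain K where "sine_poly K (\<lambda>t. sin t * p (cos t))"
    using sine_poly_sin_times_poly_cos[of coeffs M] by (auto simp: coeffs)
  then obtain c where c': "\<And>t. sin t * p (cos t) = (\<Sum>n\<in>{1..K}. c n * sin (real n * t))"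
    unfolding sine_poly_def by blast
  have c: "S x * p (C x) = (\<Sum>n\<in>{1..K}. c n * mode n x)" for x
    using c'[of "pi / (b - a) * (x - a)"] by (simp add: S_def C_def mode_def freq_def mult.assoc)
  have close: "\<bar>g N x - S x * p (C x)\<bar> \<le> \<eta>" if "x \<in> {a..b}" for x
  proof -
    let ?t = "pi / (b - a) * (x - a)"
    have "?t \<le> pi / (b - a) * (b - a)" using that a_less_b by (intro mult_left_mono) auto
    then have t: "0 \<le> ?t" "?t \<le> pi" using that a_less_b by auto
    have "arccos (C x) = ?t" unfolding C_def using t by (rule arccos_cos)
    moreover have "a + (b - a) / pi * ?t = x" using a_less_b by simp
    moreover have s: "1 - (C x)\<^sup>2 = (S x)\<^sup>2" unfolding C_def S_def by (simp add: sin_squared_eq)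
    moreover have S0: "S x \<ge> 0" unfolding S_def using t by (rule sin_ge_zero)
    ultimately have "h (C x) = f x * S x / ((S x)\<^sup>2 + \<epsilon> N)" unfolding h_def s by simp
    then have "g N x = S x * h (C x)" by (simp add: g_def power2_eq_square)
    then have "\<bar>g N x - S x * p (C x)\<bar> = \<bar>h (C x) - p (C x)\<bar> * S x"
      using S0 by (simp add: abs_mult flip: right_diff_distrib)
    also have "\<dots> \<le> \<bar>h (C x) - p (C x)\<bar>" by (rule mult_left_le) (simp_all add: S_def)
    also have "\<dots> \<le> \<eta>" using p(2)[of "C x"] by (simp add: C_def)
    finally show ?thesis .
  qed
  have contp: "continuous_on UNIV (\<lambda>x. S x * p (C x))"
    unfolding coeffs by (intro continuous_intros contS)
  have "(LINT x|lebesgue_on {a..b}. (g N x - S x * p (C x))\<^sup>2) \<le> (LINT x|lebesgue_on {a..b}. \<eta>\<^sup>2)"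
  proof (rule integral_mono)
    show "integrable (lebesgue_on {a..b}) (\<lambda>x. (g N x - S x * p (C x))\<^sup>2)"
      "integrable (lebesgue_on {a..b}) (\<lambda>x. \<eta>\<^sup>2)"
      by (intro integrable_interval continuous_intros contg contp)+
    show "(g N x - S x * p (C x))\<^sup>2 \<le> \<eta>\<^sup>2" if "x \<in> space (lebesgue_on {a..b})" for x
      using close[of x] that \<eta>(1) by (intro power2_le_iff_abs_le[THEN iffD2]) (auto simp: space_restrict_space)
  qed
  also have "\<dots> = (b - a) * \<eta>\<^sup>2"
    using a_less_b by (simp add: measure_restrict_space space_restrict_space)
  also have "\<dots> = \<delta> / 8"
    unfolding \<eta>(2) using a_less_b by (simp add: field_simps)
  finally have 2: "(LINT x|lebesgue_on {a..b}. (g N x - S x * p (C x))\<^sup>2) \<le> \<delta> / 8" .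
  have "(LINT x|lebesgue_on {a..b}. (norm ((f x - g N x) + (g N x - S x * p (C x))))\<^sup>2) \<le>
      2 * (LINT x|lebesgue_on {a..b}. (norm (f x - g N x))\<^sup>2) +
      2 * (LINT x|lebesgue_on {a..b}. (norm (g N x - S x * p (C x)))\<^sup>2)"
    by (intro integral_norm_add_square_le square_integrable_interval continuous_intros f contg contp)
  also have "\<dots> < \<delta>" using N 2 \<open>\<delta> > 0\<close> by simp
  finally have "(LINT x|lebesgue_on {a..b}. (f x - S x * p (C x))\<^sup>2) < \<delta>" by simp
  then show ?thesis using that[of c K] by (simp add: c)
qed

text \<open>Not normalised: the square of a mode of positive index integrates to
  \<open>(b - a) / 2\<close>, the origin of the factors \<open>2 / (b - a)\<close> in what
  follows.\<close>

definition sine_coeff :: "(real \<Rightarrow> real) \<Rightarrow> nat \<Rightarrow> real" where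
  "sine_coeff g n = (LINT s|lebesgue_on {a..b}. g s * mode n s)"

lemma square_integrable_mode: "square_integrable (lebesgue_on {a..b}) (mode n)"
  by (intro square_integrable_interval continuous_on_mode)

lemma integrable_mult_mode:
  assumes "square_integrable (lebesgue_on {a..b}) g"
  shows "integrable (lebesgue_on {a..b}) (\<lambda>s. g s * mode n s)"
  using square_integrable_inner[OF assms square_integrable_mode] by simp

text \<open>Expand the distance to the sine sum and complete the square in each \<open>c n\<close>:
  among all coefficients the Fourier ones are optimal. Since \<open>c\<close> is arbitrary, any
  approximating sine sum can be inserted without projecting it.\<close>

lemma integral_square_le_sine_coeffs:
  assumes g: "square_integrable (lebesgue_on {a..b}) g"
  shows "(LINT s|lebesgue_on {a..b}. (g s)\<^sup>2) \<le>
    2 / (b - a) * (\<Sum>n\<in>{1..K}. (sine_coeff g n)\<^sup>2) +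
    (LINT s|lebesgue_on {a..b}. (g s - (\<Sum>n\<in>{1..K}. c n * mode n s))\<^sup>2)"
proof -
  let ?M = "lebesgue_on {a..b}"
  define p where "p s = (\<Sum>n\<in>{1..K}. c n * mode n s)" for s
  have contp: "continuous_on UNIV p" unfolding p_def by (intro continuous_intros continuous_on_mode)
  have sqp: "square_integrable ?M p" by (rule square_integrable_interval[OF contp])
  have ig: "integrable ?M (\<lambda>s. (g s)\<^sup>2)" using g by (simp add: square_integrable_def)
  have ip: "integrable ?M (\<lambda>s. (p s)\<^sup>2)" using sqp by (simp add: square_integrable_def)
  have igp: "integrable ?M (\<lambda>s. g s * p s)" using square_integrable_inner[OF g sqp] by simp
  have cross: "(LINT s|?M. g s * p s) = (\<Sum>n\<in>{1..K}. c n * sine_coeff g n)"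
  proof -
    have "(LINT s|?M. g s * p s) = (LINT s|?M. (\<Sum>n\<in>{1..K}. c n * (g s * mode n s)))"
      by (simp add: p_def sum_distrib_left mult.left_commute)
    also have "\<dots> = (\<Sum>n\<in>{1..K}. c n * sine_coeff g n)"
      using integrable_mult_mode[OF g] by (simp add: sine_coeff_def)
    finally show ?thesis .
  qed
  have "(LINT s|?M. (p s)\<^sup>2) = (LINT s|?M. (\<Sum>n\<in>{1..K}. \<Sum>m\<in>{1..K}. c n * c m * (mode n s * mode m s)))"
    by (simp add: p_def power2_eq_square sum_product mult_ac)
  also have "\<dots> = (\<Sum>n\<in>{1..K}. \<Sum>m\<in>{1..K}. c n * c m * (LINT s|?M. mode n s * mode m s))"
    using integrable_mult_mode[OF square_integrable_mode] by simp
  also have "\<dots> = (\<Sum>n\<in>{1..K}. \<Sum>m\<in>{1..K}. if n = m then c n * c m * ((b - a) / 2) else 0)"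
    by (intro sum.cong refl) (simp add: integral_mode_mode)
  also have "\<dots> = (\<Sum>n\<in>{1..K}. (c n)\<^sup>2 * ((b - a) / 2))"
    by (simp add: power2_eq_square)
  finally have pp: "(LINT s|?M. (p s)\<^sup>2) = (\<Sum>n\<in>{1..K}. (c n)\<^sup>2 * ((b - a) / 2))" .
  have "(LINT s|?M. (g s - p s)\<^sup>2) = (LINT s|?M. (g s)\<^sup>2 + (p s)\<^sup>2 - 2 * (g s * p s))"
    by (simp add: power2_diff mult.assoc)
  also have "\<dots> = (LINT s|?M. (g s)\<^sup>2) - 2 * (\<Sum>n\<in>{1..K}. c n * sine_coeff g n) + (\<Sum>n\<in>{1..K}. (c n)\<^sup>2 * ((b - a) / 2))"
    using ig ip igp unfolding cross[symmetric] pp[symmetric] by simp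
  finally have dist: "(LINT s|?M. (g s - p s)\<^sup>2) = (LINT s|?M. (g s)\<^sup>2) -
      (\<Sum>n\<in>{1..K}. 2 * (c n * sine_coeff g n) - (c n)\<^sup>2 * ((b - a) / 2))"
    by (simp add: sum_subtractf sum_distrib_left)
  have "2 * (c n * B) - (c n)\<^sup>2 * ((b - a) / 2) \<le> 2 / (b - a) * B\<^sup>2" for n B
  proof -
    have "2 / (b - a) * B\<^sup>2 - (2 * (c n * B) - (c n)\<^sup>2 * ((b - a) / 2)) = 2 / (b - a) * (B - c n * ((b - a) / 2))\<^sup>2"
      using a_less_b by (simp add: power2_eq_square field_simps)
    also have "\<dots> \<ge> 0" using a_less_b by simp
    finally show ?thesis by simp
  qed
  then have "(\<Sum>n\<in>{1..K}. 2 * (c n * sine_coeff g n) - (c n)\<^sup>2 * ((b - a) / 2)) \<le>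
      (\<Sum>n\<in>{1..K}. 2 / (b - a) * (sine_coeff g n)\<^sup>2)"
    by (intro sum_mono)
  then show ?thesis using dist unfolding p_def by (simp add: sum_distrib_left)
qed

text \<open>The upper half of Parseval's identity, up to an error. The trace is approximated by the
  trace of a smooth function and this by modes, each with error \<open>\<delta> / 4\<close>, which
  doubling turns into \<delta> altogether.\<close>

lemma integral_square_approx_sine_coeffs:
  assumes t: "sobolev_triple u G g" and "\<delta> > 0"
  obtains K where "(LINT s|lebesgue_on {a..b}. (g s)\<^sup>2) \<le> 2 / (b - a) * (\<Sum>n\<in>{1..K}. (sine_coeff g n)\<^sup>2) + \<delta>"
proof -
  let ?M = "lebesgue_on {a..b}"
  from t obtain \<phi> where g: "square_integrable ?M g"
    and \<phi>': "\<And>n. smooth (\<phi> n)" "\<And>n x. x \<in> B \<Longrightarrow> \<phi> n x = 0"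
      "(\<lambda>n. LINT s|?M. (norm (\<phi> n (s, 0) - g s))\<^sup>2) \<longlonglongrightarrow> 0"
    unfolding sobolev_triple_def by blast
  note \<phi> = \<phi>'(1,3)
  have "\<forall>\<^sub>F n in sequentially. (LINT s|?M. (norm (\<phi> n (s, 0) - g s))\<^sup>2) < \<delta> / 4"
    using \<phi>(2) \<open>\<delta> > 0\<close> by (intro order_tendstoD) auto
  then obtain N where N: "(LINT s|?M. (norm (\<phi> N (s, 0) - g s))\<^sup>2) < \<delta> / 4"
    unfolding eventually_sequentially by blast
  have "continuous_on UNIV (\<lambda>s::real. (s, 0 :: real))" by (intro continuous_intros)
  from continuous_on_compose2[OF smooth_imp_continuous_on[OF \<phi>(1)] this subset_UNIV]
  have cont: "continuous_on UNIV (\<lambda>s. \<phi> N (s, 0))" .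
  have "\<delta> / 4 > 0" using \<open>\<delta> > 0\<close> by simp
  from continuous_approx_by_modes[OF cont this]
  obtain c K where K: "(LINT s|?M. (\<phi> N (s, 0) - (\<Sum>n\<in>{1..K}. c n * mode n s))\<^sup>2) < \<delta> / 4"
    by blast
  have sqp: "square_integrable ?M (\<lambda>s. \<Sum>n\<in>{1..K}. c n * mode n s)"
    by (intro square_integrable_interval continuous_intros continuous_on_mode)
  have sq: "square_integrable ?M (\<lambda>s. g s - \<phi> N (s, 0))"
    "square_integrable ?M (\<lambda>s. \<phi> N (s, 0) - (\<Sum>n\<in>{1..K}. c n * mode n s))"
    by (intro square_integrable_diff g square_integrable_trace \<phi> sqp)+
  have "(LINT s|?M. (g s - (\<Sum>n\<in>{1..K}. c n * mode n s))\<^sup>2) \<le>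
      2 * (LINT s|?M. (g s - \<phi> N (s, 0))\<^sup>2) + 2 * (LINT s|?M. (\<phi> N (s, 0) - (\<Sum>n\<in>{1..K}. c n * mode n s))\<^sup>2)"
    using integral_norm_add_square_le[OF sq] by simp
  also have "\<dots> \<le> \<delta>" using N K \<open>\<delta> > 0\<close> by (simp add: power2_commute[of "g _"])
  finally have "(LINT s|?M. (g s - (\<Sum>n\<in>{1..K}. c n * mode n s))\<^sup>2) \<le> \<delta>" .
  then show ?thesis using integral_square_le_sine_coeffs[OF g, of K c] that[of K] by linarith
qed

section \<open>The energy of the trial fields and the lower bound for Dirichlet energies\<close>

lemma integral_strip_product:
  fixes f h :: "real \<Rightarrow> real"
  assumes f: "continuous_on UNIV f" and h: "continuous_on UNIV h"
  shows "integrable lborel (\<lambda>z. indicator (cbox (a, c) (b, d)) z * (f (fst z) * h (snd z)))"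
    and "(LINT z|lborel. indicator (cbox (a, c) (b, d)) z * (f (fst z) * h (snd z))) =
      (LINT x|lebesgue_on {a..b}. f x) * (LINT y|lebesgue_on {c..d}. h y)"
proof -
  have "continuous_on UNIV (\<lambda>z::real \<times> real. f (fst z) * h (snd z))"
    by (intro continuous_intros continuous_on_compose2[OF f] continuous_on_compose2[OF h]) auto
  then show int: "integrable lborel (\<lambda>z. indicator (cbox (a, c) (b, d)) z * (f (fst z) * h (snd z)))"
    using borel_integrable_compact[OF compact_cbox, of "(a, c)" "(b, d)" "\<lambda>z. f (fst z) * h (snd z)"]
    by (auto intro: continuous_on_subset)
  have ind: "indicator (cbox (a, c) (b, d)) (x, y) * (f x * h y) =
      (indicator {a..b} x * f x) * (indicator {c..d} y * h y)" for x y
    by (auto simp: indicator_def cbox_Pair_eq)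
  have m: "f \<in> borel_measurable borel" "h \<in> borel_measurable borel"
    using f h by (auto intro: borel_measurable_continuous_onI)
  have int': "integrable (lborel \<Otimes>\<^sub>M lborel) (\<lambda>(x, y). indicator (cbox (a, c) (b, d)) (x, y) * (f x * h y))"
    using int by (simp add: lborel_prod case_prod_unfold)
  have "(LINT z|lborel. indicator (cbox (a, c) (b, d)) z * (f (fst z) * h (snd z))) =
      (LINT x|lborel. LINT y|lborel. indicator (cbox (a, c) (b, d)) (x, y) * (f x * h y))"
    using lborel_pair.integral_fst[OF int'] by (simp add: lborel_prod case_prod_unfold)
  also have "\<dots> = (LINT x|lborel. indicator {a..b} x * f x) * (LINT y|lborel. indicator {c..d} y * h y)"
    unfolding ind by simp
  finally show "(LINT z|lborel. indicator (cbox (a, c) (b, d)) z * (f (fst z) * h (snd z))) =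
      (LINT x|lebesgue_on {a..b}. f x) * (LINT y|lebesgue_on {c..d}. h y)"
    using m by (simp add: integral_lebesgue_on_eq_lborel)
qed

text \<open>The bound is the integral over the whole half-line and so does not depend on the depth
  \<open>H\<close>.\<close>

lemma integral_exp_interval_le:
  fixes k H :: real
  assumes "k > 0" "H > 0"
  shows "(LINT y|lebesgue_on {-H..0}. exp (k * y)) \<le> 1 / k"
proof -
  have "(LINT y|lebesgue_on {-H..0}. exp (k * y)) = integral {-H..0} (\<lambda>y. exp (k * y))"
    by (intro lebesgue_integral_eq_integral integrable_interval continuous_intros) simp
  moreover have "((\<lambda>y. exp (k * y)) has_integral exp (k * 0) / k - exp (k * (-H)) / k) {-H..0}"
  proof (rule fundamental_theorem_of_calculus)
    fix y
    have "((\<lambda>y. exp (k * y)) has_real_derivative exp (k * y) * k) (at y within {-H..0})"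
      by (auto intro!: derivative_eq_intros)
    from DERIV_cdivide[OF this, of k]
    show "((\<lambda>y. exp (k * y) / k) has_vector_derivative exp (k * y)) (at y within {-H..0})"
      using assms by (simp add: has_real_derivative_iff_has_vector_derivative)
  qed (use assms in simp)
  ultimately show ?thesis using assms by (simp add: integral_unique)
qed

text \<open>\<open>(mode_field_1 K c, mode_field_2 K c)\<close> is the gradient of the harmonic function
  \<open>\<Sum>n. c n / freq n * sin (freq n * (x - a)) * exp (freq n * y)\<close> on the half-strip.\<close>

definition mode_field_1 :: "nat \<Rightarrow> (nat \<Rightarrow> real) \<Rightarrow> real \<times> real \<Rightarrow> real" where
  "mode_field_1 K c z = (\<Sum>n\<in>{1..K}. c n * (cos (freq n * (fst z - a)) * exp (freq n * snd z)))"

definition mode_field_2 :: "nat \<Rightarrow> (nat \<Rightarrow> real) \<Rightarrow> real \<times> real \<Rightarrow> real" where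
  "mode_field_2 K c z = (\<Sum>n\<in>{1..K}. c n * (sin (freq n * (fst z - a)) * exp (freq n * snd z)))"

text \<open>Differentiation multiplies the coefficients by their frequencies. The first component of
  the first gradient and the second component of the second one cancel, so the field is
  divergence-free.\<close>

lemma mode_field_derivative:
  defines "k \<equiv> \<lambda>c n. c n * freq n :: real"
  shows "(mode_field_1 K c has_derivative (\<lambda>v. (- mode_field_2 K (k c) z, mode_field_1 K (k c) z) \<bullet> v)) (at z)"
    and "(mode_field_2 K c has_derivative (\<lambda>v. (mode_field_1 K (k c) z, mode_field_2 K (k c) z) \<bullet> v)) (at z)"
    and "continuous_on UNIV (mode_field_1 K c)" "continuous_on UNIV (mode_field_2 K c)"
proof -
  have 1: "((\<lambda>z. c n * (cos (freq n * (fst z - a)) * exp (freq n * snd z))) has_derivative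
     (\<lambda>v. (- (c n * freq n * (sin (freq n * (fst z - a)) * exp (freq n * snd z))),
       c n * freq n * (cos (freq n * (fst z - a)) * exp (freq n * snd z))) \<bullet> v)) (at z)" for n
    by (auto intro!: derivative_eq_intros simp: inner_prod_def algebra_simps)
  have 2: "((\<lambda>z. c n * (sin (freq n * (fst z - a)) * exp (freq n * snd z))) has_derivative
     (\<lambda>v. (c n * freq n * (cos (freq n * (fst z - a)) * exp (freq n * snd z)),
       c n * freq n * (sin (freq n * (fst z - a)) * exp (freq n * snd z))) \<bullet> v)) (at z)" for n
    by (auto intro!: derivative_eq_intros simp: inner_prod_def algebra_simps)
  have pair: "(\<Sum>n\<in>I. (p n, q n) \<bullet> v) = (\<Sum>n\<in>I. p n, \<Sum>n\<in>I. q n) \<bullet> v"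
    for I :: "nat set" and p q :: "nat \<Rightarrow> real" and v
    by (simp add: inner_prod_def sum.distrib sum_distrib_right)
  show "(mode_field_1 K c has_derivative (\<lambda>v. (- mode_field_2 K (k c) z, mode_field_1 K (k c) z) \<bullet> v)) (at z)"
    using has_derivative_sum[of "{1..K}", OF 1] unfolding mode_field_1_def[abs_def] mode_field_2_def k_def pair
    by (simp add: sum_negf)
  show "(mode_field_2 K c has_derivative (\<lambda>v. (mode_field_1 K (k c) z, mode_field_2 K (k c) z) \<bullet> v)) (at z)"
    using has_derivative_sum[of "{1..K}", OF 2] unfolding mode_field_1_def mode_field_2_def[abs_def] k_def pair .
  show "continuous_on UNIV (mode_field_1 K c)" "continuous_on UNIV (mode_field_2 K c)"
    unfolding mode_field_1_def mode_field_2_def by (intro continuous_intros)+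
qed

text \<open>In the squared length of the field the products of cosines and of sines combine to
  cosines of frequency differences. Integrated over the full width they leave the diagonal only, and
  \<open>1 / (freq n + freq n)\<close> bounds the vertical integral.\<close>

lemma mode_field_energy_le:
  "(LINT z|lebesgue_on \<Omega>. (norm (mode_field_1 K c z, mode_field_2 K c z))\<^sup>2) \<le>
    (b - a) / 2 * (\<Sum>n\<in>{1..K}. (c n)\<^sup>2 / freq n)"
proof -
  obtain H where H: "H > 0" "\<And>z. z \<in> \<Omega> \<Longrightarrow> norm z < H"
    using bounded_domain unfolding bounded_pos_less by auto
  let ?R = "cbox (a, - H) (b, 0)"
  have sub: "\<Omega> \<subseteq> ?R"
  proof
    fix z assume z: "z \<in> \<Omega>"
    then have "norm (snd z) < H" using H(2)[OF z] norm_snd_le[of "snd z" "fst z"] by simp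
    then show "z \<in> ?R" using z domain_subset by (cases z) (auto simp: cbox_Pair_eq)
  qed
  let ?W = "\<lambda>z. (norm (mode_field_1 K c z, mode_field_2 K c z))\<^sup>2"
  let ?C = "\<lambda>n m x. cos (of_int (int n - int m) * pi / (b - a) * (x - a))"
  let ?E = "\<lambda>n m y. exp ((freq n + freq m) * y)"
  have W: "?W z = (\<Sum>n\<in>{1..K}. \<Sum>m\<in>{1..K}. c n * c m * (?C n m (fst z) * ?E n m (snd z)))" for z
  proof -
    have C: "?C n m (fst z) = cos (freq n * (fst z - a)) * cos (freq m * (fst z - a)) +
        sin (freq n * (fst z - a)) * sin (freq m * (fst z - a))" for n m
    proof -
      have "of_int (int n - int m) * pi / (b - a) * (fst z - a) = freq n * (fst z - a) - freq m * (fst z - a)"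
        by (simp add: freq_def left_diff_distrib diff_divide_distrib)
      then show ?thesis by (simp only: cos_diff)
    qed
    have "?W z = (mode_field_1 K c z)\<^sup>2 + (mode_field_2 K c z)\<^sup>2"
      by (simp add: norm_Pair)
    also have "\<dots> = (\<Sum>n\<in>{1..K}. \<Sum>m\<in>{1..K}. c n * c m * (?C n m (fst z) * ?E n m (snd z)))"
      unfolding C mode_field_1_def mode_field_2_def power2_eq_square sum_product
      by (simp add: exp_add distrib_right flip: sum.distrib) (simp add: algebra_simps)
    finally show ?thesis .
  qed
  have contW: "continuous_on UNIV ?W"
    by (intro continuous_intros mode_field_derivative)
  have C_cont: "continuous_on UNIV (?C n m)" and E_cont: "continuous_on UNIV (?E n m)" for n m
    by (intro continuous_intros)+
  note strip = integral_strip_product[OF C_cont E_cont, of "- H" 0]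
  have int: "integrable lborel (\<lambda>z. indicator ?R z * ?W z)"
  proof -
    have "integrable lborel (\<lambda>z. \<Sum>n\<in>{1..K}. \<Sum>m\<in>{1..K}. c n * c m * (indicator ?R z * (?C n m (fst z) * ?E n m (snd z))))"
      by (intro Bochner_Integration.integrable_sum integrable_mult_right strip)
    then show ?thesis by (simp add: W sum_distrib_left mult_ac)
  qed
  have "(LINT z|lebesgue_on \<Omega>. ?W z) = (LINT z|lborel. indicator \<Omega> z * ?W z)"
    by (intro integral_lebesgue_on_eq_lborel borel_measurable_continuous_onI contW domain_sets)
  \<comment> \<open>The comparison of domains happens here: \<Omega> is enlarged to a rectangle of
    full width, which only increases the energy of the field.\<close>
  also have "\<dots> \<le> (LINT z|lborel. indicator ?R z * ?W z)"
    using sub by (intro integral_mono int integrable_indicator_continuous contW) (auto simp: indicator_def)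
  also have "\<dots> = (LINT z|lborel. (\<Sum>n\<in>{1..K}. \<Sum>m\<in>{1..K}. c n * c m * (indicator ?R z * (?C n m (fst z) * ?E n m (snd z)))))"
    by (simp add: W sum_distrib_left mult_ac)
  also have "\<dots> = (\<Sum>n\<in>{1..K}. \<Sum>m\<in>{1..K}. c n * c m *
      ((LINT x|lebesgue_on {a..b}. ?C n m x) * (LINT y|lebesgue_on {-H..0}. ?E n m y)))"
    by (simp only: Bochner_Integration.integral_sum Bochner_Integration.integrable_sum integrable_mult_right
        integral_mult_right_zero strip)
  also have "\<dots> = (\<Sum>n\<in>{1..K}. \<Sum>m\<in>{1..K}. if n = m then
      c n * c m * ((b - a) * (LINT y|lebesgue_on {-H..0}. ?E n m y)) else 0)"
    unfolding integral_cos_interval by (intro sum.cong refl) simp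
  also have "\<dots> = (\<Sum>n\<in>{1..K}. (c n)\<^sup>2 * ((b - a) * (LINT y|lebesgue_on {-H..0}. ?E n n y)))"
    by (simp add: power2_eq_square)
  also have "\<dots> \<le> (\<Sum>n\<in>{1..K}. (c n)\<^sup>2 * ((b - a) * (1 / (freq n + freq n))))"
    using a_less_b freq_pos H(1)
    by (intro sum_mono mult_left_mono integral_exp_interval_le add_pos_pos) auto
  also have "\<dots> = (b - a) / 2 * (\<Sum>n\<in>{1..K}. (c n)\<^sup>2 / freq n)"
    by (simp add: sum_distrib_left mult_ac)
  finally show ?thesis .
qed

lemma energy_ge_sine_coeffs:
  assumes t: "sobolev_triple u G g"
  shows "2 / (b - a) * (\<Sum>n\<in>{1..K}. freq n * (sine_coeff g n)\<^sup>2) \<le> (LINT z|lebesgue_on \<Omega>. (norm (G z))\<^sup>2)"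
proof -
  \<comment> \<open>Then \<open>c n / freq n\<close> is the Fourier coefficient of \<open>g\<close>,
    so the field is the gradient of the harmonic extension of its truncated sine series. With this
    choice the pairing with \<open>G\<close> equals \<open>E\<close>, and the energy of the field is
    at most \<open>E\<close>; Cauchy-Schwarz leaves \<open>E\<close> as the lower bound.\<close>
  define c where "c n = 2 / (b - a) * (freq n * sine_coeff g n)" for n
  let ?W = "\<lambda>z. (mode_field_1 K c z, mode_field_2 K c z)"
  define E where "E = 2 / (b - a) * (\<Sum>n\<in>{1..K}. freq n * (sine_coeff g n)\<^sup>2)"
  have G: "square_integrable (lebesgue_on \<Omega>) G" and g: "square_integrable (lebesgue_on {a..b}) g"
    using t by (simp_all add: sobolev_triple_def)
  have W: "square_integrable (lebesgue_on \<Omega>) ?W"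
    by (intro square_integrable_domain continuous_intros mode_field_derivative)
  have "(LINT z|lebesgue_on \<Omega>. G z \<bullet> ?W z) = (LINT s|lebesgue_on {a..b}. g s * mode_field_2 K c (s, 0))"
    by (rule sobolev_triple_divergence_free[OF t mode_field_derivative(1) _ mode_field_derivative(2)])
      (auto intro!: continuous_intros mode_field_derivative)
  also have "\<dots> = (LINT s|lebesgue_on {a..b}. (\<Sum>n\<in>{1..K}. c n * (g s * mode n s)))"
    by (simp add: mode_field_2_def mode_def sum_distrib_left mult_ac)
  also have "\<dots> = (\<Sum>n\<in>{1..K}. c n * sine_coeff g n)"
    using integrable_mult_mode[OF g] by (simp add: sine_coeff_def)
  also have "\<dots> = E"
    by (simp add: E_def c_def sum_distrib_left power2_eq_square mult_ac)
  finally have GW: "(LINT z|lebesgue_on \<Omega>. G z \<bullet> ?W z) = E" .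
  have "(LINT z|lebesgue_on \<Omega>. (norm (?W z))\<^sup>2) \<le> (b - a) / 2 * (\<Sum>n\<in>{1..K}. (c n)\<^sup>2 / freq n)"
    by (rule mode_field_energy_le)
  also have "\<dots> = (\<Sum>n\<in>{1..K}. (b - a) / 2 * ((c n)\<^sup>2 / freq n))" by (rule sum_distrib_left)
  also have "\<dots> = (\<Sum>n\<in>{1..K}. 2 / (b - a) * (freq n * (sine_coeff g n)\<^sup>2))"
  proof (rule sum.cong)
    fix n assume "n \<in> {1..K}"
    then have "freq n > 0" by (intro freq_pos) auto
    moreover define L where "L = b - a"
    moreover have "L > 0" using a_less_b by (simp add: L_def)
    ultimately show "(b - a) / 2 * ((c n)\<^sup>2 / freq n) = 2 / (b - a) * (freq n * (sine_coeff g n)\<^sup>2)"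
      unfolding c_def L_def[symmetric] by (simp add: power2_eq_square field_simps)
  qed simp
  also have "\<dots> = E" by (simp add: E_def sum_distrib_left)
  finally have WW: "(LINT z|lebesgue_on \<Omega>. (norm (?W z))\<^sup>2) \<le> E" .
  have E0: "E \<ge> 0"
    unfolding E_def using a_less_b freq_pos by (intro mult_nonneg_nonneg sum_nonneg) (auto intro: less_imp_le)
  have "E * E \<le> (LINT z|lebesgue_on \<Omega>. (norm (G z))\<^sup>2) * (LINT z|lebesgue_on \<Omega>. (norm (?W z))\<^sup>2)"
    using integral_Cauchy_Schwarz[OF G W] unfolding GW by (simp add: power2_eq_square)
  also have "\<dots> \<le> (LINT z|lebesgue_on \<Omega>. (norm (G z))\<^sup>2) * E"
    by (intro mult_left_mono WW) simp
  finally have "E * E \<le> (LINT z|lebesgue_on \<Omega>. (norm (G z))\<^sup>2) * E" .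
  then have "E \<le> (LINT z|lebesgue_on \<Omega>. (norm (G z))\<^sup>2)"
    using E0 by (cases "E = 0") (auto simp: mult_le_cancel_right)
  then show ?thesis by (simp add: E_def)
qed

text \<open>All surviving coefficients have index at least \<open>m\<close>, hence weight at least
  \<open>freq m\<close>. The number of coefficients depends on the accuracy of the Parseval bound,
  so the estimate holds up to every positive \<open>e\<close>; the accuracy
  \<open>e / freq m\<close> compensates the multiplication by \<open>freq m\<close>.\<close>

lemma energy_ge_freq:
  assumes t: "sobolev_triple u G g" and "m > 0"
    and orth: "\<And>n. 0 < n \<Longrightarrow> n < m \<Longrightarrow> sine_coeff g n = 0"
  shows "freq m * (LINT s|lebesgue_on {a..b}. (g s)\<^sup>2) \<le> (LINT z|lebesgue_on \<Omega>. (norm (G z))\<^sup>2)"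
proof (rule field_le_epsilon)
  fix e :: real assume "e > 0"
  have fm: "freq m > 0" using \<open>m > 0\<close> by (rule freq_pos)
  obtain K where K: "(LINT s|lebesgue_on {a..b}. (g s)\<^sup>2) \<le> 2 / (b - a) * (\<Sum>n\<in>{1..K}. (sine_coeff g n)\<^sup>2) + e / freq m"
    using integral_square_approx_sine_coeffs[OF t, of "e / freq m"] \<open>e > 0\<close> fm by auto
  have summand: "freq m * (sine_coeff g n)\<^sup>2 \<le> freq n * (sine_coeff g n)\<^sup>2" if "n \<in> {1..K}" for n
  proof (cases "n < m")
    case True
    then show ?thesis using orth[of n] that by simp
  next
    case False
    then have "freq m \<le> freq n"
      using a_less_b by (simp add: freq_def divide_right_mono)
    then show ?thesis by (rule mult_right_mono) simp
  qed
  have "freq m * (LINT s|lebesgue_on {a..b}. (g s)\<^sup>2) \<le>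
      freq m * (2 / (b - a) * (\<Sum>n\<in>{1..K}. (sine_coeff g n)\<^sup>2) + e / freq m)"
    using K fm by (intro mult_left_mono) auto
  also have "\<dots> = 2 / (b - a) * (\<Sum>n\<in>{1..K}. freq m * (sine_coeff g n)\<^sup>2) + e"
    using fm by (simp add: distrib_left sum_distrib_left mult_ac)
  also have "\<dots> \<le> 2 / (b - a) * (\<Sum>n\<in>{1..K}. freq n * (sine_coeff g n)\<^sup>2) + e"
    using a_less_b summand by (intro add_right_mono mult_left_mono sum_mono) auto
  also have "\<dots> \<le> (LINT z|lebesgue_on \<Omega>. (norm (G z))\<^sup>2) + e"
    using energy_ge_sine_coeffs[OF t, of K] by linarith
  finally show "freq m * (LINT s|lebesgue_on {a..b}. (g s)\<^sup>2) \<le> (LINT z|lebesgue_on \<Omega>. (norm (G z))\<^sup>2) + e" .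
qed

end

subsection \<open>Lower bounds for the eigenvalues\<close>

text \<open>Gaussian elimination, by induction on the equations. A nonzero entry in the row
  \<open>k0\<close> serves as pivot, and removing its unknown from the other rows leaves one
  equation and one unknown fewer.\<close>

lemma underdetermined_nontrivial_solution:
  fixes A :: "'k \<Rightarrow> 'i \<Rightarrow> real"
  assumes "finite K" "finite I" "card K < card I"
  shows "\<exists>c. (\<exists>i\<in>I. c i \<noteq> 0) \<and> (\<forall>k\<in>K. (\<Sum>i\<in>I. A k i * c i) = 0)"
  using assms
proof (induction K arbitrary: I A rule: finite_induct)
  case empty
  then have "I \<noteq> {}" by auto
  then show ?case by (intro exI[of _ "\<lambda>_. 1"]) auto
next
  case (insert k0 K)
  show ?case
  proof (cases "\<forall>i\<in>I. A k0 i = 0")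
    case True
    have "card K < card I" using insert by simp
    from insert.IH[OF insert.prems(1) this, of A] obtain c where
      "\<exists>i\<in>I. c i \<noteq> 0" "\<forall>k\<in>K. (\<Sum>i\<in>I. A k i * c i) = 0" by blast
    then show ?thesis using True by (intro exI[of _ c]) simp
  next
    case False
    then obtain i0 where i0: "i0 \<in> I" "A k0 i0 \<noteq> 0" by blast
    let ?J = "I - {i0}"
    have J: "finite ?J" "card K < card ?J" using insert i0 by auto
    from insert.IH[OF J, of "\<lambda>k i. A k i - A k i0 / A k0 i0 * A k0 i"] obtain c where
      c: "\<exists>i\<in>?J. c i \<noteq> 0" "\<forall>k\<in>K. (\<Sum>i\<in>?J. (A k i - A k i0 / A k0 i0 * A k0 i) * c i) = 0" by blast
    define S where "S = (\<Sum>i\<in>?J. A k0 i * c i)"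
    define d where "d = c(i0 := - S / A k0 i0)"
    have split: "(\<Sum>i\<in>I. A k i * d i) = A k i0 * (- S / A k0 i0) + (\<Sum>i\<in>?J. A k i * c i)" for k
    proof -
      have "(\<Sum>i\<in>?J. A k i * d i) = (\<Sum>i\<in>?J. A k i * c i)"
        by (intro sum.cong) (auto simp: d_def)
      then show ?thesis
        using sum.remove[OF insert.prems(1) i0(1), of "\<lambda>i. A k i * d i"] by (simp add: d_def)
    qed
    have "(\<Sum>i\<in>I. A k i * d i) = 0" if "k \<in> K" for k
    proof -
      have "(\<Sum>i\<in>?J. A k i * c i) - A k i0 / A k0 i0 * S = 0"
        using c(2) that by (simp add: S_def left_diff_distrib sum_subtractf sum_distrib_left mult.assoc)
      then show ?thesis using split[of k] by simp
    qed
    moreover have "(\<Sum>i\<in>I. A k0 i * d i) = 0"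
      using split[of k0] i0 by (simp add: S_def)
    moreover have "\<exists>i\<in>I. d i \<noteq> 0" using c(1) by (auto simp: d_def)
    ultimately show ?thesis by (intro exI[of _ d]) simp
  qed
qed

lemma integral_norm_sum_square:
  fixes f :: "nat \<Rightarrow> 'a \<Rightarrow> 'b::euclidean_space"
  assumes "\<And>i. i \<in> I \<Longrightarrow> square_integrable M (f i)"
  shows "(LINT x|M. (norm (\<Sum>i\<in>I. c i *\<^sub>R f i x))\<^sup>2) = (\<Sum>i\<in>I. \<Sum>k\<in>I. c i * c k * (LINT x|M. f i x \<bullet> f k x))"
proof -
  have "(LINT x|M. (norm (\<Sum>i\<in>I. c i *\<^sub>R f i x))\<^sup>2) = (LINT x|M. (\<Sum>i\<in>I. \<Sum>k\<in>I. c i * c k * (f i x \<bullet> f k x)))"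
    by (simp add: power2_norm_eq_inner inner_sum_left inner_sum_right sum_distrib_left mult.assoc mult.left_commute inner_commute)
  also have "\<dots> = (\<Sum>i\<in>I. \<Sum>k\<in>I. c i * c k * (LINT x|M. f i x \<bullet> f k x))"
    using assms by (simp add: square_integrable_inner)
  finally show ?thesis .
qed

section \<open>Spans of eigenfunctions and comparison with the sine frequencies\<close>

context lower_domain
begin

lemma energy_form:
  fixes m :: nat
  assumes "\<And>i. i < m \<Longrightarrow> sobolev_triple (u i) (G i) (g i)"
  shows "(LINT z|lebesgue_on \<Omega>. (norm (\<Sum>i<m. c i *\<^sub>R G i z))\<^sup>2) =
      (\<Sum>i<m. \<Sum>k<m. c i * c k * (LINT z|lebesgue_on \<Omega>. G i z \<bullet> G k z))"
    and "(LINT s|lebesgue_on {a..b}. (\<Sum>i<m. c i * g i s)\<^sup>2) =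
      (\<Sum>i<m. \<Sum>k<m. c i * c k * (LINT s|lebesgue_on {a..b}. g i s * g k s))"
  using integral_norm_sum_square[of "{..<m}" "lebesgue_on \<Omega>" G c]
    integral_norm_sum_square[of "{..<m}" "lebesgue_on {a..b}" g c] assms
  by (simp_all add: sobolev_triple_def)

text \<open>Eigenfunctions for different eigenvalues are orthogonal, so the Gram matrix of the traces is block
  diagonal and \<open>\<Lambda> - \<eta> i\<close> may be split symmetrically into square roots.\<close>

lemma energy_le_of_eigenfunctions:
  fixes m :: nat
  assumes t: "\<And>i. i < m \<Longrightarrow> sobolev_triple (u i) (G i) (g i)"
    and eig: "\<And>i k. i < m \<Longrightarrow> k < m \<Longrightarrow>
      (LINT z|lebesgue_on \<Omega>. G i z \<bullet> G k z) = \<eta> i * (LINT s|lebesgue_on {a..b}. g i s * g k s)"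
    and le: "\<And>i. i < m \<Longrightarrow> \<eta> i \<le> \<Lambda>"
  shows "(LINT z|lebesgue_on \<Omega>. (norm (\<Sum>i<m. c i *\<^sub>R G i z))\<^sup>2) \<le>
    \<Lambda> * (LINT s|lebesgue_on {a..b}. (\<Sum>i<m. c i * g i s)\<^sup>2)"
proof -
  define M where "M i k = (LINT s|lebesgue_on {a..b}. g i s * g k s)" for i k
  have M_sym: "M i k = M k i" for i k by (simp add: M_def mult.commute)
  have M_zero: "M i k = 0" if "i < m" "k < m" "\<eta> i \<noteq> \<eta> k" for i k
  proof -
    have "\<eta> i * M i k = \<eta> k * M i k"
      using eig[OF that(1,2)] eig[OF that(2,1)] M_sym[of i k] by (simp add: M_def inner_commute)
    then show ?thesis using that by simp
  qed
  define d where "d i = sqrt (\<Lambda> - \<eta> i) * c i" for i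
  have "0 \<le> (LINT s|lebesgue_on {a..b}. (\<Sum>i<m. d i * g i s)\<^sup>2)" by simp
  also have "\<dots> = (\<Sum>i<m. \<Sum>k<m. d i * d k * M i k)"
    unfolding M_def by (rule energy_form(2)[OF t])
  also have "\<dots> = (\<Sum>i<m. \<Sum>k<m. (\<Lambda> - \<eta> i) * (c i * c k * M i k))"
  proof (intro sum.cong refl)
    fix i k assume ik: "i \<in> {..<m}" "k \<in> {..<m}"
    show "d i * d k * M i k = (\<Lambda> - \<eta> i) * (c i * c k * M i k)"
    proof (cases "\<eta> i = \<eta> k")
      case True
      have "sqrt (\<Lambda> - \<eta> k) * sqrt (\<Lambda> - \<eta> k) = \<Lambda> - \<eta> k" using le[of k] ik by simp
      then show ?thesis using True by (simp add: d_def)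
    next
      case False
      then show ?thesis using M_zero ik by simp
    qed
  qed
  also have "\<dots> = \<Lambda> * (\<Sum>i<m. \<Sum>k<m. c i * c k * M i k) - (\<Sum>i<m. \<Sum>k<m. c i * c k * (\<eta> i * M i k))"
    by (simp add: algebra_simps sum_subtractf sum_distrib_left)
  also have "(\<Sum>i<m. \<Sum>k<m. c i * c k * M i k) = (LINT s|lebesgue_on {a..b}. (\<Sum>i<m. c i * g i s)\<^sup>2)"
    unfolding M_def by (rule energy_form(2)[OF t, symmetric])
  also have "(\<Sum>i<m. \<Sum>k<m. c i * c k * (\<eta> i * M i k)) =
      (\<Sum>i<m. \<Sum>k<m. c i * c k * (LINT z|lebesgue_on \<Omega>. G i z \<bullet> G k z))"
    by (intro sum.cong refl) (simp add: eig M_def)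
  also have "\<dots> = (LINT z|lebesgue_on \<Omega>. (norm (\<Sum>i<m. c i *\<^sub>R G i z))\<^sup>2)"
    by (rule energy_form(1)[OF t, symmetric])
  finally show ?thesis by simp
qed

text \<open>Gradients of eigenfunctions for different eigenvalues are orthogonal, so in a vanishing
  combination the part belonging to one eigenvalue has zero energy and vanishes by the Poincare
  inequality. This reduces independence of all eigenfunctions to independence within a single
  eigenspace.\<close>

lemma eigenfunction_block_zero:
  fixes m :: nat
  assumes t: "\<And>i. i < m \<Longrightarrow> sobolev_triple (u i) (G i) (g i)"
    and eig: "\<And>i k. i < m \<Longrightarrow> k < m \<Longrightarrow>
      (LINT z|lebesgue_on \<Omega>. G i z \<bullet> G k z) = \<eta> i * (LINT s|lebesgue_on {a..b}. g i s * g k s)"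
    and zero: "AE z in lebesgue_on \<Omega>. (\<Sum>i<m. c i * u i z) = 0"
  shows "AE z in lebesgue_on \<Omega>. (\<Sum>i<m. (if \<eta> i = \<mu> then c i else 0) * u i z) = 0"
proof -
  define A where "A i k = (LINT z|lebesgue_on \<Omega>. G i z \<bullet> G k z)" for i k
  define d where "d i = (if \<eta> i = \<mu> then c i else 0)" for i
  have A_zero: "A i k = 0" if "i < m" "k < m" "\<eta> i \<noteq> \<eta> k" for i k
  proof -
    have "\<eta> i * (LINT s|lebesgue_on {a..b}. g i s * g k s) = \<eta> k * (LINT s|lebesgue_on {a..b}. g i s * g k s)"
      using eig[OF that(1,2)] eig[OF that(2,1)] by (simp add: inner_commute mult.commute)
    then show ?thesis using that eig[OF that(1,2)] by (simp add: A_def)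
  qed
  have G: "square_integrable (lebesgue_on \<Omega>) (G i)" if "i < m" for i
    using t[OF that] by (simp add: sobolev_triple_def)
  have AE: "AE z in lebesgue_on \<Omega>. (\<Sum>i<m. c i *\<^sub>R G i z) = 0"
    by (rule sobolev_triple_zero_AE[OF sobolev_triple_sum[OF t] zero])
  have sum_zero: "(\<Sum>i<m. c i * A i k) = 0" if "k < m" for k
  proof -
    have "(\<Sum>i<m. c i * A i k) = (LINT z|lebesgue_on \<Omega>. (\<Sum>i<m. c i *\<^sub>R G i z) \<bullet> G k z)"
      using G that by (simp add: A_def inner_sum_left square_integrable_inner)
    also have "\<dots> = 0"
      by (rule integral_eq_zero_AE) (use AE in eventually_elim, simp)
    finally show ?thesis .
  qed
  have "(LINT z|lebesgue_on \<Omega>. (norm (\<Sum>i<m. d i *\<^sub>R G i z))\<^sup>2) = (\<Sum>i<m. \<Sum>k<m. d i * d k * A i k)"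
    unfolding A_def by (rule energy_form(1)[OF t])
  also have "\<dots> = (\<Sum>k<m. d k * (\<Sum>i<m. d i * A i k))"
    by (subst sum.swap) (simp add: sum_distrib_left mult_ac)
  also have "\<dots> = 0"
  proof (rule sum.neutral, rule ballI)
    fix k assume k: "k \<in> {..<m}"
    show "d k * (\<Sum>i<m. d i * A i k) = 0"
    proof (cases "\<eta> k = \<mu>")
      case True
      have "(\<Sum>i<m. d i * A i k) = (\<Sum>i<m. c i * A i k)"
        using A_zero k True by (intro sum.cong) (auto simp: d_def)
      then show ?thesis using sum_zero k by simp
    qed (simp add: d_def)
  qed
  finally have "AE z in lebesgue_on \<Omega>. (\<Sum>i<m. d i * u i z) = 0"
    by (intro sobolev_triple_zero_gradient[OF sobolev_triple_sum[OF t]]) auto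
  then show ?thesis by (simp add: d_def)
qed

text \<open>The dimension condition gives independent functions for each eigenvalue separately; much
  of the proof assembles them into one sequence of eigenfunctions matching \<eta>. Since \<eta> is
  indexed from 0 and \<open>freq\<close> from 1, \<open>\<eta> j\<close> is compared with
  \<open>freq (Suc j)\<close>.\<close>

lemma eigenvalue_ge_freq:
  assumes st: "steklov_dirichlet_eigenvalues \<Omega> {a..b} B \<eta>"
  shows "freq (Suc j) \<le> \<eta> j"
proof -
  define E where "E = steklov_eigenspace \<Omega> {a..b} B"
  define N where "N \<mu> = card {j. \<eta> j = \<mu>}" for \<mu>
  have inc: "incseq \<eta>" and top: "filterlim \<eta> at_top sequentially"
    using st by (simp_all add: steklov_dirichlet_eigenvalues_def)
  have "\<forall>\<mu>. has_dimension_ae \<Omega> (E \<mu>) (N \<mu>)"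
    using st by (simp add: steklov_dirichlet_eigenvalues_def E_def N_def)
  then have "\<forall>\<mu>. \<exists>f :: nat \<Rightarrow> real \<times> real \<Rightarrow> real. (\<forall>i<N \<mu>. f i \<in> E \<mu>) \<and>
      (\<forall>c :: nat \<Rightarrow> real. (AE x in lebesgue_on \<Omega>. (\<Sum>i<N \<mu>. c i * f i x) = 0) \<longrightarrow> (\<forall>i<N \<mu>. c i = 0))"
    unfolding has_dimension_ae_def by blast
  then obtain f :: "real \<Rightarrow> nat \<Rightarrow> real \<times> real \<Rightarrow> real" where
    f: "\<And>\<mu> i. i < N \<mu> \<Longrightarrow> f \<mu> i \<in> E \<mu>"
    and indep: "\<And>\<mu> c. (AE x in lebesgue_on \<Omega>. (\<Sum>i<N \<mu>. c i * f \<mu> i x) = 0) \<Longrightarrow> (\<forall>i<N \<mu>. c i = 0)"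
    by (subst (asm) choice_iff) blast
  have fin: "finite {j. \<eta> j = \<mu>}" for \<mu>
  proof -
    obtain n where n: "\<And>j. n \<le> j \<Longrightarrow> \<mu> < \<eta> j"
      using top unfolding filterlim_at_top_dense eventually_sequentially by blast
    have "{j. \<eta> j = \<mu>} \<subseteq> {..<n}"
      using n by (metis (mono_tags, lifting) less_irrefl lessThan_iff mem_Collect_eq not_le subsetI)
    then show ?thesis by (rule finite_subset) simp
  qed
  \<comment> \<open>The position of \<open>i\<close> among the indices with the same eigenvalue.
    Taking basis element number \<open>r i\<close> of the eigenspace uses a different one for each
    occurrence of the eigenvalue.\<close>
  define r where "r i = card {k. k < i \<and> \<eta> k = \<eta> i}" for i
  have r_less: "r i < N (\<eta> i)" for i
    unfolding r_def N_def by (rule psubset_card_mono[OF fin]) auto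
  have r_mono: "r i < r k" if "i < k" "\<eta> i = \<eta> k" for i k
    unfolding r_def using that by (intro psubset_card_mono) auto
  have r_inj: "i = k" if "r i = r k" "\<eta> i = \<eta> k" for i k
    using r_mono[of i k] r_mono[of k i] that by (cases i k rule: linorder_cases) auto
  define u where "u i = f (\<eta> i) (r i)" for i
  have "\<forall>i. \<exists>g. dirichlet_trace \<Omega> {a..b} B (u i) g \<and>
      (\<forall>v h. dirichlet_trace \<Omega> {a..b} B v h \<longrightarrow>
        (LINT x|lebesgue_on \<Omega>. weak_grad \<Omega> (u i) x \<bullet> weak_grad \<Omega> v x) =
        \<eta> i * (LINT s|lebesgue_on {a..b}. g s * h s))"
    using f[OF r_less] unfolding u_def E_def steklov_eigenspace_def by blast
  then obtain g where tr: "\<And>i. dirichlet_trace \<Omega> {a..b} B (u i) (g i)"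
    and weak: "\<And>i v h. dirichlet_trace \<Omega> {a..b} B v h \<Longrightarrow>
        (LINT x|lebesgue_on \<Omega>. weak_grad \<Omega> (u i) x \<bullet> weak_grad \<Omega> v x) =
        \<eta> i * (LINT s|lebesgue_on {a..b}. g i s * h s)"
    by (subst (asm) choice_iff) blast
  define G where "G i = weak_grad \<Omega> (u i)" for i
  have t: "sobolev_triple (u i) (G i) (g i)" for i
    unfolding G_def by (rule dirichlet_trace_imp_sobolev_triple[OF tr])
  have eig: "(LINT z|lebesgue_on \<Omega>. G i z \<bullet> G k z) = \<eta> i * (LINT s|lebesgue_on {a..b}. g i s * g k s)" for i k
    unfolding G_def by (rule weak[OF tr])
  define m where "m = Suc j"
  have coeff_zero: "c i = 0" if zero: "AE z in lebesgue_on \<Omega>. (\<Sum>i<m. c i * u i z) = 0" and "i < m" for c i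
  proof -
    define J where "J = {k. k < m \<and> \<eta> k = \<eta> i}"
    have inj: "inj_on r J" by (rule inj_onI) (auto simp: J_def intro: r_inj)
    \<comment> \<open>The coefficients of the block, moved along \<open>r\<close> to the numbering
      of the basis. Basis elements whose occurrence lies beyond the first \<open>m\<close> indices
      get 0.\<close>
    define d where "d l = (if l \<in> r ` J then c (the_inv_into J r l) else 0)" for l
    have block: "(\<Sum>k<m. (if \<eta> k = \<eta> i then c k else 0) * u k z) = (\<Sum>l<N (\<eta> i). d l * f (\<eta> i) l z)" for z
    proof -
      have "(\<Sum>k<m. (if \<eta> k = \<eta> i then c k else 0) * u k z) = (\<Sum>k\<in>J. d (r k) * f (\<eta> i) (r k) z)"
        by (rule sum.mono_neutral_cong_right)
          (auto simp: J_def d_def u_def the_inv_into_f_f[OF inj, unfolded J_def])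
      also have "\<dots> = (\<Sum>l\<in>r ` J. d l * f (\<eta> i) l z)"
        by (simp add: sum.reindex[OF inj])
      also have "\<dots> = (\<Sum>l<N (\<eta> i). d l * f (\<eta> i) l z)"
      proof (rule sum.mono_neutral_left)
        show "r ` J \<subseteq> {..<N (\<eta> i)}" using r_less by (auto simp: J_def) metis
      qed (auto simp: d_def)
      finally show ?thesis .
    qed
    have "AE z in lebesgue_on \<Omega>. (\<Sum>k<m. (if \<eta> k = \<eta> i then c k else 0) * u k z) = 0"
      by (rule eigenfunction_block_zero[OF t eig zero])
    then have "AE z in lebesgue_on \<Omega>. (\<Sum>l<N (\<eta> i). d l * f (\<eta> i) l z) = 0"
      unfolding block .
    then have "d (r i) = 0" using indep r_less by blast
    then show ?thesis using \<open>i < m\<close> the_inv_into_f_f[OF inj, of i] by (auto simp: d_def J_def)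
  qed
  \<comment> \<open>Orthogonality to the modes \<open>1, ..., j\<close> amounts to \<open>j\<close>
    linear equations for \<open>Suc j\<close> coefficients.\<close>
  have "card {1..<m} < card {..<m}" by (simp add: m_def)
  from underdetermined_nontrivial_solution[OF _ _ this, of "\<lambda>n i. sine_coeff (g i) n"]
  obtain c where c: "\<exists>i\<in>{..<m}. c i \<noteq> 0" "\<forall>n\<in>{1..<m}. (\<Sum>i<m. sine_coeff (g i) n * c i) = 0"
    by auto
  let ?g = "\<lambda>s. \<Sum>i<m. c i * g i s"
  have T: "sobolev_triple (\<lambda>z. \<Sum>i<m. c i * u i z) (\<lambda>z. \<Sum>i<m. c i *\<^sub>R G i z) ?g"
    by (rule sobolev_triple_sum[OF t])
  have sq: "square_integrable (lebesgue_on {a..b}) (g i)" for i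
    using t[of i] by (simp add: sobolev_triple_def)
  have lower: "freq m * (LINT s|lebesgue_on {a..b}. (?g s)\<^sup>2) \<le> (LINT z|lebesgue_on \<Omega>. (norm (\<Sum>i<m. c i *\<^sub>R G i z))\<^sup>2)"
  proof (rule energy_ge_freq[OF T])
    fix n assume n: "0 < n" "n < m"
    have "sine_coeff ?g n = (LINT s|lebesgue_on {a..b}. (\<Sum>i<m. c i * (g i s * mode n s)))"
      by (simp add: sine_coeff_def sum_distrib_right mult.assoc)
    also have "\<dots> = (\<Sum>i<m. sine_coeff (g i) n * c i)"
      using integrable_mult_mode[OF sq] by (simp add: sine_coeff_def mult.commute)
    finally show "sine_coeff ?g n = 0" using c(2) n by simp
  qed (simp add: m_def)
  have upper: "(LINT z|lebesgue_on \<Omega>. (norm (\<Sum>i<m. c i *\<^sub>R G i z))\<^sup>2) \<le> \<eta> j * (LINT s|lebesgue_on {a..b}. (?g s)\<^sup>2)"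
    by (rule energy_le_of_eigenfunctions[OF t eig]) (auto simp: m_def intro: incseqD[OF inc])
  \<comment> \<open>The trace has to be nonzero before it can be cancelled. If it were zero, the
    upper bound would make the energy zero, the combination would vanish by the Poincare inequality,
    and independence would annihilate its coefficients.\<close>
  have "(LINT s|lebesgue_on {a..b}. (?g s)\<^sup>2) \<noteq> 0"
  proof
    assume "(LINT s|lebesgue_on {a..b}. (?g s)\<^sup>2) = 0"
    then have "(LINT z|lebesgue_on \<Omega>. (norm (\<Sum>i<m. c i *\<^sub>R G i z))\<^sup>2) \<le> 0" using upper by simp
    from sobolev_triple_zero_gradient[OF T this] have "\<forall>i<m. c i = 0" using coeff_zero by blast
    then show False using c(1) by auto
  qed
  moreover have "(LINT s|lebesgue_on {a..b}. (?g s)\<^sup>2) \<ge> 0" by simp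
  ultimately have "(LINT s|lebesgue_on {a..b}. (?g s)\<^sup>2) > 0" by linarith
  moreover have "freq m * (LINT s|lebesgue_on {a..b}. (?g s)\<^sup>2) \<le> \<eta> j * (LINT s|lebesgue_on {a..b}. (?g s)\<^sup>2)"
    using lower upper by (rule order_trans)
  ultimately show ?thesis by (simp add: m_def)
qed

end

subsection \<open>The Riesz mean\<close>

text \<open>\<open>F\<close> is the closure of the projection of \<Omega>. It is closed because
  \<open>B\<close> lies strictly below height 0, so that \<open>F\<close> is the slice of the
  frontier there; it contains the projection by the John condition; and its points are limits of
  points of \<Omega>. Hence \<open>F\<close> is compact and connected, and positive length separates
  the end points. The projection of an open set is open, which keeps \<Omega> off the lines through
  \<open>a\<close> and \<open>b\<close>.\<close>

lemma admissible_domain_imp_lower_domain: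
  assumes adm: "admissible_domain \<Omega> F B" and John: "\<Omega> \<subseteq> F \<times> {..<0}"
  obtains a b where "F = {a..b}" "lower_domain \<Omega> B a b"
proof -
  have op: "open \<Omega>" and conn: "connected \<Omega>" and ne: "\<Omega> \<noteq> {}" and bdd: "bounded \<Omega>"
    and fr: "frontier \<Omega> = F \<times> {0} \<union> B" and B: "B \<subseteq> {x. snd x < 0}" and pos: "measure lebesgue F > 0"
    using adm by (simp_all add: admissible_domain_def)
  have F_iff: "s \<in> F \<longleftrightarrow> (s, 0) \<in> frontier \<Omega>" for s
    unfolding fr using B by auto
  have cont: "continuous_on UNIV (\<lambda>s::real. (s, 0 :: real))" by (intro continuous_intros)
  have "F = (\<lambda>s. (s, 0)) -` frontier \<Omega>" by (auto simp: F_iff)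
  then have F_closed: "closed F" using closed_vimage[OF frontier_closed cont] by simp
  have PF: "fst ` \<Omega> \<subseteq> F" using John by auto
  have "F \<subseteq> closure (fst ` \<Omega>)"
  proof
    fix s assume "s \<in> F"
    then have "(s, 0) \<in> closure \<Omega>" by (simp add: F_iff frontier_def)
    moreover have "fst ` closure \<Omega> \<subseteq> closure (fst ` \<Omega>)"
      by (intro image_closure_subset continuous_intros closed_closure closure_subset)
    ultimately show "s \<in> closure (fst ` \<Omega>)" by force
  qed
  then have F_eq: "F = closure (fst ` \<Omega>)" using closure_minimal[OF PF F_closed] by blast
  have "connected F" unfolding F_eq by (intro connected_imp_connected_closure connected_continuous_image conn continuous_intros)
  moreover have "compact F"
  proof -
    have "bounded F" unfolding F_eq
      by (intro bounded_closure bounded_linear_image[OF bdd] bounded_linear_fst)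
    then show ?thesis using F_closed by (simp add: compact_eq_bounded_closed)
  qed
  ultimately obtain a b where ab: "F = {a..b}"
    using connected_compact_interval_1[of F] by auto
  have "a < b"
  proof (rule ccontr)
    assume "\<not> a < b"
    then have "measure lebesgue F = 0" by (simp add: ab)
    then show False using pos by simp
  qed
  have "open (fst ` \<Omega>)" using op by (rule open_image_fst)
  then have "fst ` \<Omega> \<subseteq> interior {a..b}" using PF ab by (intro interior_maximal) auto
  then have "\<Omega> \<subseteq> {a<..<b} \<times> {..<0}" using John by (force simp: subset_iff)
  then have "lower_domain \<Omega> B a b"
    using op bdd \<open>a < b\<close> fr B ab by unfold_locales auto
  then show ?thesis using that ab by blast
qed

text \<open>If the last term is zero, the bound is inherited. Otherwise every term is positive and
  the sum is a quadratic polynomial in the number of terms, bounded by completing the square; the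
  empty sum is the case of no terms.\<close>

lemma sum_max_arithmetic_le:
  fixes q z :: real
  assumes "q > 0"
  shows "(\<Sum>j<N. max 0 (z - real (Suc j) * q)) \<le> z\<^sup>2 / (2 * q) - z / 2 + q / 2"
proof (induction N)
  case 0
  have "0 \<le> (z - q / 2)\<^sup>2 + 3 * q\<^sup>2 / 4" by simp
  also have "\<dots> = 2 * q * (z\<^sup>2 / (2 * q) - z / 2 + q / 2)"
    using assms by (simp add: power2_eq_square field_simps)
  finally show ?case using assms by (simp add: zero_le_mult_iff)
next
  case (Suc N)
  show ?case
  proof (cases "z \<le> real (Suc N) * q")
    case True
    then show ?thesis using Suc by simp
  next
    case False
    have "(\<Sum>j<Suc N. max 0 (z - real (Suc j) * q)) = (\<Sum>j<Suc N. z - real (Suc j) * q)"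
    proof (rule sum.cong)
      fix j assume "j \<in> {..<Suc N}"
      then have "real (Suc j) * q \<le> real (Suc N) * q" using assms by (intro mult_right_mono) auto
      then show "max 0 (z - real (Suc j) * q) = z - real (Suc j) * q" using False by simp
    qed simp
    also have "\<dots> = real (Suc N) * z - q * (real (Suc N) * real (Suc (Suc N)) / 2)"
      by (induction N) (simp_all add: field_simps)
    also have "\<dots> \<le> z\<^sup>2 / (2 * q) - z / 2 + q / 2"
    proof -
      define n where "n = real (Suc N)"
      \<comment> \<open>Over real \<open>n\<close> the polynomial
        \<open>n * z - q * (n * (n + 1) / 2)\<close> is largest at \<open>n = z / q - 1 / 2\<close>,
        with value \<open>z^2 / (2 * q) - z / 2 + q / 8\<close>. The difference
        \<open>3 * q / 8\<close> from the claimed bound becomes \<open>3 * q^2 / 4\<close> after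
        multiplication by \<open>2 * q\<close>.\<close>
      have "0 \<le> (z - n * q - q / 2)\<^sup>2 + 3 * q\<^sup>2 / 4" by simp
      also have "\<dots> = 2 * q * (z\<^sup>2 / (2 * q) - z / 2 + q / 2 - (n * z - q * (n * (n + 1) / 2)))"
        using assms by (simp add: power2_eq_square field_simps)
      finally have "0 \<le> z\<^sup>2 / (2 * q) - z / 2 + q / 2 - (n * z - q * (n * (n + 1) / 2))"
        using assms by (simp only: zero_le_mult_iff) auto
      then show ?thesis by (simp add: n_def)
    qed
    finally show ?thesis .
  qed
qed

theorem theorem1p7:
  fixes \<Omega> B :: "(real \<times> real) set" and F :: "real set" and \<eta> :: "nat \<Rightarrow> real" and z :: real
  assumes "admissible_domain \<Omega> F B"
    and "\<Omega> \<subseteq> F \<times> {..<0}"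
    and "steklov_dirichlet_eigenvalues \<Omega> F B \<eta>"
    and "z > 0"
  shows "riesz_mean_1 \<eta> z \<le>
    measure lebesgue F / (2 * pi) * z\<^sup>2 - 1 / 2 * z + pi / (2 * measure lebesgue F)"
proof -
  obtain a b where F: "F = {a..b}" and "lower_domain \<Omega> B a b"
    using admissible_domain_imp_lower_domain[OF assms(1,2)] by blast
  interpret lower_domain \<Omega> B a b by fact
  define q where "q = pi / (b - a)"
  have q: "q > 0" using a_less_b by (simp add: q_def)
  have ge: "real (Suc j) * q \<le> \<eta> j" for j
    using eigenvalue_ge_freq[of \<eta> j] assms(3) by (simp add: F freq_def q_def)
  have "filterlim \<eta> at_top sequentially"
    using assms(3) by (simp add: steklov_dirichlet_eigenvalues_def)
  then obtain N where N: "\<And>j. N \<le> j \<Longrightarrow> z < \<eta> j"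
    unfolding filterlim_at_top_dense eventually_sequentially by blast
  \<comment> \<open>From \<open>N\<close> on every eigenvalue exceeds \<open>z\<close>, so the
    series is a finite sum and can be compared term by term.\<close>
  have "riesz_mean_1 \<eta> z = (\<Sum>j<N. max 0 (z - \<eta> j))"
    unfolding riesz_mean_1_def using N by (intro suminf_finite) (auto simp: not_less less_imp_le)
  also have "\<dots> \<le> (\<Sum>j<N. max 0 (z - real (Suc j) * q))"
    using ge by (intro sum_mono max.mono diff_left_mono) auto
  also have "\<dots> \<le> z\<^sup>2 / (2 * q) - z / 2 + q / 2"
    by (rule sum_max_arithmetic_le[OF q])
  also have "\<dots> = measure lebesgue F / (2 * pi) * z\<^sup>2 - 1 / 2 * z + pi / (2 * measure lebesgue F)"
    using a_less_b by (simp add: F q_def algebra_simps)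
  finally show ?thesis .
qed

end
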